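(* Let $L$ be a non-degenerate even lattice of rank $3$. For $\alpha\in\mathrm{Cl}^{\pm}(L)^\times$ and $v\in L$, we have $\alpha v\alpha^{-1}\in L$ (the product being taken in $\mathrm{Cl}(L)$). Moreover, there is an isomorphism of groups $$\mathrm{Cl}^{\pm}(L)^\times/\{\pm1\}\ \xrightarrow{\ \sim\ }\ O_D(L)$$ induced by $$\alpha\mapsto h_\alpha:=(v\mapsto\varepsilon_\alpha\cdot\alpha v\alpha^{-1}),\qquad \varepsilon_\alpha=\begin{cases}1&\text{if }\alpha\in\mathrm{Cl}^+(L),\\-1&\text{if }\alpha\in\mathrm{Cl}^-(L),\end{cases}$$ and $\det(h_\alpha)=\varepsilon_\alpha$.
   Context: A lattice is a free $\mathbb Z$-module of finite rank with a $\mathbb Z$-valued symmetric bilinear form $\langle\,,\rangle$; it is even if $\langle x,x\rangle\in2\mathbb Z$ for all $x$. $A(L)=L^\vee/L$ is the discriminant group with discriminant form $q(L):x\mapsto\langle x,x\rangle\in\mathbb Q/2\mathbb Z$, and $O_D(L)=\ker(O(L)\to O(q(L)))$ is the group of isometries acting trivially on $A(L)$. The Clifford algebra is $\mathrm{Cl}(L)=T(L)/I_L$, where $T(L)$ is the tensor algebra over $\mathbb Z$ and $I_L$ is the two-sided ideal generated by $v\otimes v-\frac12\langle v,v\rangle$, $v\in L$. $\mathrm{Cl}^+(L)$ and $\mathrm{Cl}^-(L)$ are its even and odd parts; $L\subset\mathrm{Cl}^-(L)$. $\alpha\mapsto\alpha^*$ is the anti-automorphism of $\mathrm{Cl}(L)$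 induced by $v_1\otimes\cdots\otimes v_k\mapsto v_k\otimes\cdots\otimes v_1$, and $N\alpha=\alpha\alpha^*$, which is an integer for $\alpha\in\mathrm{Cl}^+(L)\cup\mathrm{Cl}^-(L)$ when $L$ has rank $3$. Finally $$\mathrm{Cl}^{\pm}(L)^\times=\{\alpha\in\mathrm{Cl}^+(L)\cup\mathrm{Cl}^-(L): N\alpha=\pm1\}.$$ *)

theory Defs
  imports
    "HOL-Algebra.QuotRing"
    "HOL-Algebra.Bij"
    "HOL-Library.Poly_Mapping"
    "Jordan_Normal_Form.Determinant"
begin

section \<open>Lattices\<close>

definition ordered_basis :: "(int \<Rightarrow> 'a::ab_group_add \<Rightarrow> 'a) \<Rightarrow> 'a list \<Rightarrow> bool" where
  "ordered_basis scale bs \<longleftrightarrow>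
     distinct bs \<and> \<not> Modules.module.dependent scale (set bs) \<and> Modules.module.span scale (set bs) = UNIV"

definition has_rank :: "(int \<Rightarrow> 'a::ab_group_add \<Rightarrow> 'a) \<Rightarrow> nat \<Rightarrow> bool" where
  "has_rank scale n \<longleftrightarrow> (\<exists>bs. ordered_basis scale bs \<and> length bs = n)"

text \<open>The underlying \<open>\<int>\<close>-module of the lattice is a whole type \<open>'a\<close> with scalar
  multiplication \<open>scale\<close>.\<close>

locale int_lattice = Modules.module scale
  for scale :: "int \<Rightarrow> 'a::ab_group_add \<Rightarrow> 'a" +
  fixes form :: "'a \<Rightarrow> 'a \<Rightarrow> int"
  assumes free_finite_rank: "\<exists>n. has_rank scale n"
    and form_linear: "Modules.module_hom scale (*) (form x)"
    and form_sym: "form x y = form y x"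

definition even_form :: "('a \<Rightarrow> 'a \<Rightarrow> int) \<Rightarrow> bool" where
  "even_form form \<longleftrightarrow> (\<forall>x. even (form x x))"

definition nondegenerate_form :: "('a::zero \<Rightarrow> 'a \<Rightarrow> int) \<Rightarrow> bool" where
  "nondegenerate_form form \<longleftrightarrow> (\<forall>x. (\<forall>y. form x y = 0) \<longrightarrow> x = 0)"

definition endo_matrix :: "(int \<Rightarrow> 'a::ab_group_add \<Rightarrow> 'a) \<Rightarrow> 'a list \<Rightarrow> ('a \<Rightarrow> 'a) \<Rightarrow> int mat" where
  "endo_matrix scale bs f =
     mat (length bs) (length bs)
       (\<lambda>(i, j). Modules.module.representation scale (set bs) (f (bs ! j)) (bs ! i))"

definition orthogonal_group ::
    "(int \<Rightarrow> 'a::ab_group_add \<Rightarrow> 'a) \<Rightarrow> ('a \<Rightarrow> 'a \<Rightarrow> int) \<Rightarrow> ('a \<Rightarrow> 'a) monoid" where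
  "orthogonal_group scale form =
     \<lparr>carrier = {g. bij g \<and> Modules.module_hom scale scale g \<and> (\<forall>x y. form (g x) (g y) = form x y)},
      monoid.mult = (\<circ>), one = id\<rparr>"

section \<open>The discriminant group and the discriminant form\<close>

text \<open>The dual lattice is \<open>Hom(L, \<int>)\<close>, and \<open>L\<close> sits inside it (for a non-degenerate form) as the
  set of functionals \<open>form x\<close>.\<close>

definition dual_lattice :: "(int \<Rightarrow> 'a::ab_group_add \<Rightarrow> 'a) \<Rightarrow> ('a \<Rightarrow> int) monoid" where
  "dual_lattice scale =
     \<lparr>carrier = {\<phi>. Modules.module_hom scale (*) \<phi>}, monoid.mult = (\<lambda>\<phi> \<psi> x. \<phi> x + \<psi> x), one = (\<lambda>_. 0)\<rparr>"

definition disc_group ::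
    "(int \<Rightarrow> 'a::ab_group_add \<Rightarrow> 'a) \<Rightarrow> ('a \<Rightarrow> 'a \<Rightarrow> int) \<Rightarrow> ('a \<Rightarrow> int) set monoid" where
  "disc_group scale form = dual_lattice scale Mod range form"

text \<open>The \<open>\<rat>\<close>-valued extension of the form to the dual lattice: if \<open>n \<phi> = form v\<close>, then \<open>\<phi>\<close>
  corresponds to the element \<open>v / n\<close> of \<open>L \<otimes> \<rat>\<close>, whose pairing with \<open>\<psi>\<close> is \<open>\<psi> v / n\<close>.\<close>

definition dual_form :: "('a \<Rightarrow> 'a \<Rightarrow> int) \<Rightarrow> ('a \<Rightarrow> int) \<Rightarrow> ('a \<Rightarrow> int) \<Rightarrow> rat" where
  "dual_form form \<phi> \<psi> =
     (THE r. \<exists>n v. n \<noteq> 0 \<and> (\<forall>y. n * \<phi> y = form v y) \<and> r = of_int (\<psi> v) / of_int n)"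

text \<open>The value in \<open>\<rat> / 2\<int>\<close> is represented as a coset of \<open>2\<int>\<close> in \<open>\<rat>\<close>.\<close>

definition disc_form :: "('a \<Rightarrow> 'a \<Rightarrow> int) \<Rightarrow> ('a \<Rightarrow> int) set \<Rightarrow> rat set" where
  "disc_form form X = {dual_form form \<phi> \<phi> + 2 * of_int k | \<phi> k. \<phi> \<in> X}"

definition disc_orthogonal_group ::
    "(int \<Rightarrow> 'a::ab_group_add \<Rightarrow> 'a) \<Rightarrow> ('a \<Rightarrow> 'a \<Rightarrow> int) \<Rightarrow> (('a \<Rightarrow> int) set \<Rightarrow> ('a \<Rightarrow> int) set) monoid" where
  "disc_orthogonal_group scale form =
     AutoGroup (disc_group scale form)
       \<lparr>carrier := {f \<in> auto (disc_group scale form).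
          \<forall>X \<in> carrier (disc_group scale form). disc_form form (f X) = disc_form form X}\<rparr>"

text \<open>An isometry \<open>g\<close> acts on \<open>Hom(L, \<int>)\<close> by \<open>\<phi> \<mapsto> \<phi> \<circ> g\<inverse>\<close>; this extends
  \<open>form x \<mapsto> form (g x)\<close>.\<close>

definition disc_action ::
    "(int \<Rightarrow> 'a::ab_group_add \<Rightarrow> 'a) \<Rightarrow> ('a \<Rightarrow> 'a \<Rightarrow> int) \<Rightarrow> ('a \<Rightarrow> 'a) \<Rightarrow>
      ('a \<Rightarrow> int) set \<Rightarrow> ('a \<Rightarrow> int) set" where
  "disc_action scale form g =
     (\<lambda>X \<in> carrier (disc_group scale form). (\<lambda>\<phi>. \<phi> \<circ> inv_into UNIV g) ` X)"

definition disc_kernel ::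
    "(int \<Rightarrow> 'a::ab_group_add \<Rightarrow> 'a) \<Rightarrow> ('a \<Rightarrow> 'a \<Rightarrow> int) \<Rightarrow> ('a \<Rightarrow> 'a) monoid" where
  "disc_kernel scale form =
     (orthogonal_group scale form)
       \<lparr>carrier := kernel (orthogonal_group scale form) (disc_orthogonal_group scale form)
          (disc_action scale form)\<rparr>"

section \<open>The tensor algebra\<close>

datatype 'a tword = TWord (letters: "'a list")

instantiation tword :: (type) monoid_add
begin
definition zero_tword :: "'a tword" where "0 = TWord []"
definition plus_tword :: "'a tword \<Rightarrow> 'a tword \<Rightarrow> 'a tword" where
  "u + w = TWord (letters u @ letters w)"
instance by standard (auto simp: zero_tword_def plus_tword_def)
end

definition free_ring :: "('a tword \<Rightarrow>\<^sub>0 int) ring" where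
  "free_ring = \<lparr>carrier = UNIV, monoid.mult = (*), one = 1, zero = 0, add = (+)\<rparr>"

text \<open>The free ring on the set \<open>L\<close> is the free abelian group on all words \<open>v\<^sub>1 \<dots> v\<^sub>k\<close>, and the ideal
  below is its subgroup generated by the relations saying that words are additive in each
  letter. Its quotient is therefore the direct sum of the tensor powers of \<open>L\<close> over \<open>\<int>\<close>, with
  multiplication by concatenation; homogeneity over \<open>\<int>\<close> follows from additivity.\<close>

definition tensor_ideal :: "('a::ab_group_add tword \<Rightarrow>\<^sub>0 int) set" where
  "tensor_ideal = Idl\<^bsub>free_ring\<^esub>
     {frag_of (TWord [x + y]) - frag_of (TWord [x]) - frag_of (TWord [y]) | x y. True}"

definition tensor_algebra :: "('a::ab_group_add tword \<Rightarrow>\<^sub>0 int) set ring" where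
  "tensor_algebra = free_ring Quot tensor_ideal"

definition tensor_class :: "('a::ab_group_add tword \<Rightarrow>\<^sub>0 int) \<Rightarrow> ('a tword \<Rightarrow>\<^sub>0 int) set" where
  "tensor_class x = tensor_ideal +>\<^bsub>free_ring\<^esub> x"

definition tensor_vec :: "'a::ab_group_add \<Rightarrow> ('a tword \<Rightarrow>\<^sub>0 int) set" where
  "tensor_vec v = tensor_class (frag_of (TWord [v]))"

section \<open>The Clifford algebra\<close>

type_synonym 'a cliff = "('a tword \<Rightarrow>\<^sub>0 int) set set"

definition clifford_ideal :: "('a::ab_group_add \<Rightarrow> 'a \<Rightarrow> int) \<Rightarrow> 'a cliff" where
  "clifford_ideal form = Idl\<^bsub>tensor_algebra\<^esub>
     {tensor_vec v \<otimes>\<^bsub>tensor_algebra\<^esub> tensor_vec v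
        \<ominus>\<^bsub>tensor_algebra\<^esub> [(form v v div 2)] \<cdot>\<^bsub>tensor_algebra\<^esub> \<one>\<^bsub>tensor_algebra\<^esub> | v. True}"

definition clifford :: "('a::ab_group_add \<Rightarrow> 'a \<Rightarrow> int) \<Rightarrow> 'a cliff ring" where
  "clifford form = tensor_algebra Quot clifford_ideal form"

definition clifford_class :: "('a::ab_group_add \<Rightarrow> 'a \<Rightarrow> int) \<Rightarrow> ('a tword \<Rightarrow>\<^sub>0 int) set \<Rightarrow> 'a cliff" where
  "clifford_class form t = clifford_ideal form +>\<^bsub>tensor_algebra\<^esub> t"

definition clifford_vec :: "('a::ab_group_add \<Rightarrow> 'a \<Rightarrow> int) \<Rightarrow> 'a \<Rightarrow> 'a cliff" where
  "clifford_vec form v = clifford_class form (tensor_vec v)"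

definition clifford_even :: "('a::ab_group_add \<Rightarrow> 'a \<Rightarrow> int) \<Rightarrow> 'a cliff set" where
  "clifford_even form =
     {clifford_class form (tensor_class x) | x. \<forall>w \<in> Poly_Mapping.keys x. even (length (letters w))}"

definition clifford_odd :: "('a::ab_group_add \<Rightarrow> 'a \<Rightarrow> int) \<Rightarrow> 'a cliff set" where
  "clifford_odd form =
     {clifford_class form (tensor_class x) | x. \<forall>w \<in> Poly_Mapping.keys x. odd (length (letters w))}"

definition free_reverse :: "('a tword \<Rightarrow>\<^sub>0 int) \<Rightarrow> ('a tword \<Rightarrow>\<^sub>0 int)" where
  "free_reverse = frag_extend (\<lambda>w. frag_of (TWord (rev (letters w))))"

text \<open>Word reversal is an involution that preserves both ideals, so the induced map on a quotient
  sends a coset to its elementwise image.\<close>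

definition clifford_star :: "'a cliff \<Rightarrow> 'a cliff" where
  "clifford_star \<alpha> = (\<lambda>t. free_reverse ` t) ` \<alpha>"

definition clifford_norm :: "('a::ab_group_add \<Rightarrow> 'a \<Rightarrow> int) \<Rightarrow> 'a cliff \<Rightarrow> 'a cliff" where
  "clifford_norm form \<alpha> = \<alpha> \<otimes>\<^bsub>clifford form\<^esub> clifford_star \<alpha>"

definition clifford_pm1 :: "('a::ab_group_add \<Rightarrow> 'a \<Rightarrow> int) \<Rightarrow> 'a cliff set" where
  "clifford_pm1 form = {\<one>\<^bsub>clifford form\<^esub>, \<ominus>\<^bsub>clifford form\<^esub> \<one>\<^bsub>clifford form\<^esub>}"

definition clifford_pm_group :: "('a::ab_group_add \<Rightarrow> 'a \<Rightarrow> int) \<Rightarrow> 'a cliff monoid" where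
  "clifford_pm_group form =
     \<lparr>carrier = {\<alpha> \<in> clifford_even form \<union> clifford_odd form. clifford_norm form \<alpha> \<in> clifford_pm1 form},
      monoid.mult = monoid.mult (clifford form), one = \<one>\<^bsub>clifford form\<^esub>\<rparr>"

definition clifford_sign :: "('a::ab_group_add \<Rightarrow> 'a \<Rightarrow> int) \<Rightarrow> 'a cliff \<Rightarrow> int" where
  "clifford_sign form \<alpha> = (if \<alpha> \<in> clifford_even form then 1 else - 1)"

definition clifford_conj :: "('a::ab_group_add \<Rightarrow> 'a \<Rightarrow> int) \<Rightarrow> 'a cliff \<Rightarrow> 'a \<Rightarrow> 'a cliff" where
  "clifford_conj form \<alpha> v =
     \<alpha> \<otimes>\<^bsub>clifford form\<^esub> clifford_vec form v \<otimes>\<^bsub>clifford form\<^esub> inv\<^bsub>clifford form\<^esub> \<alpha>"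

definition clifford_isometry :: "('a::ab_group_add \<Rightarrow> 'a \<Rightarrow> int) \<Rightarrow> 'a cliff \<Rightarrow> 'a \<Rightarrow> 'a" where
  "clifford_isometry form \<alpha> v =
     (THE w. clifford_vec form w = [(clifford_sign form \<alpha>)] \<cdot>\<^bsub>clifford form\<^esub> clifford_conj form \<alpha> v)"

end

theory Submission
  imports Defs
begin

text \<open>
  Write \<open>*\<close> for the reversal. An odd element fixed by \<open>*\<close> lies in \<open>L\<close> and an even one lies in \<open>\<int>\<close>;
  hence \<open>N \<alpha> = \<alpha> \<alpha>*\<close> is an integer and \<open>\<alpha> v \<alpha>* \<in> L\<close> for homogeneous \<open>\<alpha>\<close>.
  The element \<open>\<delta> = e\<^sub>1 e\<^sub>2 e\<^sub>3 - e\<^sub>3 e\<^sub>2 e\<^sub>1\<close> is central with \<open>\<delta>\<^sup>2 \<noteq> 0\<close> an integer, and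
  \<open>x y z - z y x\<close> is an alternating trilinear function of \<open>x, y, z \<in> L\<close>, hence a determinant times
  \<open>\<delta>\<close>. As \<open>\<delta>\<close> is central, this gives the determinant of \<open>h\<^sub>\<alpha>\<close>.

  For even \<open>\<beta>\<close> there is a functional \<open>\<phi>\<^sub>\<beta>\<close> on \<open>L\<close> with \<open>v \<beta> - \<beta>* v = \<phi>\<^sub>\<beta>(v) \<delta>\<close>. Every functional
  is of this form, and \<open>\<langle>w, _\<rangle>\<close> is the one that belongs to \<open>w \<delta>\<close>. Put \<open>\<beta>' = \<beta>\<close> if \<open>\<alpha>\<close> is even and
  \<open>\<beta>' = \<beta>*\<close> if \<open>\<alpha>\<close> is odd. Then \<open>\<alpha> \<beta> - \<beta>' \<alpha> = z\<^sub>\<beta> \<delta>\<close> with \<open>z\<^sub>\<beta> \<alpha>* \<in> L\<close>, and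
      if \<open>g(v) = \<epsilon> \<alpha> v \<alpha>\<inverse>\<close> then
  \<open>N \<alpha> (\<phi>\<^sub>\<beta> \<circ> g\<inverse> - \<phi>\<^sub>\<beta>) = \<epsilon> \<langle>z\<^sub>\<beta> \<alpha>*, _\<rangle>\<close>. If \<open>N \<alpha> = \<plusminus>1\<close>, then \<open>g\<close> acts trivially on the
  discriminant group.

  Conversely, by Cartan and Dieudonne every isometry \<open>g\<close> is \<open>v \<mapsto> \<epsilon> \<alpha> v \<alpha>\<inverse>\<close> for a homogeneous \<open>\<alpha>\<close> of
  nonzero norm; its parity can be adjusted by the central odd element \<open>\<delta>\<close>, and \<open>\<alpha>\<close> can be taken
  primitive. If \<open>g\<close> acts trivially on the discriminant group, then \<open>z\<^sub>\<beta> \<alpha>* \<in>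
      N \<alpha> \<cdot> L\<close>, so \<open>N \<alpha>\<close> divides
  all \<open>z\<^sub>\<beta> z\<^sub>\<gamma>*\<close>. In coordinates this forces every prime factor of \<open>N \<alpha>\<close> to divide \<open>\<alpha>\<close>, so
  \<open>N \<alpha> = \<plusminus>1\<close>.
\<close>

section \<open>A coordinate model of the Clifford algebra\<close>

text \<open>Coordinates with respect to
  \<open>1, e\<^sub>2 e\<^sub>3, e\<^sub>1 e\<^sub>3, e\<^sub>1 e\<^sub>2, e\<^sub>1, e\<^sub>2, e\<^sub>3, e\<^sub>1 e\<^sub>2 e\<^sub>3\<close>, in this order.\<close>

datatype cl_coords = CV int int int int int int int int

instantiation cl_coords :: ab_group_add
begin

definition zero_cl_coords :: cl_coords where "0 = CV 0 0 0 0 0 0 0 0"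

fun plus_cl_coords :: "cl_coords \<Rightarrow> cl_coords \<Rightarrow> cl_coords" where
  "CV x0 x1 x2 x3 y1 y2 y3 y0 + CV x0' x1' x2' x3' y1' y2' y3' y0' =
     CV (x0 + x0') (x1 + x1') (x2 + x2') (x3 + x3') (y1 + y1') (y2 + y2') (y3 + y3') (y0 + y0')"

fun uminus_cl_coords :: "cl_coords \<Rightarrow> cl_coords" where
  "- CV x0 x1 x2 x3 y1 y2 y3 y0 = CV (- x0) (- x1) (- x2) (- x3) (- y1) (- y2) (- y3) (- y0)"

definition minus_cl_coords :: "cl_coords \<Rightarrow> cl_coords \<Rightarrow> cl_coords" where
  "x - y = x + (- y)" for x y :: cl_coords

instance
proof
  fix x y z :: cl_coords
  show "x + y + z = x + (y + z)" by (cases x; cases y; cases z) simp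
  show "x + y = y + x" by (cases x; cases y) simp
  show "0 + x = x" by (cases x) (simp add: zero_cl_coords_def)
  show "- x + x = 0" by (cases x) (simp add: zero_cl_coords_def)
  show "x - y = x + - y" by (rule minus_cl_coords_def)
qed

end

fun cscale :: "int \<Rightarrow> cl_coords \<Rightarrow> cl_coords" where
  "cscale n (CV x0 x1 x2 x3 y1 y2 y3 y0) =
     CV (n * x0) (n * x1) (n * x2) (n * x3) (n * y1) (n * y2) (n * y3) (n * y0)"

lemma minus_CV [simp]:
  "CV x0 x1 x2 x3 y1 y2 y3 y0 - CV x0' x1' x2' x3' y1' y2' y3' y0' =
     CV (x0 - x0') (x1 - x1') (x2 - x2') (x3 - x3') (y1 - y1') (y2 - y2') (y3 - y3') (y0 - y0')"
  by (simp add: minus_cl_coords_def)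

lemma CV_eq_0_iff [simp]:
  "CV x0 x1 x2 x3 y1 y2 y3 y0 = 0 \<longleftrightarrow>
     x0 = 0 \<and> x1 = 0 \<and> x2 = 0 \<and> x3 = 0 \<and> y1 = 0 \<and> y2 = 0 \<and> y3 = 0 \<and> y0 = 0"
  by (simp add: zero_cl_coords_def)

lemma cscale_0_left [simp]: "cscale 0 v = 0"
  by (cases v) simp

lemma cscale_1_left [simp]: "cscale 1 v = v"
  by (cases v) simp

lemma cscale_add_left: "cscale (m + n) v = cscale m v + cscale n v"
  by (cases v) (simp add: algebra_simps)

lemma cscale_diff_left: "cscale (m - n) v = cscale m v - cscale n v"
  by (cases v) (simp add: algebra_simps)

lemma cscale_eq_0_iff: "cscale n v = 0 \<longleftrightarrow> n = 0 \<or> v = 0"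
  by (cases v) auto

text \<open>A descent measure: passing from a nonzero \<open>cscale p v\<close> with
  \<open>p\<close> prime to \<open>v\<close> makes it strictly smaller, so an element of minimal
  size is primitive.\<close>

fun csize :: "cl_coords \<Rightarrow> nat" where
  "csize (CV x0 x1 x2 x3 y1 y2 y3 y0) =
     nat \<bar>x0\<bar> + nat \<bar>x1\<bar> + nat \<bar>x2\<bar> + nat \<bar>x3\<bar> + nat \<bar>y1\<bar> + nat \<bar>y2\<bar> + nat \<bar>y3\<bar> + nat \<bar>y0\<bar>"

lemma csize_cscale: "csize (cscale p v) = nat \<bar>p\<bar> * csize v"
  by (cases v) (simp add: nat_abs_mult_distrib distrib_left)

lemma csize_0: "csize v = 0 \<longleftrightarrow> v = 0"
  by (cases v) simp

text \<open>The Clifford algebra is modelled by its left regular representation, so that its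
  multiplication is composition of operators and associativity is free.\<close>

typedef coord_op = "{f :: cl_coords \<Rightarrow> cl_coords. \<forall>x y. f (x + y) = f x + f y}"
  morphisms app Cop
  by (rule exI[of _ id]) simp

lemma app_add_right [simp]: "app f (x + y) = app f x + app f y"
  using app[of f] by simp

lemma app_zero_right [simp]: "app f 0 = 0"
  using app_add_right[of f 0 0] by simp

lemma app_uminus_right [simp]: "app f (- x) = - app f x"
  using app_add_right[of f x "- x"] by (simp add: eq_neg_iff_add_eq_0 add.commute)

lemma app_diff_right [simp]: "app f (x - y) = app f x - app f y"
  using app_add_right[of f x "- y"] by simp

lemma app_Cop: "(\<And>x y. f (x + y) = f x + f y) \<Longrightarrow> app (Cop f) = f"
  by (rule Cop_inverse) simp

lemma coord_op_eqI: "(\<And>v. app f v = app g v) \<Longrightarrow> f = g"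
  by (simp add: app_inject[symmetric] fun_eq_iff)

instantiation coord_op :: ring_1
begin

definition zero_coord_op :: coord_op where "0 = Cop (\<lambda>_. 0)"
definition one_coord_op :: coord_op where "1 = Cop (\<lambda>v. v)"
definition plus_coord_op :: "coord_op \<Rightarrow> coord_op \<Rightarrow> coord_op" where
    "f + g = Cop (\<lambda>v. app f v + app g v)"
definition uminus_coord_op :: "coord_op \<Rightarrow> coord_op" where "- f = Cop (\<lambda>v. - app f v)"
definition minus_coord_op :: "coord_op \<Rightarrow> coord_op \<Rightarrow> coord_op" where
    "f - g = Cop (\<lambda>v. app f v - app g v)"
definition times_coord_op :: "coord_op \<Rightarrow> coord_op \<Rightarrow> coord_op" where
    "f * g = Cop (\<lambda>v. app f (app g v))"

lemma app_zero [simp]: "app 0 v = 0"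
  by (simp add: zero_coord_op_def app_Cop)

lemma app_one [simp]: "app 1 v = v"
  by (simp add: one_coord_op_def app_Cop)

lemma app_add [simp]: "app (f + g) v = app f v + app g v"
  by (simp add: plus_coord_op_def app_Cop algebra_simps)

lemma app_uminus [simp]: "app (- f) v = - app f v"
  by (simp add: uminus_coord_op_def app_Cop)

lemma app_diff [simp]: "app (f - g) v = app f v - app g v"
  by (simp add: minus_coord_op_def app_Cop algebra_simps)

lemma app_mult [simp]: "app (f * g) v = app f (app g v)"
  by (simp add: times_coord_op_def app_Cop)

instance
proof
  show "(0 :: coord_op) \<noteq> 1"
  proof
    assume "(0 :: coord_op) = 1"
    then have "app 0 (CV 1 0 0 0 0 0 0 0) = app 1 (CV 1 0 0 0 0 0 0 0)" by simp
    then show False by (simp add: zero_cl_coords_def)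
  qed
qed (auto intro!: coord_op_eqI simp: algebra_simps)

end

lemma app_of_int [simp]: "app (of_int n) v = cscale n v"
proof (induction n rule: int_induct[where k = 0])
  case (step1 i) then show ?case by (simp add: cscale_add_left)
next
  case (step2 i) then show ?case by (simp add: cscale_diff_left)
qed simp

lemma of_int_mult_eq_0_iff: "of_int n * x = 0 \<longleftrightarrow> n = 0 \<or> x = 0" for x :: coord_op
proof
  assume *: "of_int n * x = 0"
  have "cscale n (app x v) = 0" for v
    using arg_cong[OF *, of "\<lambda>f. app f v"] by simp
  then show "n = 0 \<or> x = 0"
    by (auto simp: cscale_eq_0_iff intro: coord_op_eqI)
qed auto

lemma of_int_mult_cancel: "of_int n * x = of_int n * y \<longleftrightarrow> n = 0 \<or> x = y" for x y :: coord_op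
  using of_int_mult_eq_0_iff[of n "x - y"] by (simp add: right_diff_distrib)

instance coord_op :: ring_char_0
proof
  show "inj (of_nat :: nat \<Rightarrow> coord_op)"
  proof (rule injI)
    fix m n :: nat
    assume "(of_nat m :: coord_op) = of_nat n"
    then have "app (of_int (int m)) (CV 1 0 0 0 0 0 0 0) =
        app (of_int (int n)) (CV 1 0 0 0 0 0 0 0)"
      by simp
    then show "m = n" unfolding app_of_int by simp
  qed
qed

text \<open>Formed in an arbitrary ring, so that the same eight monomials can be taken among
  operators, where the Clifford relations hold, and in the free ring, where they hold only modulo an
  ideal.\<close>

fun lin_comb :: "'r::ring_1 \<Rightarrow> 'r \<Rightarrow> 'r \<Rightarrow> cl_coords \<Rightarrow> 'r" where
  "lin_comb X1 X2 X3 (CV x0 x1 x2 x3 y1 y2 y3 y0) =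
     of_int x0 + of_int x1 * (X2 * X3) + of_int x2 * (X1 * X3) + of_int x3 * (X1 * X2) +
     of_int y1 * X1 + of_int y2 * X2 + of_int y3 * X3 + of_int y0 * (X1 * (X2 * X3))"

lemma lin_comb_zero [simp]: "lin_comb X1 X2 X3 0 = 0"
  by (simp add: zero_cl_coords_def)

lemma lin_comb_add: "lin_comb X1 X2 X3 (v + w) = lin_comb X1 X2 X3 v + lin_comb X1 X2 X3 w"
  by (cases v; cases w) (simp add: algebra_simps)

lemma lin_comb_uminus: "lin_comb X1 X2 X3 (- v) = - lin_comb X1 X2 X3 v"
  by (cases v) simp

lemma lin_comb_diff: "lin_comb X1 X2 X3 (v - w) = lin_comb X1 X2 X3 v - lin_comb X1 X2 X3 w"
  by (cases v; cases w) (simp add: algebra_simps)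

lemma lin_comb_cscale: "lin_comb X1 X2 X3 (cscale n v) = of_int n * lin_comb X1 X2 X3 v"
  by (cases v) (simp add: distrib_left mult.assoc)

lemma of_int_left_commute: "x * (of_int n * y) = of_int n * (x * y)" for x y :: "'r::ring_1"
  by (metis mult.assoc mult_of_int_commute)

text \<open>The coefficients of the quadratic form
  \<open>a x\<^sub>1\<^sup>2 + b x\<^sub>2\<^sup>2 + c x\<^sub>3\<^sup>2 + r x\<^sub>2 x\<^sub>3 + s x\<^sub>1 x\<^sub>3 + t x\<^sub>1 x\<^sub>2\<close>.\<close>

locale ternary_form =
  fixes a b c r s t :: int
begin

text \<open>Left multiplication by the basis vectors, computed with \<open>e\<^sub>2 e\<^sub>1 = t - e\<^sub>1 e\<^sub>2\<close>,
  \<open>e\<^sub>3 e\<^sub>1 = s - e\<^sub>1 e\<^sub>3\<close> and \<open>e\<^sub>3 e\<^sub>2 = r - e\<^sub>2 e\<^sub>3\<close>.\<close>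

fun op1 op2 op3 :: "cl_coords \<Rightarrow> cl_coords" where
  "op1 (CV x0 x1 x2 x3 y1 y2 y3 y0) =
     CV (a * y1) (a * y0) y3 y2 x0 (a * x3) (a * x2) x1"
| "op2 (CV x0 x1 x2 x3 y1 y2 y3 y0) =
     CV (t * y1 + b * y2) (y3 + t * y0) (- b * y0) (- y1)
        (- b * x3) (x0 + t * x3) (t * x2 + b * x1) (- x2)"
| "op3 (CV x0 x1 x2 x3 y1 y2 y3 y0) =
     CV (s * y1 + r * y2 + c * y3) (- y2 + s * y0) (- y1 - r * y0) (c * y0)
        (- r * x3 - c * x2) (s * x3 - c * x1) (x0 + s * x2 + r * x1) x3"

definition E1 :: coord_op where "E1 = Cop op1"
definition E2 :: coord_op where "E2 = Cop op2"
definition E3 :: coord_op where "E3 = Cop op3"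

lemma app_E [simp]: "app E1 v = op1 v" "app E2 v = op2 v" "app E3 v = op3 v"
proof -
  have "op1 (x + y) = op1 x + op1 y" "op2 (x + y) = op2 x + op2 y" "op3 (x + y) = op3 x + op3 y"
      for x y
    by (cases x; cases y; simp add: algebra_simps)+
  then show "app E1 v = op1 v" "app E2 v = op2 v" "app E3 v = op3 v"
    by (simp_all add: E1_def E2_def E3_def app_Cop)
qed

lemma E_clifford_relations:
  "E1 * E1 = of_int a" "E2 * E2 = of_int b" "E3 * E3 = of_int c"
  "E2 * E1 = of_int t - E1 * E2" "E3 * E1 = of_int s - E1 * E3" "E3 * E2 = of_int r - E2 * E3"
proof -
  have "app (E1 * E1) v = app (of_int a) v" "app (E2 * E2) v = app (of_int b) v"
      "app (E3 * E3) v = app (of_int c) v"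
    "app (E2 * E1) v = app (of_int t - E1 * E2) v" "app (E3 * E1) v = app (of_int s - E1 * E3) v"
    "app (E3 * E2) v = app (of_int r - E2 * E3) v" for v
    by (cases v; simp add: algebra_simps)+
  then show
  "E1 * E1 = of_int a" "E2 * E2 = of_int b" "E3 * E3 = of_int c"
  "E2 * E1 = of_int t - E1 * E2" "E3 * E1 = of_int s - E1 * E3" "E3 * E2 = of_int r - E2 * E3"
   by (blast intro: coord_op_eqI)+
qed

definition lin :: "cl_coords \<Rightarrow> coord_op" where "lin = lin_comb E1 E2 E3"

lemma lin_CV:
  "lin (CV x0 x1 x2 x3 y1 y2 y3 y0) =
     of_int x0 + of_int x1 * (E2 * E3) + of_int x2 * (E1 * E3) + of_int x3 * (E1 * E2) +
     of_int y1 * E1 + of_int y2 * E2 + of_int y3 * E3 + of_int y0 * (E1 * (E2 * E3))"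
  by (simp add: lin_def)

definition unit_coords :: cl_coords where "unit_coords = CV 1 0 0 0 0 0 0 0"

text \<open>Each monomial, as an operator, sends 1 to its own coordinate vector. Evaluation at 1
  therefore recovers coordinates, and the eight monomials are independent over the integers.\<close>

lemma app_lin_unit_coords [simp]: "app (lin v) unit_coords = v"
  by (cases v) (simp add: unit_coords_def lin_CV)

lemma lin_inject [simp]: "lin v = lin w \<longleftrightarrow> v = w"
  by (metis app_lin_unit_coords)

lemma lin_zero: "lin 0 = 0"
  and lin_add: "lin (v + w) = lin v + lin w"
  and lin_uminus: "lin (- v) = - lin v"
  and lin_diff: "lin (v - w) = lin v - lin w"
  and lin_cscale: "lin (cscale n v) = of_int n * lin v"
  by (simp_all add: lin_def lin_comb_add lin_comb_uminus lin_comb_diff lin_comb_cscale)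

text \<open>The brackets \<open>Rij\<close> are the defining relations of the Clifford algebra: the lemma applies both
  to operators that satisfy them and to the free ring modulo them.\<close>

lemma mult_lin_comb:
  fixes X1 X2 X3 :: "'r::ring_1"
  defines "R11 \<equiv> X1 * X1 - of_int a" and "R22 \<equiv> X2 * X2 - of_int b" and "R33 \<equiv> X3 * X3 - of_int c"
    and "R21 \<equiv> X2 * X1 + X1 * X2 - of_int t" and "R31 \<equiv> X3 * X1 + X1 * X3 - of_int s"
    and "R32 \<equiv> X3 * X2 + X2 * X3 - of_int r"
  shows
    "X1 * lin_comb X1 X2 X3 (CV x0 x1 x2 x3 y1 y2 y3 y0) - lin_comb X1 X2 X3 (op1 (CV x0 x1 x2 x3
        y1 y2 y3 y0)) =
       of_int y1 * R11 + of_int x3 * (R11 * X2) + of_int x2 * (R11 * X3) +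
           of_int y0 * (R11 * (X2 * X3))"
    "X2 * lin_comb X1 X2 X3 (CV x0 x1 x2 x3 y1 y2 y3 y0) - lin_comb X1 X2 X3 (op2 (CV x0 x1 x2 x3
        y1 y2 y3 y0)) =
       of_int y1 * R21 + of_int y2 * R22 + of_int x3 * (R21 * X2 - X1 * R22) +
           of_int x2 * (R21 * X3) +
       of_int x1 * (R22 * X3) + of_int y0 * (R21 * (X2 * X3) - X1 * (R22 * X3))"
    "X3 * lin_comb X1 X2 X3 (CV x0 x1 x2 x3 y1 y2 y3 y0) - lin_comb X1 X2 X3 (op3 (CV x0 x1 x2 x3
        y1 y2 y3 y0)) =
       of_int y1 * R31 + of_int y2 * R32 + of_int y3 * R33 + of_int x3 * (R31 * X2 - X1 * R32) +
       of_int x2 * (R31 * X3 - X1 * R33) + of_int x1 * (R32 * X3 - X2 * R33) +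
       of_int y0 * (R31 * (X2 * X3) - X1 * (R32 * X3) + X1 * (X2 * R33))"
proof -
  have com: "X1 * of_int n = of_int n * X1" "X2 * of_int n = of_int n * X2"
      "X3 * of_int n = of_int n * X3"
    "(of_int m * of_int n :: 'r) = of_int n * of_int m" for m n
    by (rule mult_of_int_commute[symmetric])+
  have lcom: "X1 * (of_int n * y) = of_int n * (X1 * y)" "X2 * (of_int n * y) = of_int n * (X2 * y)"
    "X3 * (of_int n * y) = of_int n * (X3 * y)" "of_int m * (of_int n * y) =
        of_int n * (of_int m * y)" for m n y
    by (rule of_int_left_commute)+
  show
    "X1 * lin_comb X1 X2 X3 (CV x0 x1 x2 x3 y1 y2 y3 y0) - lin_comb X1 X2 X3 (op1 (CV x0 x1 x2 x3
        y1 y2 y3 y0)) =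
       of_int y1 * R11 + of_int x3 * (R11 * X2) + of_int x2 * (R11 * X3) +
           of_int y0 * (R11 * (X2 * X3))"
    "X2 * lin_comb X1 X2 X3 (CV x0 x1 x2 x3 y1 y2 y3 y0) - lin_comb X1 X2 X3 (op2 (CV x0 x1 x2 x3
        y1 y2 y3 y0)) =
       of_int y1 * R21 + of_int y2 * R22 + of_int x3 * (R21 * X2 - X1 * R22) +
           of_int x2 * (R21 * X3) +
       of_int x1 * (R22 * X3) + of_int y0 * (R21 * (X2 * X3) - X1 * (R22 * X3))"
    "X3 * lin_comb X1 X2 X3 (CV x0 x1 x2 x3 y1 y2 y3 y0) - lin_comb X1 X2 X3 (op3 (CV x0 x1 x2 x3
        y1 y2 y3 y0)) =
       of_int y1 * R31 + of_int y2 * R32 + of_int y3 * R33 + of_int x3 * (R31 * X2 - X1 * R32) +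
       of_int x2 * (R31 * X3 - X1 * R33) + of_int x1 * (R32 * X3 - X2 * R33) +
       of_int y0 * (R31 * (X2 * X3) - X1 * (R32 * X3) + X1 * (X2 * R33))"
    unfolding R11_def R22_def R33_def R21_def R31_def R32_def
    by (simp_all add: algebra_simps com lcom)
qed

text \<open>All brackets on the right of \<open>mult_lin_comb\<close> vanish for \<open>E1\<close>,
  \<open>E2\<close>, \<open>E3\<close>, so the span of the monomials is stable under left
  multiplication by the generators.\<close>

lemma E_mult_lin:
  "E1 * lin v = lin (op1 v)" "E2 * lin v = lin (op2 v)" "E3 * lin v = lin (op3 v)"
proof -
  obtain x0 x1 x2 x3 y1 y2 y3 y0 where v: "v = CV x0 x1 x2 x3 y1 y2 y3 y0" by (cases v)
  have "E1 * lin v - lin (op1 v) = 0" "E2 * lin v - lin (op2 v) = 0" "E3 * lin v - lin (op3 v) = 0"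
    unfolding v lin_def mult_lin_comb by (simp_all add: E_clifford_relations)
  then show "E1 * lin v = lin (op1 v)" "E2 * lin v = lin (op2 v)" "E3 * lin v = lin (op3 v)"
    by simp_all
qed

text \<open>Repeated use of \<open>E_mult_lin\<close> keeps a product of monomials in the span.
  Products thus become explicit integer polynomials in the coordinates.\<close>

lemma lin_mult_lin: "lin v * lin w = lin (app (lin v) w)"
  by (cases v)
    (simp add: lin_CV distrib_right mult.assoc E_mult_lin lin_cscale[symmetric] lin_add[symmetric])

fun lin_mult :: "cl_coords \<Rightarrow> cl_coords \<Rightarrow> cl_coords" where
  "lin_mult (CV x0 x1 x2 x3 y1 y2 y3 y0) w =
     cscale x0 w + cscale x1 (op2 (op3 w)) + cscale x2 (op1 (op3 w)) + cscale x3 (op1 (op2 w)) +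
     cscale y1 (op1 w) + cscale y2 (op2 w) + cscale y3 (op3 w) + cscale y0 (op1 (op2 (op3 w)))"

lemma app_lin: "app (lin v) w = lin_mult v w"
  by (cases v) (simp add: lin_CV)

lemma lin_of_int: "of_int n = lin (CV n 0 0 0 0 0 0 0)"
  by (simp add: lin_CV)

lemma lin_1: "1 = lin unit_coords"
  by (simp add: unit_coords_def lin_CV)

lemma lin_E: "E1 = lin (CV 0 0 0 0 1 0 0 0)" "E2 = lin (CV 0 0 0 0 0 1 0 0)"
    "E3 = lin (CV 0 0 0 0 0 0 1 0)"
  by (simp_all add: lin_CV)

lemma lin_monomials:
  "E2 * E3 = lin (CV 0 1 0 0 0 0 0 0)" "E1 * E3 = lin (CV 0 0 1 0 0 0 0 0)"
  "E1 * E2 = lin (CV 0 0 0 1 0 0 0 0)" "E1 * (E2 * E3) = lin (CV 0 0 0 0 0 0 0 1)"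
  by (simp_all add: lin_CV)

text \<open>Collects a ring expression under a single \<open>lin\<close>; with
  \<open>lin_inject\<close> an equation then splits into eight polynomial identities over the
  integers.\<close>

lemmas to_lin = lin_mult_lin app_lin lin_add[symmetric] lin_diff[symmetric] lin_uminus[symmetric]
  lin_cscale[symmetric]

end

declare lin_comb.simps [simp del]

context ternary_form
begin

section \<open>Parity and reversal in coordinates\<close>

abbreviation "even_elt x0 x1 x2 x3 \<equiv> lin (CV x0 x1 x2 x3 0 0 0 0)"
abbreviation "odd_elt y1 y2 y3 y0 \<equiv> lin (CV 0 0 0 0 y1 y2 y3 y0)"
abbreviation "vec_elt y1 y2 y3 \<equiv> odd_elt y1 y2 y3 0"

definition even_part :: "coord_op set" where "even_part =
    {even_elt x0 x1 x2 x3 | x0 x1 x2 x3. True}"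
definition odd_part :: "coord_op set" where "odd_part = {odd_elt y1 y2 y3 y0 | y1 y2 y3 y0. True}"

lemma even_partE:
  assumes "x \<in> even_part" obtains x0 x1 x2 x3 where "x = even_elt x0 x1 x2 x3"
  using assms by (auto simp: even_part_def)

lemma odd_partE:
  assumes "x \<in> odd_part" obtains y1 y2 y3 y0 where "x = odd_elt y1 y2 y3 y0"
  using assms by (auto simp: odd_part_def)

lemma even_elt_in [simp]: "even_elt x0 x1 x2 x3 \<in> even_part"
  by (auto simp: even_part_def)

lemma odd_elt_in [simp]: "odd_elt y1 y2 y3 y0 \<in> odd_part"
  by (auto simp: odd_part_def)

lemma even_part_range: "x \<in> even_part \<Longrightarrow> x \<in> range lin"
  by (auto simp: even_part_def)

lemma odd_part_range: "x \<in> odd_part \<Longrightarrow> x \<in> range lin"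
  by (auto simp: odd_part_def)

lemma part_add:
  "x \<in> even_part \<Longrightarrow> y \<in> even_part \<Longrightarrow> x + y \<in> even_part"
  "x \<in> odd_part \<Longrightarrow> y \<in> odd_part \<Longrightarrow> x + y \<in> odd_part"
  by (auto elim!: even_partE odd_partE simp: to_lin)

lemma part_mult:
  "x \<in> even_part \<Longrightarrow> y \<in> even_part \<Longrightarrow> x * y \<in> even_part"
  "x \<in> odd_part \<Longrightarrow> y \<in> odd_part \<Longrightarrow> x * y \<in> even_part"
  "x \<in> even_part \<Longrightarrow> y \<in> odd_part \<Longrightarrow> x * y \<in> odd_part"
  "x \<in> odd_part \<Longrightarrow> y \<in> even_part \<Longrightarrow> x * y \<in> odd_part"
  by (auto elim!: even_partE odd_partE simp: to_lin)

lemma part_of_int [simp]: "of_int n \<in> even_part"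
  by (simp add: lin_of_int)

lemma part_zero [simp]: "0 \<in> even_part" "0 \<in> odd_part"
  using part_of_int[of 0] odd_elt_in[of 0 0 0 0] by (simp_all add: lin_CV)

lemma part_one [simp]: "1 \<in> even_part"
  using part_of_int[of 1] by simp

lemma part_uminus:
  "x \<in> even_part \<Longrightarrow> - x \<in> even_part"
  "x \<in> odd_part \<Longrightarrow> - x \<in> odd_part"
  by (auto elim!: even_partE odd_partE simp: to_lin)

lemma part_scale:
  "x \<in> even_part \<Longrightarrow> of_int n * x \<in> even_part"
  "x \<in> odd_part \<Longrightarrow> of_int n * x \<in> odd_part"
  by (auto elim!: even_partE odd_partE simp: to_lin)

lemma part_disjoint: "x \<in> even_part \<Longrightarrow> x \<in> odd_part \<Longrightarrow> x = 0"
  by (elim even_partE odd_partE) (auto simp: lin_zero[symmetric])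

text \<open>The reversed monomials rewritten in the basis, for instance
  \<open>e3 e2 = r - e2 e3\<close> and
  \<open>e3 e2 e1 = r e1 - s e2 + t e3 - e1 e2 e3\<close>.\<close>

fun rev_coords :: "cl_coords \<Rightarrow> cl_coords" where
  "rev_coords (CV x0 x1 x2 x3 y1 y2 y3 y0) =
     CV (x0 + r * x1 + s * x2 + t * x3) (- x1) (- x2) (- x3)
        (y1 + r * y0) (y2 - s * y0) (y3 + t * y0) (- y0)"

text \<open>Defined on every operator through its value at 1, but it is the reversal only on
  \<open>range lin\<close>; hence the range hypotheses in the lemmas about products and
  involutivity.\<close>

definition star :: "coord_op \<Rightarrow> coord_op" where
  "star x = lin (rev_coords (app x unit_coords))"

lemma rev_coords_add: "rev_coords (v + w) = rev_coords v + rev_coords w"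
  by (cases v; cases w) (simp add: algebra_simps)

lemma rev_coords_uminus: "rev_coords (- v) = - rev_coords v"
  by (cases v) (simp add: algebra_simps)

lemma rev_coords_cscale: "rev_coords (cscale n v) = cscale n (rev_coords v)"
  by (cases v) (simp add: algebra_simps)

lemma star_lin: "star (lin v) = lin (rev_coords v)"
  by (simp add: star_def)

lemma star_add: "star (x + y) = star x + star y"
  by (simp add: star_def rev_coords_add lin_add)

lemma star_uminus: "star (- x) = - star x"
  by (simp add: star_def rev_coords_uminus lin_uminus)

lemma star_diff: "star (x - y) = star x - star y"
  using star_add[of x "- y"] by (simp add: star_uminus)

lemma star_scale: "star (of_int n * x) = of_int n * star x"
  by (simp add: star_def rev_coords_cscale lin_cscale)

lemma star_of_int [simp]: "star (of_int n) = of_int n"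
  by (simp add: lin_of_int star_lin)

lemma star_one [simp]: "star 1 = 1"
  using star_of_int[of 1] by simp

lemma star_vec [simp]: "star (vec_elt y1 y2 y3) = vec_elt y1 y2 y3"
  by (simp add: star_lin)

lemma star_star: "x \<in> range lin \<Longrightarrow> star (star x) = x"
proof (erule rangeE)
  fix v assume "x = lin v"
  then show ?thesis by (cases v) (simp add: star_lin algebra_simps)
qed

lemma star_part: "x \<in> even_part \<Longrightarrow> star x \<in> even_part" "x \<in> odd_part \<Longrightarrow> star x \<in> odd_part"
  by (auto elim!: even_partE odd_partE simp: star_lin)

lemma star_E_mult:
  "star (E1 * lin v) = star (lin v) * E1" "star (E2 * lin v) = star (lin v) * E2"
  "star (E3 * lin v) = star (lin v) * E3"
  by (cases v; simp add: star_lin lin_E to_lin; simp add: algebra_simps)+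

text \<open>It suffices to move one generator at a time out of the left factor, which is
  \<open>star_E_mult\<close>; the monomials of the left factor are products of at most three
  generators.\<close>

lemma star_mult_lin: "star (lin v * lin w) = star (lin w) * star (lin v)"
proof -
  have st: "star E1 = E1" "star E2 = E2" "star E3 = E3"
    by (simp_all add: lin_E star_lin)
  have st2: "star (E1 * E2) = E2 * E1" "star (E1 * E3) = E3 * E1" "star (E2 * E3) = E3 * E2"
    using star_E_mult(1)[of "CV 0 0 0 0 0 1 0 0"] star_E_mult(1)[of "CV 0 0 0 0 0 0 1 0"]
      star_E_mult(2)[of "CV 0 0 0 0 0 0 1 0"] by (simp_all add: st lin_E[symmetric])
  have st3: "star (E1 * (E2 * E3)) = E3 * E2 * E1"
    using star_E_mult(1)[of "CV 0 1 0 0 0 0 0 0"] by (simp add: st2 lin_monomials[symmetric])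
  have m: "star (E1 * (E2 * lin w)) = star (lin w) * (E2 * E1)"
     "star (E1 * (E3 * lin w)) = star (lin w) * (E3 * E1)"
     "star (E2 * (E3 * lin w)) = star (lin w) * (E3 * E2)"
     "star (E1 * (E2 * (E3 * lin w))) = star (lin w) * (E3 * (E2 * E1))"
    by (metis E_mult_lin star_E_mult mult.assoc)+
  have sc: "star (lin w) * (of_int n * x) = of_int n * (star (lin w) * x)"
    "star (lin w) * of_int n = of_int n * star (lin w)" for n x
    by (rule of_int_left_commute, rule mult_of_int_commute[symmetric])
  show ?thesis
    by (cases v) (simp add: lin_CV star_add star_scale distrib_right distrib_left mult.assoc
        st st2 st3 star_E_mult m sc)
qed

lemma star_mult: "x \<in> range lin \<Longrightarrow> y \<in> range lin \<Longrightarrow> star (x * y) = star y * star x"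
  by (auto simp: star_mult_lin)

text \<open>Reversal negates the coefficient of \<open>e1 e2 e3\<close>, so a fixed odd element has
  none. This is the criterion by which elements are shown to lie in the lattice.\<close>

lemma odd_fixed_by_star:
  assumes "x \<in> odd_part" "star x = x"
  obtains y1 y2 y3 where "x = vec_elt y1 y2 y3"
  using assms by (elim odd_partE) (auto simp: star_lin)

text \<open>The coefficients of the three products of two basis vectors are negated by reversal, so
  only the scalar coordinate survives.\<close>

lemma even_fixed_by_star:
  assumes "x \<in> even_part" "star x = x"
  obtains n where "x = of_int n"
  using assms by (elim even_partE) (auto simp: star_lin lin_of_int)

text \<open>On the even part, a quaternion order, \<open>star\<close> is the canonical involution;
  the integer is the reduced trace.\<close>

lemma even_trace:
  assumes "x \<in> even_part"
  obtains n where "star x = of_int n - x"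
proof -
  obtain x0 x1 x2 x3 where "x = even_elt x0 x1 x2 x3" using assms by (rule even_partE)
  then have "star x = of_int (2 * x0 + r * x1 + s * x2 + t * x3) - x"
    by (simp add: lin_of_int[of "2 * x0 + r * x1 + s * x2 +
        t * x3"] to_lin star_lin del: of_int_add of_int_mult)
  then show ?thesis by (rule that)
qed

text \<open>Half the determinant of the Gram matrix.\<close>

definition disc :: int where
  "disc = 4 * a * b * c + r * s * t - a * r^2 - b * s^2 - c * t^2"

text \<open>This is \<open>e\<^sub>1 e\<^sub>2 e\<^sub>3 - e\<^sub>3 e\<^sub>2 e\<^sub>1\<close>.\<close>

definition delta :: coord_op where "delta = odd_elt (- r) s (- t) 2"

lemma delta_odd: "delta \<in> odd_part"
  by (simp add: delta_def)

lemma star_delta: "star delta = - delta"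
  by (simp add: delta_def star_lin to_lin)

text \<open>In odd rank the volume element is central; \<open>delta\<close> is its version that is
  negated by reversal.\<close>

lemma delta_commute: "lin v * delta = delta * lin v"
  by (cases v) (simp add: delta_def to_lin algebra_simps)

lemma delta_square: "delta * delta = of_int (- disc)"
  unfolding lin_of_int by (simp add: delta_def to_lin disc_def algebra_simps power2_eq_square)

lemma alternating_triple:
  fixes x1 x2 x3 y1 y2 y3 z1 z2 z3 :: int
  defines "X \<equiv> vec_elt x1 x2 x3" and "Y \<equiv> vec_elt y1 y2 y3" and "Z \<equiv> vec_elt z1 z2 z3"
  shows "X * Y * Z - Z * Y * X =
    of_int (x1 * (y2 * z3 - y3 * z2) - x2 * (y1 * z3 - y3 * z1) + x3 * (y1 * z2 - y2 * z1)) * delta"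
  unfolding X_def Y_def Z_def delta_def by (simp only: to_lin) (simp add: algebra_simps)

text \<open>The multiplier of \<open>delta\<close> is a functional of the vector whose coefficients
  are, up to sign, the non-scalar coordinates of the even element. These are arbitrary, so every
  functional arises.\<close>

lemma vec_even_skew:
  "vec_elt y1 y2 y3 * even_elt x0 x1 x2 x3 - star (even_elt x0 x1 x2 x3) * vec_elt y1 y2 y3 =
   of_int (x1 * y1 - x2 * y2 + x3 * y3) * delta"
  unfolding delta_def by (simp only: to_lin star_lin rev_coords.simps) (simp add: algebra_simps)

text \<open>As for quaternions, scalars drop out and the commutator is, up to signs, the cross
  product of the non-scalar coordinates.\<close>

lemma even_commutator:
  "even_elt x0 x1 x2 x3 * even_elt z0 z1 z2 z3 - even_elt z0 z1 z2 z3 * even_elt x0 x1 x2 x3 =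
   vec_elt (x2 * z3 - x3 * z2) (x1 * z3 - x3 * z1) (x1 * z2 - x2 * z1) * delta"
  unfolding delta_def by (simp only: to_lin star_lin rev_coords.simps) (simp add: algebra_simps)

lemma odd_even_skew:
  "odd_elt y1 y2 y3 y0 * even_elt x0 x1 x2 x3 - star (even_elt x0 x1 x2 x3) * odd_elt y1 y2 y3 y0 =
   even_elt (x1 * y1 - x2 * y2 + x3 * y3) (y0 * x1) (y0 * x2) (y0 * x3) * delta"
  unfolding delta_def by (simp only: to_lin star_lin rev_coords.simps) (simp add: algebra_simps)

text \<open>A separate constant for scalar multiples: moving central factors of the form \<open>of_int n\<close> to the
  front is not a terminating rewrite rule.\<close>

definition sc :: "int \<Rightarrow> coord_op \<Rightarrow> coord_op" where "sc n x = of_int n * x"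

lemma scalars:
  "of_int n = sc n 1" "x * sc n y = sc n (x * y)" "sc n x * y = sc n (x * y)"
      "sc m (sc n x) = sc (m * n) x"
  "sc n (x + y) = sc n x + sc n y" "sc n (x - y) = sc n x - sc n y" "sc n (- x) = - sc n x"
  "sc 1 x = x" "sc (- 1) x = - x"
  by (simp_all add: sc_def mult.assoc of_int_left_commute[of x] right_diff_distrib distrib_left)

lemma sc_inject: "n \<noteq> 0 \<Longrightarrow> sc n x = sc n y \<longleftrightarrow> x = y"
  by (simp add: sc_def of_int_mult_cancel)

lemma lin_mult_closed: "x \<in> range lin \<Longrightarrow> y \<in> range lin \<Longrightarrow> x * y \<in> range lin"
  by (auto simp: lin_mult_lin)

lemma delta_commute': "x \<in> range lin \<Longrightarrow> x * delta = delta * x"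
  by (auto simp: delta_commute)

text \<open>A second factor \<open>delta\<close> turns the common factor into a nonzero integer, and
  nonzero integers can be cancelled.\<close>

lemma delta_cancel:
  assumes "disc \<noteq> 0" "x * delta = y * delta"
  shows "x = y"
proof -
  have "x * (delta * delta) = y * (delta * delta)"
    using assms(2) by (simp add: mult.assoc[symmetric])
  then have "of_int (- disc) * x = of_int (- disc) * y"
    by (simp add: delta_square mult_of_int_commute)
  then show ?thesis
    using assms(1) by (simp only: of_int_mult_cancel) simp
qed

section \<open>Norms and twisted commutators of homogeneous elements\<close>

definition homogeneous :: "coord_op set" where "homogeneous = even_part \<union> odd_part"

lemma homogeneous_range: "x \<in> homogeneous \<Longrightarrow> x \<in> range lin"
  by (auto simp: homogeneous_def even_part_range odd_part_range)

lemma homogeneous_mult: "x \<in> homogeneous \<Longrightarrow> y \<in> homogeneous \<Longrightarrow> x * y \<in> homogeneous"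
  by (auto simp: homogeneous_def part_mult)

lemma homogeneous_star: "x \<in> homogeneous \<Longrightarrow> star x \<in> homogeneous"
  by (auto simp: homogeneous_def star_part)

lemma star_closed: "x \<in> range lin \<Longrightarrow> star x \<in> range lin"
  by (auto simp: star_lin)

text \<open>Both products are even and fixed by reversal, hence integers.\<close>

lemma norm_int:
  assumes "x \<in> homogeneous"
  obtains n where "x * star x = of_int n" "star x * x = of_int n"
proof -
  have ex: "\<exists>n. y * star y = of_int n" if "y \<in> homogeneous" for y
  proof -
    have "y * star y \<in> even_part"
      using that by (auto simp: homogeneous_def part_mult star_part)
    moreover have "star (y * star y) = y * star y"
      using homogeneous_range[OF that] by (simp add: star_mult star_closed star_star)
    ultimately show ?thesis by (metis even_fixed_by_star)
  qed
  obtain n where n: "x * star x = of_int n" using ex[OF assms] by blast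
  obtain m where m: "star x * x = of_int m"
    using ex[OF homogeneous_star[OF assms]] homogeneous_range[OF assms] by (auto simp: star_star)
  \<comment> \<open>Bracketing \<open>x * star x * x\<close> in two ways shows that the two integers
    agree unless \<open>x = 0\<close>.\<close>
  have "of_int n * x = x * (star x * x)" by (simp add: n[symmetric] mult.assoc)
  also have "\<dots> = of_int m * x" by (simp add: m mult_of_int_commute)
  finally have "of_int (n - m) * x = 0" by (simp add: left_diff_distrib)
  then have "n = m \<or> x = 0" by (simp only: of_int_mult_eq_0_iff) simp
  then show ?thesis
    using n m that by auto
qed

lemma even_norm_eq:
  assumes "even_elt x0 x1 x2 x3 * star (even_elt x0 x1 x2 x3) = of_int n"
  shows "n = x0 * x0 + r * (x0 * x1) + s * (x0 * x2) + t * (x0 * x3) + a * b * (x3 * x3) +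
    a * c * (x2 * x2) + b * c * (x1 * x1) + a * r * (x2 * x3) + c * t * (x1 * x2) +
    (r * t - b * s) * (x1 * x3)"
  using assms unfolding lin_of_int by (simp add: to_lin star_lin algebra_simps)

lemma odd_norm_eq:
  assumes "odd_elt y1 y2 y3 y0 * star (odd_elt y1 y2 y3 y0) = of_int n"
  shows "n = a * (y1 * y1) + b * (y2 * y2) + c * (y3 * y3) + r * (y2 * y3) + s * (y1 * y3) +
    t * (y1 * y2) + a * r * (y0 * y1) + c * t * (y0 * y3) + (r * t - b * s) * (y0 * y2) +
    a * b * c * (y0 * y0)"
  using assms unfolding lin_of_int by (simp add: to_lin star_lin algebra_simps)

text \<open>Chosen so that \<open>x * y - twist x y * x\<close> is a multiple of
  \<open>delta\<close> for both parities of \<open>x\<close>: a commutator for even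
  \<open>x\<close>, a skew expression for odd \<open>x\<close>.\<close>

definition twist :: "coord_op \<Rightarrow> coord_op \<Rightarrow> coord_op" where
  "twist x y = (if x \<in> even_part then y else star y)"

lemma twist_witness_ex:
  assumes x: "x \<in> homogeneous" and y: "y \<in> even_part"
  obtains z where "x * y - twist x y * x = z * delta"
    "x \<in> even_part \<Longrightarrow> z \<in> odd_part" "x \<notin> even_part \<Longrightarrow> z \<in> even_part"
proof (cases "x \<in> even_part")
  case True
  then show ?thesis
    using even_commutator y that by (elim even_partE) (metis True odd_elt_in twist_def)
next
  case False
  then have "x \<in> odd_part" using x by (simp add: homogeneous_def)
  then show ?thesis
    using odd_even_skew y that False by (elim even_partE odd_partE) (metis even_elt_in twist_def)
qed

text \<open>The element \<open>z * star x\<close> is odd, so it remains to see that it equals its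
  reversal \<open>x * star z\<close>. After multiplication by \<open>delta\<close> the difference
  becomes \<open>x (y + star y) star x - n (y' + star y')\<close> with
  \<open>y' = twist x y\<close>; both traces are the same integer and \<open>x * star x = n\<close>,
  so it vanishes.\<close>

lemma twist_witness_in_lattice:
  assumes D: "disc \<noteq> 0" and x: "x \<in> homogeneous" and y: "y \<in> even_part"
    and z: "x * y - twist x y * x = z * delta"
    "x \<in> even_part \<Longrightarrow> z \<in> odd_part" "x \<notin> even_part \<Longrightarrow> z \<in> even_part"
  obtains v1 v2 v3 where "z * star x = vec_elt v1 v2 v3"
proof -
  have odd: "z * star x \<in> odd_part"
    using x z(2,3) by (cases "x \<in> even_part") (auto simp: homogeneous_def part_mult star_part)
  have zr: "z \<in> range lin" using z(2,3) by (metis even_part_range odd_part_range)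
  note xr = homogeneous_range[OF x] and yr = even_part_range[OF y]
  obtain n where n: "x * star x = of_int n" "star x * x = of_int n"
    using norm_int[OF x] .
  obtain m where m: "star y = of_int m - y" using even_trace[OF y] .
  have dr: "delta \<in> range lin" by (simp add: delta_def)
  have tr: "twist x y \<in> range lin" by (simp add: twist_def yr star_closed)
  have "z * star x * delta = z * delta * star x"
    by (simp add: mult.assoc delta_commute' star_closed xr)
  also have "\<dots> = x * y * star x - twist x y * of_int n"
    by (simp add: z(1)[symmetric] left_diff_distrib mult.assoc n)
  finally have 1: "z * star x * delta = x * y * star x - of_int n * twist x y"
    by (simp add: mult_of_int_commute)
  have "x * star z * delta = - (x * (star delta * star z))"
    by (simp add: star_delta delta_commute' zr star_closed mult.assoc)
  also have "star delta * star z = star (z * delta)"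
    by (simp add: star_mult zr dr)
  also have "- (x * \<dots>) = - (x * (star y * star x - star x * star (twist x y)))"
    by (simp add: z(1)[symmetric] star_diff star_mult xr yr tr)
  also have "\<dots> = - (x * star y * star x) + of_int n * star (twist x y)"
    by (simp add: right_diff_distrib mult.assoc[symmetric] n)
  finally have 2: "x * star z * delta = - (x * star y * star x) + of_int n * star (twist x y)" .
  have xm: "x * (of_int m * star x) = of_int m * of_int n"
    by (simp add: of_int_left_commute n)
  have nm: "of_int n * of_int m = (of_int m * of_int n :: coord_op)"
    by (rule mult_of_int_commute)
  have "z * star x * delta = x * star z * delta"
    unfolding 1 2 twist_def
    by (simp add: star_star yr) (simp add: m xm nm algebra_simps)
  then have "z * star x = x * star z" by (rule delta_cancel[OF D])
  then have "star (z * star x) = z * star x"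
    by (simp add: star_mult zr star_closed xr star_star)
  then show ?thesis using odd that by (metis odd_fixed_by_star)
qed

text \<open>If \<open>y\<close> and \<open>y'\<close> are two of the products of two basis vectors,
  one coordinate of \<open>z * star z'\<close> is a square \<open>x1 * x1\<close>,
  \<open>x2 * x2\<close> or \<open>x3 * x3\<close> up to sign. Hence \<open>p\<close> divides the
  non-scalar coordinates, and then the norm equation yields \<open>x0\<close>.\<close>

lemma even_prime_dvd_coords:
  fixes p n :: int
  assumes p: "prime p" "p dvd n"
    and n: "even_elt x0 x1 x2 x3 * star (even_elt x0 x1 x2 x3) = of_int n"
    and dvd: "\<And>y y' z z'. y \<in> even_part \<Longrightarrow> y' \<in> even_part \<Longrightarrow>
        even_elt x0 x1 x2 x3 * y - y * even_elt x0 x1 x2 x3 = z * delta \<Longrightarrow>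
        even_elt x0 x1 x2 x3 * y' - y' * even_elt x0 x1 x2 x3 = z' * delta \<Longrightarrow>
        z \<in> odd_part \<Longrightarrow> z' \<in> odd_part \<Longrightarrow>
        \<exists>w\<in>even_part. z * star z' = of_int n * w"
  shows "p dvd x0 \<and> p dvd x1 \<and> p dvd x2 \<and> p dvd x3"
proof -
  have *: "\<exists>w\<in>even_part. vec_elt (x2 * z3 - x3 * z2) (x1 * z3 - x3 * z1) (x1 * z2 - x2 * z1) *
     vec_elt (x2 * z3' - x3 * z2') (x1 * z3' - x3 * z1') (x1 * z2' - x2 * z1') = of_int n * w"
     for z1 z2 z3 z1' z2' z3'
    using dvd[OF _ _ even_commutator[of x0 x1 x2 x3 0 z1 z2 z3] even_commutator[of x0 x1 x2 x3 0
        z1' z2' z3']]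
    by simp
  have "n dvd x1 * x1"
    using *[of 1 0 0 0 1 0] by (auto elim!: even_partE simp: to_lin)
  moreover have "n dvd x2 * x2"
    using *[of 1 0 0 0 0 1]
        by (auto elim!: even_partE simp: to_lin) (metis dvd_triv_left dvd_minus_iff)
  moreover have "n dvd x3 * x3"
    using *[of 0 1 0 0 0 1] by (auto elim!: even_partE simp: to_lin)
  ultimately have x: "p dvd x1" "p dvd x2" "p dvd x3"
    using p by (metis dvd_trans prime_dvd_mult_iff)+
  have "x0 * x0 = n - (r * (x0 * x1) + s * (x0 * x2) + t * (x0 * x3) + a * b * (x3 * x3) +
    a * c * (x2 * x2) + b * c * (x1 * x1) + a * r * (x2 * x3) + c * t * (x1 * x2) +
    (r * t - b * s) * (x1 * x3))" using even_norm_eq[OF n] by simp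
  moreover have "p dvd \<dots>"
    by (intro dvd_diff dvd_add p) (use x in \<open>auto intro!: dvd_mult dvd_mult2\<close>)
  ultimately have "p dvd x0" using p prime_dvd_mult_iff by metis
  with x show ?thesis by simp
qed

text \<open>The coordinates of \<open>z * star z'\<close> show that \<open>n\<close> divides
  \<open>y0 * y0\<close> times each coefficient of the quadratic form, as well as each
  \<open>y0 * yi\<close>. This forces \<open>p\<close> to divide \<open>y0\<close> first, and the
  remaining coordinates follow.\<close>

lemma odd_prime_dvd_coords:
  fixes p n :: int
  assumes p: "prime p" "p dvd n" and "n \<noteq> 0"
    and n: "odd_elt y1 y2 y3 y0 * star (odd_elt y1 y2 y3 y0) = of_int n"
    and dvd: "\<And>y y' z z'. y \<in> even_part \<Longrightarrow> y' \<in> even_part \<Longrightarrow>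
        odd_elt y1 y2 y3 y0 * y - star y * odd_elt y1 y2 y3 y0 = z * delta \<Longrightarrow>
        odd_elt y1 y2 y3 y0 * y' - star y' * odd_elt y1 y2 y3 y0 = z' * delta \<Longrightarrow>
        z \<in> even_part \<Longrightarrow> z' \<in> even_part \<Longrightarrow>
        \<exists>w\<in>even_part. z * star z' = of_int n * w"
  shows "p dvd y1 \<and> p dvd y2 \<and> p dvd y3 \<and> p dvd y0"
proof -
  have *: "\<exists>w\<in>even_part. even_elt (x1 * y1 - x2 * y2 + x3 * y3) (y0 * x1) (y0 * x2) (y0 * x3) *
     star (even_elt (x1' * y1 - x2' * y2 + x3' * y3) (y0 * x1') (y0 * x2') (y0 * x3')) =
         of_int n * w"
     for x1 x2 x3 x1' x2' x3'
    using dvd[OF _ _ odd_even_skew[of y1 y2 y3 y0 0 x1 x2 x3] odd_even_skew[of y1 y2 y3 y0 0 x1'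
        x2' x3']]
    by simp
  have d1: "n dvd c * (y0 * y0)" "n dvd y0 * y1" "n dvd y0 * y2"
    using *[of 1 0 0 0 "- 1" 0] by (auto elim!: even_partE simp: to_lin star_lin algebra_simps)
  have d2: "n dvd b * (y0 * y0)" "n dvd - (y0 * y1) - r * (y0 * y0)" "n dvd y0 * y3"
    using *[of 1 0 0 0 0 1] by (auto elim!: even_partE simp: to_lin star_lin algebra_simps)
  have d3: "n dvd a * (y0 * y0)" "n dvd - (y0 * y3) - t * (y0 * y0)" "n dvd s * (y0 * y0) - y0 * y2"
    using *[of 0 "- 1" 0 0 0 1] by (auto elim!: even_partE simp: to_lin star_lin algebra_simps)
  have d4: "n dvd y1 * y1 + y0 * (r * y1 + b * c * y0)" "n dvd y2 * y2 + y0 * (a * c * y0 - s * y2)"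
     "n dvd y3 * y3 + y0 * (t * y3 + a * b * y0)"
    using *[of 1 0 0 1 0 0] *[of 0 "- 1" 0 0 "- 1" 0] *[of 0 0 1 0 0 1]
    by (auto elim!: even_partE simp: to_lin star_lin algebra_simps)
  \<comment> \<open>Adding the divisibilities of \<open>y0 * y1\<close>, \<open>y0 * y3\<close> and
    \<open>y0 * y2\<close> isolates the mixed coefficients.\<close>
  have "n dvd r * (y0 * y0)" "n dvd t * (y0 * y0)" "n dvd s * (y0 * y0)"
    using dvd_add[OF d2(2) d1(2)] dvd_add[OF d3(2) d2(3)] dvd_add[OF d3(3) d1(3)] by simp_all
  then obtain a' b' c' r' s' t' u1 u2 u3 where
    e: "a * (y0 * y0) = n * a'" "b * (y0 * y0) = n * b'" "c * (y0 * y0) = n * c'"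
     "r * (y0 * y0) = n * r'" "s * (y0 * y0) = n * s'" "t * (y0 * y0) = n * t'"
     "y0 * y1 = n * u1" "y0 * y2 = n * u2" "y0 * y3 = n * u3"
    using d1 d2 d3 unfolding dvd_def by metis
  \<comment> \<open>Multiplied by \<open>y0 ^ 4\<close>, every term of the norm equation is a
    product of three multiples of \<open>n\<close>; cancelling one factor \<open>n\<close> leaves
    \<open>n\<close> dividing \<open>y0 ^ 4\<close>.\<close>
  have "n * y0 ^ 4 =
     (a * (y0 * y0)) * (y0 * y1) * (y0 * y1) + (b * (y0 * y0)) * (y0 * y2) * (y0 * y2) +
     (c * (y0 * y0)) * (y0 * y3) * (y0 * y3) + (r * (y0 * y0)) * (y0 * y2) * (y0 * y3) +
     (s * (y0 * y0)) * (y0 * y1) * (y0 * y3) + (t * (y0 * y0)) * (y0 * y1) * (y0 * y2) +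
     (a * (y0 * y0)) * (r * (y0 * y0)) * (y0 * y1) + (c * (y0 * y0)) * (t * (y0 * y0)) * (y0 * y3) +
     ((r * (y0 * y0)) * (t * (y0 * y0)) - (b * (y0 * y0)) * (s * (y0 * y0))) * (y0 * y2) +
     (a * (y0 * y0)) * (b * (y0 * y0)) * (c * (y0 * y0))"
    by (subst odd_norm_eq[OF n]) (simp add: power_numeral_reduce algebra_simps)
  also have "\<dots> = n * (n * (n * (a' * u1 * u1 + b' * u2 * u2 + c' * u3 * u3 + r' * u2 * u3 +
      s' * u1 * u3 +
     t' * u1 * u2 + a' * r' * u1 + c' * t' * u3 + (r' * t' - b' * s') * u2 + a' * b' * c')))"
    unfolding e by (simp add: algebra_simps)
  finally have "n dvd y0 ^ 4" using \<open>n \<noteq> 0\<close> by (metis dvd_triv_left mult_cancel_left)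
  then have "p dvd y0 ^ 4" using p(2) dvd_trans by blast
  then have y0: "p dvd y0" using p(1) prime_dvd_power by blast
  \<comment> \<open>The divisibilities \<open>d4\<close> come from \<open>y = y'\<close>: they
    concern norms of the form \<open>yi * yi\<close> plus a multiple of \<open>y0\<close>.\<close>
  have "p dvd y1 * y1" "p dvd y2 * y2" "p dvd y3 * y3"
    using d4[THEN dvd_trans[OF p(2)]] y0 by (metis dvd_add_left_iff dvd_mult2)+
  then show ?thesis using y0 p(1) by (metis prime_dvd_mult_iff)
qed

end

section \<open>The Clifford algebra as a quotient of the free ring\<close>

lemma free_ring_simps [simp]:
  "carrier free_ring = UNIV" "x \<otimes>\<^bsub>free_ring\<^esub> y = x * y" "\<one>\<^bsub>free_ring\<^esub> = 1"
  "\<zero>\<^bsub>free_ring\<^esub> = 0" "x \<oplus>\<^bsub>free_ring\<^esub> y = x + y"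
  by (simp_all add: free_ring_def)

lemma ring_free_ring: "ring (free_ring :: ('a tword \<Rightarrow>\<^sub>0 int) ring)"
proof (rule ringI)
  show "abelian_group (free_ring :: ('a tword \<Rightarrow>\<^sub>0 int) ring)"
  proof (rule abelian_groupI)
    fix x :: "'a tword \<Rightarrow>\<^sub>0 int"
    show "\<exists>y\<in>carrier free_ring. y \<oplus>\<^bsub>free_ring\<^esub> x = \<zero>\<^bsub>free_ring\<^esub>"
      by (rule bexI[of _ "- x"]) simp_all
  qed (simp_all add: add_ac)
  show "Group.monoid (free_ring :: ('a tword \<Rightarrow>\<^sub>0 int) ring)"
    by (rule monoidI) (simp_all add: mult.assoc)
qed (simp_all add: algebra_simps)

interpretation free_ring: ring "free_ring :: ('a tword \<Rightarrow>\<^sub>0 int) ring"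
  by (rule ring_free_ring)

lemma free_ring_minus [simp]: "\<ominus>\<^bsub>free_ring\<^esub> x = - x" "x \<ominus>\<^bsub>free_ring\<^esub> y = x - y"
  for x y :: "'a tword \<Rightarrow>\<^sub>0 int"
proof -
  have *: "\<ominus>\<^bsub>free_ring\<^esub> x = - x" for x :: "'a tword \<Rightarrow>\<^sub>0 int"
    by (rule free_ring.minus_equality) simp_all
  then show "\<ominus>\<^bsub>free_ring\<^esub> x = - x" .
  show "x \<ominus>\<^bsub>free_ring\<^esub> y = x - y"
    by (simp add: a_minus_def *)
qed

lemma ideal_free_ringI:
  fixes I :: "('a tword \<Rightarrow>\<^sub>0 int) set"
  assumes "0 \<in> I" "\<And>x y. x \<in> I \<Longrightarrow> y \<in> I \<Longrightarrow> x - y \<in> I"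
    "\<And>x y. y \<in> I \<Longrightarrow> x * y \<in> I" "\<And>x y. y \<in> I \<Longrightarrow> y * x \<in> I"
  shows "ideal I free_ring"
proof (rule idealI[OF ring_free_ring])
  have neg: "- x \<in> I" if "x \<in> I" for x using assms(2)[OF assms(1) that] by simp
  have "x + y \<in> I" if "x \<in> I" "y \<in> I" for x y using assms(2)[OF that(1) neg[OF that(2)]] by simp
  moreover have "inv\<^bsub>add_monoid free_ring\<^esub> x = - x" for x :: "'a tword \<Rightarrow>\<^sub>0 int"
    using free_ring_minus(1)[of x] by (simp add: a_inv_def)
  ultimately show "subgroup I (add_monoid free_ring)"
    using assms(1) neg by (auto intro!: subgroup.intro)
qed (use assms in auto)

lemma ideal_tensor_ideal: "ideal tensor_ideal (free_ring :: ('a::ab_group_add tword \<Rightarrow>\<^sub>0 int) ring)"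
  unfolding tensor_ideal_def by (rule free_ring.genideal_ideal) simp

lemma tensor_ideal_closed:
  "0 \<in> tensor_ideal" "x \<in> tensor_ideal \<Longrightarrow> y \<in> tensor_ideal \<Longrightarrow> x + y \<in> tensor_ideal"
  "x \<in> tensor_ideal \<Longrightarrow> - x \<in> tensor_ideal"
  "x \<in> tensor_ideal \<Longrightarrow> y \<in> tensor_ideal \<Longrightarrow> x - y \<in> tensor_ideal"
  "x \<in> tensor_ideal \<Longrightarrow> z * x \<in> tensor_ideal" "x \<in> tensor_ideal \<Longrightarrow> x * z \<in> tensor_ideal"
proof -
  note sub = ideal.axioms(1)[OF ideal_tensor_ideal]
  show "0 \<in> tensor_ideal" using additive_subgroup.zero_closed[OF sub] by simp
  show a: "x \<in> tensor_ideal \<Longrightarrow> y \<in> tensor_ideal \<Longrightarrow> x + y \<in> tensor_ideal" for x y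
    using additive_subgroup.a_closed[OF sub] by simp
  show m: "x \<in> tensor_ideal \<Longrightarrow> - x \<in> tensor_ideal" for x
    using additive_subgroup.a_inv_closed[OF sub, of x] by simp
  show "x \<in> tensor_ideal \<Longrightarrow> y \<in> tensor_ideal \<Longrightarrow> x - y \<in> tensor_ideal"
    using a[of x "- y"] m[of y] by simp
  show "x \<in> tensor_ideal \<Longrightarrow> z * x \<in> tensor_ideal" "x \<in> tensor_ideal \<Longrightarrow> x * z \<in> tensor_ideal"
    using ideal.I_l_closed[OF ideal_tensor_ideal] ideal.I_r_closed[OF ideal_tensor_ideal] by auto
qed

lemma tensor_ideal_additive:
  "frag_of (TWord [x + y]) - frag_of (TWord [x]) - frag_of (TWord [y]) \<in> tensor_ideal"
  unfolding tensor_ideal_def by (rule subsetD[OF free_ring.genideal_self]) auto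

text \<open>Serves as the induction principle for membership in the ideal.\<close>

lemma tensor_ideal_minimal:
  assumes "0 \<in> I" "\<And>x y. x \<in> I \<Longrightarrow> y \<in> I \<Longrightarrow> x - y \<in> I"
    "\<And>x y. y \<in> I \<Longrightarrow> x * y \<in> I" "\<And>x y. y \<in> I \<Longrightarrow> y * x \<in> I"
    "\<And>x y. frag_of (TWord [x + y]) - frag_of (TWord [x]) - frag_of (TWord [y]) \<in> I"
  shows "tensor_ideal \<subseteq> I"
  unfolding tensor_ideal_def
  by (rule free_ring.genideal_minimal[OF ideal_free_ringI]) (use assms in auto)

lemma ring_tensor_algebra: "ring tensor_algebra"
  unfolding tensor_algebra_def by (rule ideal.quotient_is_ring[OF ideal_tensor_ideal])

interpretation tensor_algebra: ring "tensor_algebra :: ('a::ab_group_add tword \<Rightarrow>\<^sub>0 int) set ring"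
  by (rule ring_tensor_algebra)

lemma tensor_class_hom: "tensor_class \<in> Ring.ring_hom free_ring tensor_algebra"
  using ideal.rcos_ring_hom[OF ideal_tensor_ideal]
      unfolding tensor_class_def[abs_def] tensor_algebra_def .

interpretation tensor_class: ring_hom_ring free_ring tensor_algebra tensor_class
  by (rule ring_hom_ringI2[OF ring_free_ring ring_tensor_algebra tensor_class_hom])

lemma tensor_class_simps:
  "tensor_class 0 = \<zero>\<^bsub>tensor_algebra\<^esub>" "tensor_class 1 = \<one>\<^bsub>tensor_algebra\<^esub>"
  "tensor_class (x + y) = tensor_class x \<oplus>\<^bsub>tensor_algebra\<^esub> tensor_class y"
  "tensor_class (- x) = \<ominus>\<^bsub>tensor_algebra\<^esub> tensor_class x"
  "tensor_class (x - y) = tensor_class x \<ominus>\<^bsub>tensor_algebra\<^esub> tensor_class y"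
  "tensor_class (x * y) = tensor_class x \<otimes>\<^bsub>tensor_algebra\<^esub> tensor_class y"
proof -
  show "tensor_class 0 = \<zero>\<^bsub>tensor_algebra\<^esub>" using tensor_class.hom_zero by simp
  show "tensor_class 1 = \<one>\<^bsub>tensor_algebra\<^esub>" using tensor_class.hom_one by simp
  show add: "tensor_class (x + y) = tensor_class x \<oplus>\<^bsub>tensor_algebra\<^esub> tensor_class y" for x y
    using tensor_class.hom_add[of x y] by simp
  show m: "tensor_class (- x) = \<ominus>\<^bsub>tensor_algebra\<^esub> tensor_class x" for x
    using tensor_class.hom_a_inv[of x] by simp
  show "tensor_class (x - y) = tensor_class x \<ominus>\<^bsub>tensor_algebra\<^esub> tensor_class y"
    using add[of x "- y"] by (simp add: a_minus_def m)
  show "tensor_class (x * y) = tensor_class x \<otimes>\<^bsub>tensor_algebra\<^esub> tensor_class y"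
    using tensor_class.hom_mult[of x y] by simp
qed

lemma tensor_class_closed [simp]: "tensor_class x \<in> carrier tensor_algebra"
  using tensor_class.hom_closed[of x] by simp

lemma carrier_tensor_algebra: "carrier tensor_algebra = range tensor_class"
  by (auto simp: tensor_algebra_def FactRing_def A_RCOSETS_defs tensor_class_def a_r_coset_def)

lemma tensor_class_eq_iff: "tensor_class x = tensor_class y \<longleftrightarrow> x - y \<in> tensor_ideal"
  unfolding tensor_class_def
  using ring.quotient_eq_iff_same_a_r_cos[OF ring_free_ring ideal_tensor_ideal, of x y] by simp

lemma tensor_class_set: "tensor_class x = {y. x - y \<in> tensor_ideal}"
proof -
  have "tensor_class x = {h + x | h. h \<in> tensor_ideal}"
    by (auto simp: tensor_class_def a_r_coset_def r_coset_def)
  also have "\<dots> = {y. x - y \<in> tensor_ideal}"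
  proof (rule equalityI; rule subsetI)
    fix y assume "y \<in> {h + x | h. h \<in> tensor_ideal}"
    then show "y \<in> {y. x - y \<in> tensor_ideal}" by (auto simp: tensor_ideal_closed)
  next
    fix y assume "y \<in> {y. x - y \<in> tensor_ideal}"
    then have "- (x - y) \<in> tensor_ideal" "y = - (x - y) + x"
        by (auto simp del: minus_diff_eq intro: tensor_ideal_closed)
    then show "y \<in> {h + x | h. h \<in> tensor_ideal}" by blast
  qed
  finally show ?thesis .
qed

section \<open>The Clifford ideal pulled back to the free ring\<close>

context
  fixes form :: "'a::ab_group_add \<Rightarrow> 'a \<Rightarrow> int"
begin

lemma ideal_clifford_ideal: "ideal (clifford_ideal form) tensor_algebra"
  unfolding clifford_ideal_def
  by (rule tensor_algebra.genideal_ideal) (auto simp: tensor_vec_def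
      carrier_tensor_algebra[symmetric])

lemma ring_clifford: "ring (clifford form)"
  unfolding clifford_def by (rule ideal.quotient_is_ring[OF ideal_clifford_ideal])

definition clifford_proj :: "('a tword \<Rightarrow>\<^sub>0 int) \<Rightarrow> 'a cliff" where
  "clifford_proj x = clifford_class form (tensor_class x)"

lemma clifford_class_hom: "clifford_class form \<in> Ring.ring_hom tensor_algebra (clifford form)"
  using ideal.rcos_ring_hom[OF ideal_clifford_ideal]
  unfolding clifford_class_def[abs_def] clifford_def .

lemma clifford_proj_hom: "clifford_proj \<in> Ring.ring_hom free_ring (clifford form)"
  using ring_hom_trans[OF tensor_class_hom clifford_class_hom]
  by (simp add: comp_def clifford_proj_def[abs_def])

lemma clifford_proj_closed [simp]: "clifford_proj x \<in> carrier (clifford form)"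
  using ring_hom_closed[OF clifford_proj_hom] by simp

lemma clifford_proj_mult: "clifford_proj (x * y) = clifford_proj x \<otimes>\<^bsub>clifford form\<^esub> clifford_proj y"
  using ring_hom_mult[OF clifford_proj_hom] by simp

lemma clifford_proj_add: "clifford_proj (x + y) = clifford_proj x \<oplus>\<^bsub>clifford form\<^esub> clifford_proj y"
  using ring_hom_add[OF clifford_proj_hom] by simp

lemma clifford_proj_one: "clifford_proj 1 = \<one>\<^bsub>clifford form\<^esub>"
  using ring_hom_one[OF clifford_proj_hom] by simp

lemma clifford_proj_zero: "clifford_proj 0 = \<zero>\<^bsub>clifford form\<^esub>"
  using ring_hom_zero[OF clifford_proj_hom ring_free_ring ring_clifford] by simp

lemma clifford_proj_uminus: "clifford_proj (- x) = \<ominus>\<^bsub>clifford form\<^esub> clifford_proj x"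
proof -
  interpret ring "clifford form" by (rule ring_clifford)
  have "clifford_proj (- x) \<oplus>\<^bsub>clifford form\<^esub> clifford_proj x = \<zero>\<^bsub>clifford form\<^esub>"
    by (simp add: clifford_proj_add[symmetric] clifford_proj_zero)
  then show ?thesis by (simp add: minus_equality)
qed

text \<open>The kernel of the projection from the free ring, so that the two successive quotients
  can be handled as one.\<close>

definition clifford_clifford_relations :: "('a tword \<Rightarrow>\<^sub>0 int) set" where
  "clifford_clifford_relations = {x. clifford_proj x = clifford_proj 0}"

lemma clifford_proj_eq_iff: "clifford_proj x = clifford_proj y \<longleftrightarrow>
    x - y \<in> clifford_clifford_relations"
proof -
  interpret ring "clifford form" by (rule ring_clifford)
  have "clifford_proj (x - y) = clifford_proj x \<oplus>\<^bsub>clifford form\<^esub> \<ominus>\<^bsub>clifford form\<^esub> clifford_proj y"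
    by (simp add: clifford_proj_add[symmetric] clifford_proj_uminus[symmetric])
  then show ?thesis
    by (simp add: clifford_clifford_relations_def clifford_proj_zero r_neg)
      (metis clifford_proj_closed add.inv_closed minus_equality minus_minus r_neg)
qed

lemma clifford_clifford_relations_closed:
  "0 \<in> clifford_clifford_relations" "x \<in> clifford_clifford_relations \<Longrightarrow>
      y \<in> clifford_clifford_relations \<Longrightarrow> x + y \<in> clifford_clifford_relations"
  "x \<in> clifford_clifford_relations \<Longrightarrow> - x \<in> clifford_clifford_relations"
  "x \<in> clifford_clifford_relations \<Longrightarrow> y \<in> clifford_clifford_relations \<Longrightarrow>
      x - y \<in> clifford_clifford_relations"
  "x \<in> clifford_clifford_relations \<Longrightarrow> z * x \<in> clifford_clifford_relations"
      "x \<in> clifford_clifford_relations \<Longrightarrow> x * z \<in> clifford_clifford_relations"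
proof -
  interpret ring "clifford form" by (rule ring_clifford)
  show "0 \<in> clifford_clifford_relations" by (simp add: clifford_clifford_relations_def)
  show a: "x \<in> clifford_clifford_relations \<Longrightarrow> y \<in> clifford_clifford_relations \<Longrightarrow>
      x + y \<in> clifford_clifford_relations" for x y
    by (simp add: clifford_clifford_relations_def clifford_proj_add clifford_proj_zero)
  show m: "x \<in> clifford_clifford_relations \<Longrightarrow> - x \<in> clifford_clifford_relations" for x
    by (simp add: clifford_clifford_relations_def clifford_proj_uminus clifford_proj_zero)
  show "x \<in> clifford_clifford_relations \<Longrightarrow> y \<in> clifford_clifford_relations \<Longrightarrow>
      x - y \<in> clifford_clifford_relations"
    using a[of x "- y"] m[of y] by simp
  show "x \<in> clifford_clifford_relations \<Longrightarrow> z * x \<in> clifford_clifford_relations"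
      "x \<in> clifford_clifford_relations \<Longrightarrow> x * z \<in> clifford_clifford_relations"
    by (simp_all add: clifford_clifford_relations_def clifford_proj_mult clifford_proj_zero)
qed

lemma clifford_clifford_relations_additive:
  "frag_of (TWord [x + y]) - frag_of (TWord [x]) - frag_of (TWord [y]) \<in>
      clifford_clifford_relations"
proof -
  have "tensor_class (frag_of (TWord [x + y]) - frag_of (TWord [x]) - frag_of (TWord [y])) =
      tensor_class 0"
    unfolding tensor_class_eq_iff using tensor_ideal_additive by simp
  then show ?thesis
    by (simp add: clifford_clifford_relations_def clifford_proj_def)
qed

lemma tensor_class_of_int: "tensor_class (of_int n :: 'a tword \<Rightarrow>\<^sub>0 int) =
    [n] \<cdot>\<^bsub>tensor_algebra\<^esub> \<one>\<^bsub>tensor_algebra\<^esub>"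
proof (induction n rule: int_induct[where k = 0])
  case base
  show ?case by (simp add: tensor_class_simps add_pow_def)
next
  case (step1 i)
  then show ?case
    by (simp add: tensor_class_simps tensor_algebra.add.int_pow_mult[of _ i 1]
        tensor_algebra.add.int_pow_1)
next
  case (step2 i)
  then show ?case
    using tensor_algebra.add.int_pow_mult[of "\<one>\<^bsub>tensor_algebra\<^esub> :: ('a tword \<Rightarrow>\<^sub>0 int) set" i "- 1"]
    by (simp add: tensor_class_simps tensor_algebra.add.int_pow_neg a_minus_def
        a_inv_def[symmetric])
qed

lemma clifford_generator:
  "tensor_vec v \<otimes>\<^bsub>tensor_algebra\<^esub> tensor_vec v
        \<ominus>\<^bsub>tensor_algebra\<^esub> [(form v v div 2)] \<cdot>\<^bsub>tensor_algebra\<^esub> \<one>\<^bsub>tensor_algebra\<^esub> =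
   tensor_class (frag_of (TWord [v]) * frag_of (TWord [v]) - of_int (form v v div 2))"
  by (simp add: tensor_class_simps tensor_vec_def tensor_class_of_int)

lemma clifford_clifford_relations_square:
  "frag_of (TWord [v]) * frag_of (TWord [v]) - of_int (form v v div 2) \<in>
      clifford_clifford_relations"
proof -
  let ?g = "tensor_class (frag_of (TWord [v]) * frag_of (TWord [v]) - of_int (form v v div 2))"
  have "?g \<in> clifford_ideal form"
    unfolding clifford_ideal_def clifford_generator
        using tensor_algebra.genideal_self[of "{tensor_class (frag_of (TWord [v]) * frag_of (TWord
            [v]) - of_int (form v v div 2)) | v. True}"]
    by (auto simp: carrier_tensor_algebra)
  then have "clifford_class form ?g = clifford_ideal form"
    unfolding clifford_class_def
    using abelian_subgroup.a_rcos_const[OF abelian_subgroupI3[OF ideal.axioms(1)[OF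
        ideal_clifford_ideal]]]
      tensor_algebra.abelian_group_axioms by blast
  moreover have "clifford_ideal form = \<zero>\<^bsub>clifford form\<^esub>"
    by (simp add: clifford_def FactRing_def)
  ultimately show ?thesis
    by (simp add: clifford_clifford_relations_def clifford_proj_zero) (simp add: clifford_proj_def)
qed

text \<open>Since \<open>I\<close> contains \<open>tensor_ideal\<close>, it is the full preimage of
  its image in the tensor algebra. That image is an ideal containing the generators of the Clifford
  ideal, hence the Clifford ideal itself, and pulling back gives the claim.\<close>

lemma clifford_clifford_relations_minimal:
  fixes I :: "('a tword \<Rightarrow>\<^sub>0 int) set"
  assumes "0 \<in> I" "\<And>x y. x \<in> I \<Longrightarrow> y \<in> I \<Longrightarrow> x - y \<in> I"
    "\<And>x y. y \<in> I \<Longrightarrow> x * y \<in> I" "\<And>x y. y \<in> I \<Longrightarrow> y * x \<in> I"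
    "\<And>x y. frag_of (TWord [x + y]) - frag_of (TWord [x]) - frag_of (TWord [y]) \<in> I"
    "\<And>v. frag_of (TWord [v]) * frag_of (TWord [v]) - of_int (form v v div 2) \<in> I"
  shows "clifford_clifford_relations \<subseteq> I"
proof
  fix x assume "x \<in> clifford_clifford_relations"
  have ti: "tensor_ideal \<subseteq> I" by (rule tensor_ideal_minimal) (use assms in auto)
  have neg: "- x \<in> I" if "x \<in> I" for x using assms(2)[OF assms(1) that] by simp
  have add: "x + y \<in> I" if "x \<in> I" "y \<in> I" for x y using assms(2)[OF that(1) neg[OF that(2)]]
      by simp
  have cI: "tensor_class x \<in> tensor_class ` I \<longleftrightarrow> x \<in> I" for x
    using add ti by (force simp: tensor_class_eq_iff)
  have "ideal (tensor_class ` I) tensor_algebra"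
  proof (rule idealI[OF ring_tensor_algebra])
    have "subgroup I (add_monoid free_ring)"
      using ideal_free_ringI[OF assms(1-4)] ideal.axioms(1) additive_subgroup.a_subgroup by blast
    then show "subgroup (tensor_class ` I) (add_monoid tensor_algebra)"
      using group_hom.subgroup_img_is_subgroup[OF tensor_class.a_group_hom] by blast
  next
    fix X Y :: "('a tword \<Rightarrow>\<^sub>0 int) set"
    assume "X \<in> tensor_class ` I" "Y \<in> carrier tensor_algebra"
    then obtain x y where *: "x \<in> I" "X = tensor_class x" "Y = tensor_class y"
      by (auto simp: carrier_tensor_algebra)
    show "Y \<otimes>\<^bsub>tensor_algebra\<^esub> X \<in> tensor_class ` I"
      using assms(3)[OF *(1)] by (simp add: * tensor_class_simps[symmetric])
    show "X \<otimes>\<^bsub>tensor_algebra\<^esub> Y \<in> tensor_class ` I"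
      using assms(4)[OF *(1)] by (simp add: * tensor_class_simps[symmetric])
  qed
  then have sub: "clifford_ideal form \<subseteq> tensor_class ` I"
    unfolding clifford_ideal_def
    by (rule tensor_algebra.genideal_minimal) (use assms(6) in \<open>auto simp: clifford_generator\<close>)
  have "clifford_proj x = clifford_ideal form"
    using \<open>x \<in> clifford_clifford_relations\<close>
        by (simp add: clifford_clifford_relations_def clifford_proj_zero clifford_def FactRing_def)
  then have "tensor_class x \<in> clifford_ideal form"
    using ideal.axioms(1)[OF ideal_clifford_ideal]
    unfolding clifford_proj_def clifford_class_def
    by (metis abelian_subgroup.a_rcos_self abelian_subgroupI3 carrier_tensor_algebra rangeI
        tensor_algebra.abelian_group_axioms)
  then show "x \<in> I" using sub cI by blast
qed

text \<open>An explicit description of the coset is needed because \<open>clifford_star\<close> is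
  defined elementwise.\<close>

lemma clifford_proj_set: "clifford_proj x = {tensor_class y | y. clifford_proj y = clifford_proj x}"
proof -
  have "clifford_proj x \<subseteq> range tensor_class"
    using ideal_clifford_ideal unfolding clifford_proj_def clifford_class_def
    by (metis additive_subgroup.a_subset carrier_tensor_algebra ideal.axioms(1) rangeI
        tensor_algebra.a_r_coset_subset_G)
  moreover have "tensor_class y \<in> clifford_proj x \<longleftrightarrow> clifford_proj y = clifford_proj x" for y
  proof
    assume "tensor_class y \<in> clifford_proj x"
    then show "clifford_proj y = clifford_proj x" unfolding clifford_proj_def clifford_class_def
      using ideal_clifford_ideal
      by (metis abelian_subgroup.a_repr_independence' abelian_subgroupI3 carrier_tensor_algebra
          ideal.axioms(1) rangeI tensor_algebra.abelian_group_axioms)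
  next
    assume "clifford_proj y = clifford_proj x"
    then show "tensor_class y \<in> clifford_proj x"
      using ideal_clifford_ideal unfolding clifford_proj_def clifford_class_def
      by (metis abelian_subgroup.a_rcos_self abelian_subgroupI3 carrier_tensor_algebra
          ideal.axioms(1) rangeI tensor_algebra.abelian_group_axioms)
  qed
  ultimately show ?thesis by blast
qed

end

section \<open>Reversal on the free ring\<close>

lemma frag_of_word_mult: "frag_of u * frag_of w = frag_of (TWord (letters u @ letters w))"
  by (simp add: Poly_Mapping.mult_single plus_tword_def)

lemma free_reverse_simps [simp]:
  "free_reverse 0 = 0" "free_reverse (x + y) = free_reverse x + free_reverse y"
  "free_reverse (x - y) = free_reverse x - free_reverse y" "free_reverse (- x) = - free_reverse x"
  "free_reverse (frag_of w) = frag_of (TWord (rev (letters w)))"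
  by (simp_all add: free_reverse_def frag_extend_add frag_extend_diff frag_extend_minus)

lemma free_induct [case_names zero one diff]:
  fixes x :: "'a \<Rightarrow>\<^sub>0 int"
  assumes "P 0" "\<And>w. P (frag_of w)" "\<And>x y. P x \<Longrightarrow> P y \<Longrightarrow> P (x - y)"
  shows "P x"
  by (rule frag_induction[of x UNIV]) (use assms in auto)

lemma free_reverse_free_reverse [simp]: "free_reverse (free_reverse x) = x"
  by (induction x rule: free_induct) auto

lemma free_reverse_mult: "free_reverse (x * y) = free_reverse y * free_reverse x"
proof (induction x rule: free_induct)
  case (one w)
  show ?case
    by (induction y rule: free_induct) (auto simp: frag_of_word_mult algebra_simps)
qed (auto simp: algebra_simps)

text \<open>The generating relations involve words of length one, which reversal fixes, and reversal
  exchanges left and right multiples. Involutivity gives the converse direction.\<close>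

lemma free_reverse_tensor_ideal: "free_reverse x \<in> tensor_ideal \<longleftrightarrow> x \<in> tensor_ideal"
proof -
  have "tensor_ideal \<subseteq> {x. free_reverse x \<in> tensor_ideal}"
    by (rule tensor_ideal_minimal)
      (use tensor_ideal_additive in \<open>auto simp: tensor_ideal_closed free_reverse_mult\<close>)
  then show ?thesis by (metis free_reverse_free_reverse mem_Collect_eq subsetD)
qed

lemma free_reverse_tensor_class: "free_reverse ` tensor_class x = tensor_class (free_reverse x)"
proof -
  have "y \<in> free_reverse ` tensor_class x \<longleftrightarrow> free_reverse y \<in> tensor_class x" for y
    by (metis free_reverse_free_reverse image_iff)
  then show ?thesis
    by (auto simp: tensor_class_set) (metis free_reverse_free_reverse free_reverse_simps(3)
        free_reverse_tensor_ideal)+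
qed

section \<open>Lattices of rank three\<close>

lemma det_2:
  fixes A :: "int mat"
  assumes "A \<in> carrier_mat 2 2"
  shows "det A = A $$ (0, 0) * A $$ (1, 1) - A $$ (1, 0) * A $$ (0, 1)"
proof -
  have "mat_delete A 0 0 \<in> carrier_mat 1 1" "mat_delete A 1 0 \<in> carrier_mat 1 1"
    using assms by (auto simp: mat_delete_def)
  then show ?thesis
    using assms by (subst laplace_expansion_column[OF assms, of 0])
      (auto simp: lessThan_Suc numeral_2_eq_2 cofactor_def det_single mat_delete_def)
qed

lemma det_3:
  fixes A :: "int mat"
  assumes A: "A \<in> carrier_mat 3 3"
  shows "det A = A $$ (0, 0) * (A $$ (1, 1) * A $$ (2, 2) - A $$ (2, 1) * A $$ (1, 2))
    - A $$ (1, 0) * (A $$ (0, 1) * A $$ (2, 2) - A $$ (2, 1) * A $$ (0, 2))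
    + A $$ (2, 0) * (A $$ (0, 1) * A $$ (1, 2) - A $$ (1, 1) * A $$ (0, 2))"
proof -
  have del: "mat_delete A i 0 \<in> carrier_mat 2 2" for i
    using A by (auto simp: mat_delete_def)
  have set: "{..<3} = {0, 1, 2 :: nat}" by auto
  have "det A = A $$ (0, 0) * cofactor A 0 0 + A $$ (1, 0) * cofactor A 1 0 +
      A $$ (2, 0) * cofactor A 2 0"
    by (subst laplace_expansion_column[OF A, of 0]) (auto simp: set)
  then show ?thesis
    using A by (simp add: cofactor_def det_2[OF del]) (simp add: mat_delete_def numeral_2_eq_2
        algebra_simps)
qed

locale ternary_lattice = int_lattice scale form + ternary_form a b c r s t
  for scale :: "int \<Rightarrow> 'a::ab_group_add \<Rightarrow> 'a" and form :: "'a \<Rightarrow> 'a \<Rightarrow> int"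
    and a b c r s t :: int +
  fixes e1 e2 e3 :: 'a
  assumes basis: "ordered_basis scale [e1, e2, e3]"
    and even: "even_form form"
    and nondegenerate: "nondegenerate_form form"
    and gram: "form e1 e1 = 2 * a" "form e2 e2 = 2 * b" "form e3 e3 = 2 * c"
      "form e2 e3 = r" "form e1 e3 = s" "form e1 e2 = t"
begin

definition co1 :: "'a \<Rightarrow> int" where "co1 x = representation {e1, e2, e3} x e1"
definition co2 :: "'a \<Rightarrow> int" where "co2 x = representation {e1, e2, e3} x e2"
definition co3 :: "'a \<Rightarrow> int" where "co3 x = representation {e1, e2, e3} x e3"

lemma distinct_basis: "e1 \<noteq> e2" "e1 \<noteq> e3" "e2 \<noteq> e3"
  using basis by (auto simp: ordered_basis_def)

lemma independent_basis: "independent {e1, e2, e3}" and span_basis: "span {e1, e2, e3} = UNIV"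
  using basis by (simp_all add: ordered_basis_def)

lemma expand: "x = scale (co1 x) e1 + scale (co2 x) e2 + scale (co3 x) e3"
proof -
  have "(\<Sum>v\<in>{e1, e2, e3}. scale (representation {e1, e2, e3} x v) v) = x"
    by (rule sum_representation_eq) (simp_all add: independent_basis span_basis)
  then show ?thesis
    using distinct_basis by (simp add: co1_def co2_def co3_def add.assoc)
qed

lemma co_eqI:
  assumes "x = scale x1 e1 + scale x2 e2 + scale x3 e3"
  shows "co1 x = x1 \<and> co2 x = x2 \<and> co3 x = x3"
proof -
  let ?f = "\<lambda>v. if v = e1 then x1 else if v = e2 then x2 else if v = e3 then x3 else 0"
  have "representation {e1, e2, e3} x = ?f"
  proof (rule representation_eqI[OF independent_basis])
    show "x \<in> span {e1, e2, e3}" by (simp add: span_basis)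
    show "v \<in> {e1, e2, e3}" if "?f v \<noteq> 0" for v using that by (auto split: if_splits)
    show fin: "finite {v. ?f v \<noteq> 0}"
      by (rule finite_subset[of _ "{e1, e2, e3}"]) (auto split: if_splits)
    have "(\<Sum>v | ?f v \<noteq> 0. scale (?f v) v) = (\<Sum>v\<in>{e1, e2, e3}. scale (?f v) v)"
      by (rule sum.mono_neutral_left) (auto split: if_splits)
    also have "\<dots> = x" using distinct_basis by (simp add: assms add.assoc)
    finally show "(\<Sum>v | ?f v \<noteq> 0. scale (?f v) v) = x" .
  qed
  then show ?thesis using distinct_basis by (simp add: co1_def co2_def co3_def)
qed

lemma co_add: "co1 (x + y) = co1 x + co1 y" "co2 (x + y) = co2 x + co2 y"
    "co3 (x + y) = co3 x + co3 y"
proof -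
  have "x + y = scale (co1 x + co1 y) e1 + scale (co2 x + co2 y) e2 + scale (co3 x + co3 y) e3"
    by (subst expand[of x], subst expand[of y]) (simp add: scale_left_distrib algebra_simps)
  from co_eqI[OF this] show "co1 (x + y) = co1 x + co1 y" "co2 (x + y) = co2 x + co2 y"
      "co3 (x + y) = co3 x + co3 y"
    by auto
qed

lemma co_scale: "co1 (scale n x) = n * co1 x" "co2 (scale n x) = n * co2 x"
    "co3 (scale n x) = n * co3 x"
proof -
  have "scale n x = scale (n * co1 x) e1 + scale (n * co2 x) e2 + scale (n * co3 x) e3"
    by (subst expand[of x]) (simp add: scale_right_distrib)
  from co_eqI[OF this] show "co1 (scale n x) = n * co1 x" "co2 (scale n x) = n * co2 x"
      "co3 (scale n x) = n * co3 x"
    by auto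
qed

lemma co_basis [simp]: "co1 e1 = 1" "co2 e1 = 0" "co3 e1 = 0" "co1 e2 = 0" "co2 e2 = 1" "co3 e2 = 0"
   "co1 e3 = 0" "co2 e3 = 0" "co3 e3 = 1"
  using co_eqI[of e1 1 0 0] co_eqI[of e2 0 1 0] co_eqI[of e3 0 0 1] by simp_all

lemma form_add_right: "form x (y + z) = form x y + form x z"
  and form_scale_right: "form x (scale n y) = n * form x y"
  using form_linear[of x] by (simp_all add: Modules.module_hom.add Modules.module_hom.scale)

lemma form_add_left: "form (x + y) z = form x z + form y z"
  using form_add_right[of z x y] by (simp add: form_sym)

lemma form_scale_left: "form (scale n x) y = n * form x y"
  using form_scale_right[of y n x] by (simp add: form_sym)

lemma form_coords:
  "form x y = 2 * a * (co1 x * co1 y) + 2 * b * (co2 x * co2 y) + 2 * c * (co3 x * co3 y) +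
     r * (co2 x * co3 y + co3 x * co2 y) + s * (co1 x * co3 y + co3 x * co1 y) +
     t * (co1 x * co2 y + co2 x * co1 y)"
  by (subst expand[of x], subst expand[of y])
    (simp add: form_add_left form_add_right form_scale_left form_scale_right gram
      form_sym[of e2 e1] form_sym[of e3 e1] form_sym[of e3 e2] algebra_simps)

definition q :: "'a \<Rightarrow> int" where "q x = form x x div 2"

lemma form_self: "form x x = 2 * q x"
  using even by (simp add: q_def even_form_def)

lemma q_add: "q (x + y) = q x + q y + form x y"
  using form_self[of "x + y"]
  by (simp add: form_add_left form_add_right form_self[of x] form_self[of y] form_sym[of y x])

definition vec :: "'a \<Rightarrow> coord_op" where
  "vec x = vec_elt (co1 x) (co2 x) (co3 x)"

lemma vec_add: "vec (x + y) = vec x + vec y"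
  by (simp add: vec_def co_add to_lin)

lemma vec_scale: "vec (scale n x) = of_int n * vec x"
  by (simp add: vec_def co_scale to_lin)

lemma vec_inject [simp]: "vec x = vec y \<longleftrightarrow> x = y"
  using expand[of x] expand[of y] by (auto simp: vec_def)

lemma vec_elt_is_vec: "\<exists>x. vec_elt y1 y2 y3 = vec x"
proof
  show "vec_elt y1 y2 y3 = vec (scale y1 e1 + scale y2 e2 + scale y3 e3)"
    by (simp add: vec_def co_add co_scale)
qed

lemma vec_odd [simp]: "vec x \<in> odd_part"
  by (simp add: vec_def)

lemma star_vec' [simp]: "star (vec x) = vec x"
  by (simp add: vec_def)

lemma vec_mult_vec: "vec x * vec y + vec y * vec x = of_int (form x y)"
  unfolding lin_of_int vec_def form_coords by (simp only: to_lin) (simp add: algebra_simps)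

lemma vec_square: "vec x * vec x = of_int (q x)"
proof -
  have "of_int 2 * (vec x * vec x) = vec x * vec x + vec x * vec x" by (simp add: mult_2)
  also have "\<dots> = of_int 2 * of_int (q x)" unfolding vec_mult_vec by (simp add: form_self)
  finally show ?thesis by (simp only: of_int_mult_cancel) simp
qed

lemma vec_basis: "vec e1 = E1" "vec e2 = E2" "vec e3 = E3"
  by (simp_all add: vec_def lin_E)

section \<open>Evaluation of words and normal forms modulo the Clifford relations\<close>

definition free_eval :: "('a tword \<Rightarrow>\<^sub>0 int) \<Rightarrow> coord_op" where
  "free_eval x = (\<Sum>w\<in>Poly_Mapping.keys x. of_int (Poly_Mapping.lookup x w) * prod_list (map vec
      (letters w)))"

lemma free_eval_superset:
  assumes "finite S" "Poly_Mapping.keys x \<subseteq> S"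
  shows "free_eval x = (\<Sum>w\<in>S. of_int (Poly_Mapping.lookup x w) * prod_list (map vec (letters w)))"
  unfolding free_eval_def
  by (rule sum.mono_neutral_left) (use assms in \<open>auto simp: in_keys_iff\<close>)

lemma free_eval_diff: "free_eval (x - y) = free_eval x - free_eval y"
proof -
  let ?S = "Poly_Mapping.keys x \<union> Poly_Mapping.keys y"
  have "Poly_Mapping.keys (x - y) \<subseteq> ?S" by (rule keys_diff)
  then show ?thesis
    by (simp add: free_eval_superset[of ?S] lookup_minus left_diff_distrib sum_subtractf)
qed

lemma free_eval_zero [simp]: "free_eval 0 = 0"
  by (simp add: free_eval_def)

lemma free_eval_uminus: "free_eval (- x) = - free_eval x"
  using free_eval_diff[of 0 x] by simp

lemma free_eval_add: "free_eval (x + y) = free_eval x + free_eval y"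
  using free_eval_diff[of x "- y"] by (simp add: free_eval_uminus)

lemma free_eval_word [simp]: "free_eval (frag_of w) = prod_list (map vec (letters w))"
  by (simp add: free_eval_def keys_frag_of)

lemma free_eval_mult: "free_eval (x * y) = free_eval x * free_eval y"
proof (induction x rule: free_induct)
  case (one w)
  show ?case
    by (induction y rule: free_induct) (simp_all add: frag_of_word_mult free_eval_diff
        algebra_simps)
qed (auto simp: free_eval_diff algebra_simps)

lemma free_eval_one [simp]: "free_eval 1 = 1"
  using free_eval_word[of 0] by (simp add: zero_tword_def[symmetric]) (simp add: zero_tword_def)

lemma free_eval_of_int [simp]: "free_eval (of_int n) = of_int n"
  by (induction n rule: int_induct[where k = 0]) (simp_all add: free_eval_add free_eval_diff)

lemma free_eval_word_range: "prod_list (map vec ws) \<in> range lin"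
proof (induction ws)
  case Nil
  then show ?case by (simp add: lin_1)
next
  case (Cons w ws)
  then show ?case by (simp add: lin_mult_closed odd_part_range)
qed

text \<open>The universal property: \<open>vec\<close> is additive and \<open>vec v\<close> squares
  to the integer \<open>q v\<close>, so the kernel of the evaluation is an ideal containing all
  relations.\<close>

lemma free_eval_clifford_relations: "x \<in> clifford_clifford_relations form \<Longrightarrow> free_eval x = 0"
proof -
  have "clifford_clifford_relations form \<subseteq> {x. free_eval x = 0}"
    by (rule clifford_clifford_relations_minimal) (auto simp: free_eval_diff free_eval_mult
        vec_add vec_square[unfolded q_def])
  then show "x \<in> clifford_clifford_relations form \<Longrightarrow> free_eval x = 0" by blast
qed

abbreviation "X1 \<equiv> frag_of (TWord [e1])"
abbreviation "X2 \<equiv> frag_of (TWord [e2])"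
abbreviation "X3 \<equiv> frag_of (TWord [e3])"

abbreviation linF :: "cl_coords \<Rightarrow> ('a tword \<Rightarrow>\<^sub>0 int)" where "linF \<equiv> lin_comb X1 X2 X3"

lemma free_eval_linF: "free_eval (linF v) = lin v"
  by (cases v) (simp add: free_eval_add free_eval_mult vec_basis lin_CV lin_comb.simps)

text \<open>Polarisation of the square relation at \<open>x\<close>, \<open>y\<close> and
  \<open>x + y\<close>. The correction terms with \<open>?l\<close> account for letters being
  additive only modulo the ideal.\<close>

lemma relation_polar: "frag_of (TWord [x]) * frag_of (TWord [y]) +
    frag_of (TWord [y]) * frag_of (TWord [x])
   - of_int (form x y) \<in> clifford_clifford_relations form"
proof -
  let ?x = "frag_of (TWord [x])" and ?y = "frag_of (TWord [y])" and ?z = "frag_of (TWord [x + y])"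
  let ?l = "?z - ?x - ?y"
  have n: "of_int (form (x + y) (x + y) div 2) =
     (of_int (form x x div 2) + of_int (form y y div 2) + of_int (form x y) :: 'a tword \<Rightarrow>\<^sub>0 int)"
    using q_add[of x y] by (simp add: q_def)
  have "?x * ?y + ?y * ?x - of_int (form x y) =
     (?z * ?z - of_int (form (x + y) (x + y) div 2)) - (?x * ?x - of_int (form x x div 2))
     - (?y * ?y - of_int (form y y div 2)) - ?l * ?z - (?x + ?y) * ?l"
    unfolding n by (simp only: algebra_simps)
  also have "\<dots> \<in> clifford_clifford_relations form"
    by (rule clifford_clifford_relations_square clifford_clifford_relations_additive | rule
        clifford_clifford_relations_closed)+
  finally show ?thesis .
qed

lemma clifford_clifford_relations_basis:
  "X1 * X1 - of_int a \<in> clifford_clifford_relations form"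
      "X2 * X2 - of_int b \<in> clifford_clifford_relations form"
  "X3 * X3 - of_int c \<in> clifford_clifford_relations form"
      "X2 * X1 + X1 * X2 - of_int t \<in> clifford_clifford_relations form"
  "X3 * X1 + X1 * X3 - of_int s \<in> clifford_clifford_relations form"
      "X3 * X2 + X2 * X3 - of_int r \<in> clifford_clifford_relations form"
  using clifford_clifford_relations_square[of e1 form] clifford_clifford_relations_square[of e2
      form] clifford_clifford_relations_square[of e3 form]
    relation_polar[of e2 e1] relation_polar[of e3 e1] relation_polar[of e3 e2]
  by (simp_all add: gram form_sym[of e2 e1] form_sym[of e3 e1] form_sym[of e3 e2])

lemma X_linF:
  "X1 * linF v - linF (op1 v) \<in> clifford_clifford_relations form"
  "X2 * linF v - linF (op2 v) \<in> clifford_clifford_relations form"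
  "X3 * linF v - linF (op3 v) \<in> clifford_clifford_relations form"
proof -
  obtain x0 x1 x2 x3 y1 y2 y3 y0 where v: "v = CV x0 x1 x2 x3 y1 y2 y3 y0" by (cases v)
  show "X1 * linF v - linF (op1 v) \<in> clifford_clifford_relations form"
    "X2 * linF v - linF (op2 v) \<in> clifford_clifford_relations form"
    "X3 * linF v - linF (op3 v) \<in> clifford_clifford_relations form"
    unfolding v mult_lin_comb
        by (rule clifford_clifford_relations_basis | rule clifford_clifford_relations_closed)+
qed

lemma clifford_clifford_relations_scale: "frag_of (TWord [scale n x]) - of_int n * frag_of (TWord
    [x]) \<in> clifford_clifford_relations form"
proof (induction n rule: int_induct[where k = 0])
  case base
  \<comment> \<open>Additivity at the pair 0, 0 yields minus the letter 0.\<close>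
  show ?case using clifford_clifford_relations_additive[of 0 0 form]
      clifford_clifford_relations_closed(3) by force
next
  case (step1 i)
  have "frag_of (TWord [scale (i + 1) x]) - of_int (i + 1) * frag_of (TWord [x]) =
    (frag_of (TWord [scale i x + x]) - frag_of (TWord [scale i x]) - frag_of (TWord [x])) +
    (frag_of (TWord [scale i x]) - of_int i * frag_of (TWord [x]))"
    by (simp add: scale_left_distrib algebra_simps)
  then show ?case
      using clifford_clifford_relations_closed(2)[OF clifford_clifford_relations_additive
          step1(2)] by metis
next
  case (step2 i)
  have "frag_of (TWord [scale (i - 1) x]) - of_int (i - 1) * frag_of (TWord [x]) =
    (frag_of (TWord [scale i x]) - of_int i * frag_of (TWord [x])) -
    (frag_of (TWord [scale (i - 1) x + x]) - frag_of (TWord [scale (i - 1) x]) - frag_of (TWord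
        [x]))"
    by (simp add: scale_left_diff_distrib algebra_simps)
  then show ?case
      using clifford_clifford_relations_closed(4)[OF step2(2)
          clifford_clifford_relations_additive] by metis
qed

lemma clifford_clifford_relations_expand:
  "frag_of (TWord [x]) - (of_int (co1 x) * X1 + of_int (co2 x) * X2 + of_int (co3 x) * X3) \<in>
      clifford_clifford_relations form"
proof -
  let ?f = "\<lambda>x. frag_of (TWord [x])"
  let ?x1 = "scale (co1 x) e1" and ?x2 = "scale (co2 x) e2" and ?x3 = "scale (co3 x) e3"
  have "?f (?x1 + ?x2 + ?x3) - (of_int (co1 x) * X1 + of_int (co2 x) * X2 + of_int (co3 x) * X3) =
    (?f (?x1 + ?x2 + ?x3) - ?f (?x1 + ?x2) - ?f ?x3) + (?f (?x1 + ?x2) - ?f ?x1 - ?f ?x2) +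
    (?f ?x1 - of_int (co1 x) * X1) + (?f ?x2 - of_int (co2 x) * X2) +
        (?f ?x3 - of_int (co3 x) * X3)"
    by simp
  also have "\<dots> \<in> clifford_clifford_relations form"
    by (rule clifford_clifford_relations_additive clifford_clifford_relations_scale | rule
        clifford_clifford_relations_closed)+
  finally show ?thesis by (simp add: expand[symmetric])
qed

text \<open>Induction on the word: the tail is replaced by its normal form, the first letter is
  expanded in the basis, and \<open>X_linF\<close> moves each basis letter into the normal form. The
  displayed equation telescopes these three replacements.\<close>

lemma word_linF:
  "frag_of (TWord ws) - linF (app (free_eval (frag_of (TWord ws))) unit_coords) \<in>
      clifford_clifford_relations form"
proof (induction ws)
  case Nil
  have "frag_of (TWord []) = (1 :: 'a tword \<Rightarrow>\<^sub>0 int)" by (simp add: zero_tword_def[symmetric])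
  then show ?case by (simp add: unit_coords_def lin_comb.simps clifford_clifford_relations_closed)
next
  case (Cons w ws)
  let ?l = "of_int (co1 w) * X1 + of_int (co2 w) * X2 + of_int (co3 w) * X3"
  let ?n = "app (free_eval (frag_of (TWord ws))) unit_coords"
  have w: "frag_of (TWord (w # ws)) = frag_of (TWord [w]) * frag_of (TWord ws)"
    by (simp add: frag_of_word_mult)
  have n: "app (free_eval (frag_of (TWord (w # ws)))) unit_coords =
     cscale (co1 w) (op1 ?n) + cscale (co2 w) (op2 ?n) + cscale (co3 w) (op3 ?n)"
    by (simp add: vec_def lin_CV)
  have "frag_of (TWord (w # ws)) - linF (app (free_eval (frag_of (TWord (w # ws)))) unit_coords) =
     frag_of (TWord [w]) * (frag_of (TWord ws) - linF ?n) + (frag_of (TWord [w]) - ?l) * linF ?n +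
     of_int (co1 w) * (X1 * linF ?n - linF (op1 ?n)) +
         of_int (co2 w) * (X2 * linF ?n - linF (op2 ?n)) +
     of_int (co3 w) * (X3 * linF ?n - linF (op3 ?n))"
    unfolding n unfolding w lin_comb_add lin_comb_cscale by (simp only: algebra_simps)
  also have "\<dots> \<in> clifford_clifford_relations form"
    by (rule Cons clifford_clifford_relations_expand X_linF | rule
        clifford_clifford_relations_closed)+
  finally show ?case .
qed

lemma reduce_linF: "x - linF (app (free_eval x) unit_coords) \<in> clifford_clifford_relations form"
proof (induction x rule: free_induct)
  case zero
  show ?case by (simp add: clifford_clifford_relations_closed)
next
  case (one w)
  then show ?case using word_linF[of "letters w"] by simp
next
  case (diff x y)
  then have "(x - linF (app (free_eval x) unit_coords)) - (y - linF (app (free_eval y)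
      unit_coords)) \<in> clifford_clifford_relations form"
    by (rule clifford_clifford_relations_closed)
  then show ?case by (simp add: free_eval_diff lin_comb_diff algebra_simps)
qed

text \<open>Faithfulness of the coordinate model: by \<open>reduce_linF\<close> an element is
  congruent to the normal form read off from its evaluation, and this is 0 if the evaluation
  is.\<close>

lemma clifford_clifford_relations_iff: "x \<in> clifford_clifford_relations form \<longleftrightarrow> free_eval x = 0"
proof
  assume "free_eval x = 0"
  then show "x \<in> clifford_clifford_relations form" using reduce_linF[of x] by simp
qed (rule free_eval_clifford_relations)

lemma clifford_proj_eq_free_eval: "clifford_proj form x = clifford_proj form y \<longleftrightarrow>
    free_eval x = free_eval y"
  by (simp add: clifford_proj_eq_iff clifford_clifford_relations_iff free_eval_diff)

text \<open>The inverse of the isomorphism induced by \<open>free_eval\<close>. An operator outside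
  \<open>range lin\<close> is no evaluation and is sent to the empty set, which explains the range
  hypotheses below.\<close>

definition to_clifford :: "coord_op \<Rightarrow> 'a cliff" where
  "to_clifford x = {tensor_class y | y. free_eval y = x}"

lemma to_clifford_free_eval: "to_clifford (free_eval x) = clifford_proj form x"
  unfolding to_clifford_def by (subst clifford_proj_set) (simp add: clifford_proj_eq_free_eval)

lemma rangeE_free_eval:
  assumes "x \<in> range lin" obtains y where "x = free_eval y"
  using assms free_eval_linF by (metis imageE)

lemma to_clifford_inject: "x \<in> range lin \<Longrightarrow> y \<in> range lin \<Longrightarrow> to_clifford x = to_clifford y \<longleftrightarrow> x = y"
  by (elim rangeE_free_eval) (simp add: to_clifford_free_eval clifford_proj_eq_free_eval)

lemma to_clifford_closed: "x \<in> range lin \<Longrightarrow> to_clifford x \<in> carrier (clifford form)"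
  by (elim rangeE_free_eval) (simp add: to_clifford_free_eval)

lemma to_clifford_mult: "x \<in> range lin \<Longrightarrow> y \<in> range lin \<Longrightarrow>
    to_clifford (x * y) = to_clifford x \<otimes>\<^bsub>clifford form\<^esub> to_clifford y"
  by (elim rangeE_free_eval) (simp add: to_clifford_free_eval free_eval_mult[symmetric]
      clifford_proj_mult)

lemma to_clifford_uminus: "x \<in> range lin \<Longrightarrow> to_clifford (- x) = \<ominus>\<^bsub>clifford form\<^esub> to_clifford x"
  by (elim rangeE_free_eval) (simp add: to_clifford_free_eval free_eval_uminus[symmetric]
      clifford_proj_uminus)

lemma to_clifford_one: "to_clifford 1 = \<one>\<^bsub>clifford form\<^esub>"
  using to_clifford_free_eval[of 1] by (simp add: clifford_proj_one)

lemma to_clifford_sign: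
  assumes "x \<in> range lin"
  shows "[(1::int)] \<cdot>\<^bsub>clifford form\<^esub> to_clifford x = to_clifford x"
    "[(- 1::int)] \<cdot>\<^bsub>clifford form\<^esub> to_clifford x = to_clifford (- x)"
proof -
  interpret ring "clifford form" by (rule ring_clifford)
  show "[(1::int)] \<cdot>\<^bsub>clifford form\<^esub> to_clifford x = to_clifford x"
    by (simp add: add.int_pow_1 to_clifford_closed assms)
  have "[(- 1::int)] \<cdot>\<^bsub>clifford form\<^esub> to_clifford x =
      \<ominus>\<^bsub>clifford form\<^esub> ([(1::int)] \<cdot>\<^bsub>clifford form\<^esub> to_clifford x)"
    using add.int_pow_neg[of "to_clifford x" 1] to_clifford_closed assms by (simp add: a_inv_def)
  then show "[(- 1::int)] \<cdot>\<^bsub>clifford form\<^esub> to_clifford x = to_clifford (- x)"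
    by (simp add: add.int_pow_1 to_clifford_closed assms to_clifford_uminus)
qed

lemma clifford_vec_to_clifford: "clifford_vec form v = to_clifford (vec v)"
  using to_clifford_free_eval[of "frag_of (TWord [v])"]
      by (simp add: clifford_vec_def tensor_vec_def clifford_proj_def)

section \<open>Parity, reversal and the unit group under \<open>to_clifford\<close>\<close>

lemma prod_vec_parity:
  "prod_list (map vec ws) \<in> (if even (length ws) then even_part else odd_part)"
  by (induction ws) (auto simp: part_mult split: if_splits)

lemma part_sum:
  "(\<And>i. i \<in> I \<Longrightarrow> f i \<in> even_part) \<Longrightarrow> sum f I \<in> even_part"
  "(\<And>i. i \<in> I \<Longrightarrow> f i \<in> odd_part) \<Longrightarrow> sum f I \<in> odd_part"
  by (induction I rule: infinite_finite_induct) (auto simp: part_add)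

lemma free_eval_even:
  assumes "\<forall>w\<in>Poly_Mapping.keys x. even (length (letters w))"
  shows "free_eval x \<in> even_part"
  unfolding free_eval_def
proof (intro part_sum(1) part_scale(1))
  fix w assume "w \<in> Poly_Mapping.keys x"
  then show "prod_list (map vec (letters w)) \<in> even_part"
    using prod_vec_parity[of "letters w"] assms by simp
qed

lemma free_eval_odd:
  assumes "\<forall>w\<in>Poly_Mapping.keys x. odd (length (letters w))"
  shows "free_eval x \<in> odd_part"
  unfolding free_eval_def
proof (intro part_sum(2) part_scale(2))
  fix w assume "w \<in> Poly_Mapping.keys x"
  then show "prod_list (map vec (letters w)) \<in> odd_part"
    using prod_vec_parity[of "letters w"] assms by simp
qed

lemma free_of_int: "of_int n = (Poly_Mapping.single 0 n :: 'a tword \<Rightarrow>\<^sub>0 int)"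
  by (induction n rule: int_induct[where k = 0]) (simp_all add: single_add single_diff)

lemma keys_scaled_word: "Poly_Mapping.keys (of_int n * frag_of w) \<subseteq> {w}" for w :: "'a tword"
  by (simp add: free_of_int mult_single)

lemma keys_add_ball:
  "\<forall>w\<in>Poly_Mapping.keys x. P w \<Longrightarrow> \<forall>w\<in>Poly_Mapping.keys y. P w \<Longrightarrow> \<forall>w\<in>Poly_Mapping.keys (x + y). P w"
  using keys_add[of x y] by blast

text \<open>The definition of \<open>clifford_even\<close> asks for a representative supported on
  words of even length; the normal form of an even element is one.\<close>

lemma linF_even_keys:
  "\<forall>w\<in>Poly_Mapping.keys (linF (CV x0 x1 x2 x3 0 0 0 0)). even (length (letters w))"
proof -
  have 1: "\<forall>w\<in>Poly_Mapping.keys (of_int n * frag_of (TWord [u, v])). even (length (letters w))"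
      for n and u v :: 'a
    using keys_scaled_word[of n "TWord [u, v]"] by auto
  have 2: "\<forall>w\<in>Poly_Mapping.keys (of_int n :: 'a tword \<Rightarrow>\<^sub>0 int). even (length (letters w))" for n
    by (auto simp: free_of_int zero_tword_def)
  show ?thesis
    by (simp only: lin_comb.simps frag_of_word_mult tword.sel append.simps of_int_0 mult_zero_left
        add_0_right)
      (intro keys_add_ball 1 2)
qed

lemma linF_odd_keys:
  "\<forall>w\<in>Poly_Mapping.keys (linF (CV 0 0 0 0 y1 y2 y3 y0)). odd (length (letters w))"
proof -
  have 1: "\<forall>w\<in>Poly_Mapping.keys (of_int n * frag_of (TWord [u])). odd (length (letters w))"
     "\<forall>w\<in>Poly_Mapping.keys (of_int n * frag_of (TWord [u, v, v'])). odd (length (letters w))"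
         for n and u v v' :: 'a
    using keys_scaled_word[of n "TWord [u]"] keys_scaled_word[of n "TWord [u, v, v']"] by auto
  show ?thesis
    by (simp only: lin_comb.simps frag_of_word_mult tword.sel append.simps of_int_0 mult_zero_left
        add_0_right add_0_left)
      (intro keys_add_ball 1)
qed

lemma clifford_even_to_clifford: "clifford_even form = to_clifford ` even_part"
proof
  show "clifford_even form \<subseteq> to_clifford ` even_part"
    using free_eval_even
        by (auto simp: clifford_even_def clifford_proj_def[symmetric]
            to_clifford_free_eval[symmetric])
  show "to_clifford ` even_part \<subseteq> clifford_even form"
  proof
    fix X assume "X \<in> to_clifford ` even_part"
    then obtain x0 x1 x2 x3 where "X = to_clifford (free_eval (linF (CV x0 x1 x2 x3 0 0 0 0)))"
      by (auto simp: even_part_def free_eval_linF)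
    then show "X \<in> clifford_even form"
      using linF_even_keys
          unfolding clifford_even_def clifford_proj_def[symmetric] to_clifford_free_eval by blast
  qed
qed

lemma clifford_odd_to_clifford: "clifford_odd form = to_clifford ` odd_part"
proof
  show "clifford_odd form \<subseteq> to_clifford ` odd_part"
    using free_eval_odd
        by (auto simp: clifford_odd_def clifford_proj_def[symmetric]
            to_clifford_free_eval[symmetric])
  show "to_clifford ` odd_part \<subseteq> clifford_odd form"
  proof
    fix X assume "X \<in> to_clifford ` odd_part"
    then obtain y1 y2 y3 y0 where "X = to_clifford (free_eval (linF (CV 0 0 0 0 y1 y2 y3 y0)))"
      by (auto simp: odd_part_def free_eval_linF)
    then show "X \<in> clifford_odd form"
      using linF_odd_keys
          unfolding clifford_odd_def clifford_proj_def[symmetric] to_clifford_free_eval by blast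
  qed
qed

lemma star_prod_vec: "star (prod_list (map vec ws)) = prod_list (map vec (rev ws))"
proof (induction ws)
  case (Cons w ws)
  have "star (vec w * prod_list (map vec ws)) = star (prod_list (map vec ws)) * vec w"
    by (simp add: star_mult free_eval_word_range odd_part_range)
  then show ?case by (simp add: Cons)
qed simp

lemma free_eval_free_reverse: "free_eval (free_reverse x) = star (free_eval x)"
proof (induction x rule: free_induct)
  case zero
  show ?case using star_of_int[of 0] by simp
qed (simp_all add: star_prod_vec free_eval_diff star_diff)

lemma clifford_star_to_clifford:
  assumes "x \<in> range lin"
  shows "clifford_star (to_clifford x) = to_clifford (star x)"
proof -
  have "clifford_star (to_clifford x) = {free_reverse ` tensor_class y | y. free_eval y = x}"
    by (auto simp: clifford_star_def to_clifford_def)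
  also have "\<dots> = {tensor_class (free_reverse y) | y. free_eval y = x}"
    by (simp add: free_reverse_tensor_class)
  also have "\<dots> = {tensor_class z | z. free_eval z = star x}"
  proof (intro Collect_cong iffI; elim exE conjE)
    fix X z assume "X = tensor_class z" "free_eval z = star x"
    then have "X = tensor_class (free_reverse (free_reverse z)) \<and> free_eval (free_reverse z) = x"
      using assms by (simp add: free_eval_free_reverse star_star)
    then show "\<exists>y. X = tensor_class (free_reverse y) \<and> free_eval y = x" by blast
  next
    fix X y assume "X = tensor_class (free_reverse y)" "free_eval y = x"
    then show "\<exists>z. X = tensor_class z \<and> free_eval z = star x"
      using free_eval_free_reverse[of y] by blast
  qed
  finally show ?thesis by (simp add: to_clifford_def)
qed

definition unit_norm :: "coord_op set" where
  "unit_norm = {x \<in> homogeneous. x * star x = 1 \<or> x * star x = - 1}"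

lemma range_lin_1: "1 \<in> range lin" "- 1 \<in> range lin"
  using lin_1 lin_uminus by (metis rangeI)+

lemma clifford_pm1_to_clifford: "clifford_pm1 form = to_clifford ` {1, - 1}"
  by (simp add: clifford_pm1_def to_clifford_one to_clifford_uminus range_lin_1)

lemma carrier_pm_group: "carrier (clifford_pm_group form) = to_clifford ` unit_norm"
proof -
  have *: "clifford_norm form (to_clifford x) \<in> clifford_pm1 form \<longleftrightarrow>
      x * star x = 1 \<or> x * star x = - 1"
    if "x \<in> homogeneous" for x
    using homogeneous_range[OF that]
    by (simp add: clifford_norm_def clifford_star_to_clifford to_clifford_mult[symmetric]
        star_closed clifford_pm1_to_clifford
        to_clifford_inject range_lin_1 lin_mult_closed)
  then show ?thesis
    unfolding clifford_pm_group_def clifford_even_to_clifford clifford_odd_to_clifford unit_norm_def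
    by (auto simp: homogeneous_def)
qed

section \<open>Functionals and isometries in terms of the Clifford algebra\<close>

text \<open>The three equations say that the Gram matrix kills the vector, so nondegeneracy
  applies.\<close>

lemma kernel_trivial:
  assumes "2 * a * x1 + t * x2 + s * x3 = 0" "t * x1 + 2 * b * x2 + r * x3 = 0"
      "s * x1 + r * x2 + 2 * c * x3 = 0"
  shows "x1 = 0 \<and> x2 = 0 \<and> x3 = 0"
proof -
  let ?x = "scale x1 e1 + scale x2 e2 + scale x3 e3"
  note co = co_eqI[OF refl, of x1 x2 x3]
  have "form ?x y = (2 * a * x1 + t * x2 + s * x3) * co1 y + (t * x1 + 2 * b * x2 + r * x3) * co2 y
      + (s * x1 + r * x2 + 2 * c * x3) * co3 y" for y
    unfolding form_coords using co by (simp add: algebra_simps)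
  then have "form ?x y = 0" for y using assms by simp
  then have "?x = 0" using nondegenerate by (simp add: nondegenerate_form_def)
  then show ?thesis using co co_eqI[of 0 0 0 0] by simp
qed

lemma disc_nonzero: "disc \<noteq> 0"
proof
  assume D: "disc = 0"
  \<comment> \<open>The columns of the adjugate Gram matrix lie in the kernel of the form.\<close>
  have "4 * b * c - r * r = 0 \<and> r * s - 2 * c * t = 0 \<and> r * t - 2 * b * s = 0"
    by (rule kernel_trivial) (use D in \<open>simp_all add: disc_def power2_eq_square algebra_simps\<close>)
  moreover have "r * s - 2 * c * t = 0 \<and> 4 * a * c - s * s = 0 \<and> s * t - 2 * a * r = 0"
    by (rule kernel_trivial) (use D in \<open>simp_all add: disc_def power2_eq_square algebra_simps\<close>)
  moreover have "r * t - 2 * b * s = 0 \<and> s * t - 2 * a * r = 0 \<and> 4 * a * b - t * t = 0"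
    by (rule kernel_trivial) (use D in \<open>simp_all add: disc_def power2_eq_square algebra_simps\<close>)
  ultimately have m: "4 * b * c = r * r" "r * s = 2 * c * t" "r * t = 2 * b * s" "4 * a * c = s * s"
    "s * t = 2 * a * r" "4 * a * b = t * t" by simp_all
  \<comment> \<open>Now that all 2 by 2 minors of the Gram matrix vanish, two entries of a row,
    exchanged with one sign, also give kernel vectors. The entries in the row of \<open>e1\<close>
    are then 0, so \<open>e1\<close> itself is in the kernel.\<close>
  have "t = 0 \<and> - 2 * a = 0 \<and> 0 = (0 :: int)"
    by (rule kernel_trivial) (use m in \<open>simp_all add: algebra_simps\<close>)
  moreover have "s = 0 \<and> 0 = (0 :: int) \<and> - 2 * a = 0"
    by (rule kernel_trivial) (use m in \<open>simp_all add: algebra_simps\<close>)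
  moreover have "0 = (0 :: int) \<and> r = 0 \<and> - 2 * b = 0"
    by (rule kernel_trivial) (use m in \<open>simp_all add: algebra_simps\<close>)
  ultimately show False
    using kernel_trivial[of 1 0 0] by simp
qed

lemma delta_range: "delta \<in> range lin"
  by (simp add: delta_def)

lemma vec_range: "vec x \<in> range lin"
  by (simp add: odd_part_range)

lemma delta_scale_inject: "of_int m * delta = of_int n * delta \<longleftrightarrow> m = n"
  by (auto simp: delta_def to_lin)

lemma vec_zero [simp]: "vec 0 = 0"
  using vec_scale[of 0 0] by simp

lemma vec_uminus: "vec (- x) = - vec x"
  using vec_scale[of "- 1" x] by simp

text \<open>The functional attached to an even element by \<open>vec_even_skew\<close>, read off
  from the coordinates.\<close>

definition skew_functional :: "coord_op \<Rightarrow> 'a \<Rightarrow> int" where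
  "skew_functional x v = (case app x unit_coords of CV x0 x1 x2 x3 y1 y2 y3 y0 \<Rightarrow> x1 * co1 v - x2 *
      co2 v + x3 * co3 v)"

lemma skew_functional_eq: "x \<in> even_part \<Longrightarrow> vec v * x - star x * vec v =
    of_int (skew_functional x v) * delta"
  by (elim even_partE) (simp add: skew_functional_def vec_def vec_even_skew)

lemma skew_functional_eqI: "x \<in> even_part \<Longrightarrow> vec v * x - star x * vec v = of_int n * delta \<Longrightarrow>
    skew_functional x v = n"
  using skew_functional_eq[of x v] delta_scale_inject by simp

lemma skew_functional_diff: "skew_functional (x - y) v = skew_functional x v - skew_functional y v"
  by (cases "app x unit_coords"; cases "app y unit_coords") (simp add: skew_functional_def
      algebra_simps)

lemma skew_functional_scale: "skew_functional (of_int n * x) v = n * skew_functional x v"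
  by (cases "app x unit_coords") (simp add: skew_functional_def algebra_simps)

text \<open>Reversal replaces \<open>x\<close> by an integer minus \<open>x\<close>; the integer is
  central and cancels, leaving a change of sign.\<close>

lemma skew_functional_star:
  assumes "x \<in> even_part"
  shows "skew_functional (star x) v = - skew_functional x v"
proof (rule skew_functional_eqI)
  show "star x \<in> even_part" using assms by (rule star_part)
  obtain n where n: "star x = of_int n - x" using even_trace[OF assms] .
  have "vec v * star x - star (star x) * vec v = - (vec v * x - star x * vec v)"
    using even_part_range[OF assms] by (simp add: star_star) (simp add: n algebra_simps scalars)
  then show "vec v * star x - star (star x) * vec v = of_int (- skew_functional x v) * delta"
    by (simp add: skew_functional_eq assms)
qed

text \<open>The element \<open>vec w * delta\<close> is negated by reversal and \<open>delta\<close>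
  is central, so the skew expression is an anticommutator of vectors times \<open>delta\<close>.
  This locates the lattice inside its dual.\<close>

lemma skew_functional_vec_delta: "skew_functional (vec w * delta) v = form w v"
proof (rule skew_functional_eqI)
  show "vec w * delta \<in> even_part" by (simp add: part_mult delta_odd)
  have "star (vec w * delta) = - (vec w * delta)"
    by (simp add: star_mult vec_range delta_range star_delta delta_commute')
  then have "vec v * (vec w * delta) - star (vec w * delta) * vec v = (vec w * vec v +
      vec v * vec w) * delta"
    by (simp add: distrib_right mult.assoc delta_commute'[OF vec_range, symmetric])
  then show "vec v * (vec w * delta) - star (vec w * delta) * vec v = of_int (form w v) * delta"
    by (simp add: vec_mult_vec)
qed

lemma functional_is_skew_functional:
  assumes "Modules.module_hom scale (*) f"
  obtains x where "x \<in> even_part" "f = skew_functional x"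
proof -
  interpret f: Modules.module_hom scale "(*)" f by (rule assms)
  \<comment> \<open>The sign of the middle coordinate compensates the one in
    \<open>skew_functional\<close>.\<close>
  have "f v = skew_functional (even_elt 0 (f e1) (- f e2) (f e3)) v" for v
    by (subst expand[of v]) (simp add: f.add f.scale skew_functional_def algebra_simps)
  then have "f = skew_functional (even_elt 0 (f e1) (- f e2) (f e3))" by (rule ext)
  then show ?thesis by (rule that[OF even_elt_in])
qed

text \<open>A form without denominators of \<open>g v = e x v (inverse of x)\<close>, the inverse
  being \<open>star x\<close> divided by \<open>n\<close>. The sign \<open>e\<close> is not yet tied
  to the parity of \<open>x\<close>; \<open>matching\<close> does that later.\<close>

definition implements :: "coord_op \<Rightarrow> int \<Rightarrow> int \<Rightarrow> ('a \<Rightarrow> 'a) \<Rightarrow> bool" where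
  "implements x n e g \<longleftrightarrow> x \<in> homogeneous \<and> x * star x = of_int n \<and> n \<noteq> 0 \<and> (e = 1 \<or> e = - 1) \<and>
     (\<forall>v. of_int n * vec (g v) = of_int e * (x * vec v * star x))"

definition det3 :: "('a \<Rightarrow> 'a) \<Rightarrow> int" where
  "det3 f = co1 (f e1) * (co2 (f e2) * co3 (f e3) - co3 (f e2) * co2 (f e3))
    - co2 (f e1) * (co1 (f e2) * co3 (f e3) - co3 (f e2) * co1 (f e3))
    + co3 (f e1) * (co1 (f e2) * co2 (f e3) - co2 (f e2) * co1 (f e3))"

lemma det3_triple:
  "vec (f e1) * vec (f e2) * vec (f e3) - vec (f e3) * vec (f e2) * vec (f e1) =
      of_int (det3 f) * delta"
  unfolding det3_def vec_def by (rule alternating_triple)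

lemma star_norm:
  assumes "x \<in> homogeneous" "x * star x = of_int n"
  shows "star x * x = of_int n"
proof -
  obtain m where "x * star x = of_int m" "star x * x = of_int m" using norm_int[OF assms(1)] .
  then show ?thesis using assms(2) by simp
qed

section \<open>Properties of an isometry implemented by a homogeneous element\<close>

context
  fixes x n e g
  assumes imp: "implements x n e g"
begin

lemma imp_facts:
  shows imp_hom: "x \<in> homogeneous" and imp_norm: "x * star x = of_int n" and imp_nz: "n \<noteq> 0"
    and imp_norm': "star x * x = of_int n" and imp_e: "e = 1 \<or> e = - 1"
    and imp_eq: "of_int n * vec (g v) = of_int e * (x * vec v * star x)"
    and imp_range: "x \<in> range lin"
  using imp star_norm homogeneous_range by (auto simp: implements_def)

lemma imp_ee: "of_int e * of_int e = (1 :: coord_op)" "e * e = 1"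
  using imp_e by auto

lemma imp_conj_mult: "(x * y * star x) * (x * z * star x) = of_int n * (x * (y * z) * star x)"
proof -
  have "(x * y * star x) * (x * z * star x) = x * y * (star x * x) * z * star x"
      by (simp add: mult.assoc)
  also have "\<dots> = of_int n * (x * (y * z) * star x)"
    unfolding imp_norm' by (simp add: scalars mult_ac)
  finally show ?thesis .
qed

lemma imp_prod:
  "of_int (n * n) * (vec (g u) * vec (g v)) = of_int n * (x * (vec u * vec v) * star x)"
proof -
  have "of_int (n * n) * (vec (g u) * vec (g v)) = (of_int n * vec (g u)) * (of_int n * vec (g v))"
    by (simp add: scalars mult_ac)
  also have "\<dots> = of_int e * of_int e * ((x * vec u * star x) * (x * vec v * star x))"
    unfolding imp_eq by (simp add: scalars mult_ac)
  finally show ?thesis by (simp add: imp_ee imp_conj_mult)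
qed

text \<open>The form is the anticommutator of vectors. Conjugation respects products by
  \<open>imp_prod\<close>, where the sign enters squared, and fixes integers.\<close>

lemma imp_isometry: "form (g u) (g v) = form u v"
proof -
  have "of_int (n * n) * of_int (form (g u) (g v)) =
      of_int n * (x * (vec u * vec v + vec v * vec u) * star x)"
    unfolding vec_mult_vec[symmetric] distrib_left imp_prod by (simp add: algebra_simps)
  also have "\<dots> = of_int (n * n) * of_int (form u v)"
    unfolding vec_mult_vec by (simp add: imp_norm scalars mult_ac)
  finally show ?thesis
    using imp_nz by (simp only: of_int_mult_cancel) simp
qed

lemma imp_linear: "Modules.module_hom scale scale g"
proof (rule module_hom.intro[OF _ _ module_hom_axioms.intro])
  show "g (u + v) = g u + g v" for u v
  proof -
    have "of_int n * vec (g (u + v)) = of_int n * vec (g u + g v)"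
      unfolding vec_add distrib_left imp_eq by (simp add: algebra_simps)
    then show ?thesis using imp_nz by (simp only: of_int_mult_cancel) simp
  qed
  show "g (scale k u) = scale k (g u)" for k u
  proof -
    have "of_int n * vec (g (scale k u)) = of_int k * (of_int n * vec (g u))"
      unfolding imp_eq vec_scale by (simp add: scalars mult_ac)
    also have "\<dots> = of_int n * vec (scale k (g u))"
      unfolding vec_scale by (simp add: scalars mult_ac)
    finally show ?thesis using imp_nz by (simp only: of_int_mult_cancel) simp
  qed
qed (rule module_axioms)+

lemma imp_triple:
  "of_int (n * n) * (of_int n * (vec (g u) * vec (g v) * vec (g w))) =
   of_int (n * n) * (of_int e * (x * (vec u * vec v * vec w) * star x))"
proof -
  have "of_int (n * n) * (of_int n * (vec (g u) * vec (g v) * vec (g w))) =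
    (of_int (n * n) * (vec (g u) * vec (g v))) * (of_int n * vec (g w))"
    by (simp add: scalars mult_ac)
  also have "\<dots> = of_int n * of_int e * ((x * (vec u * vec v) * star x) * (x * vec w * star x))"
    unfolding imp_prod imp_eq by (simp add: scalars mult_ac)
  also have "\<dots> = of_int n * of_int e * (of_int n * (x * (vec u * vec v * vec w) * star x))"
    unfolding imp_conj_mult by (simp add: mult.assoc)
  finally show ?thesis by (simp add: scalars mult_ac)
qed

text \<open>Applied to the antisymmetrised product of the basis vectors, which is
  \<open>delta\<close>, the map gives \<open>det3 g\<close> times \<open>delta\<close>. Conjugation
  fixes the central \<open>delta\<close>, and three vectors contribute the sign \<open>e\<close>
  three times, leaving one factor \<open>e\<close>.\<close>

lemma imp_det: "det3 g = e"
proof -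
  have t: "of_int n * (vec (g u) * vec (g v) * vec (g w)) =
      of_int e * (x * (vec u * vec v * vec w) * star x)" for u v w
    using imp_triple[of u v w] imp_nz by (simp only: of_int_mult_cancel) simp
  have id: "vec e1 * vec e2 * vec e3 - vec e3 * vec e2 * vec e1 = delta"
    using det3_triple[of id] by (simp add: det3_def)
  have "of_int n * (of_int (det3 g) * delta) =
      of_int e * (x * (vec e1 * vec e2 * vec e3 - vec e3 * vec e2 * vec e1) * star x)"
    by (simp only: det3_triple[symmetric] right_diff_distrib left_diff_distrib t)
  then have "of_int n * (of_int (det3 g) * delta) = of_int e * (x * delta * star x)"
    by (simp only: id)
  also have "x * delta * star x = of_int n * delta"
    by (simp add: delta_commute'[OF imp_range] mult.assoc imp_norm scalars)
  finally have "of_int n * (of_int (det3 g) * delta) = of_int n * (of_int e * delta)"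
    by (simp add: scalars mult_ac)
  then show ?thesis
    using imp_nz by (simp only: of_int_mult_cancel delta_scale_inject) simp
qed

lemma imp_inverse:
  assumes "\<And>v. g (g' v) = v"
  shows "of_int n * vec (g' v) = of_int e * (star x * vec v * x)"
proof -
  have "of_int n * (star x * vec v * x) = star x * (of_int n * vec (g (g' v))) * x"
    by (simp add: assms scalars mult_ac)
  also have "\<dots> = of_int e * ((star x * x) * vec (g' v) * (star x * x))"
    unfolding imp_eq by (simp add: scalars mult_ac)
  also have "\<dots> = of_int n * (of_int n * (of_int e * vec (g' v)))"
    unfolding imp_norm' by (simp add: scalars mult_ac)
  finally have *: "star x * vec v * x = of_int n * (of_int e * vec (g' v))"
    using imp_nz by (simp only: of_int_mult_cancel) simp
  show ?thesis
    unfolding * using imp_e by (auto simp: scalars)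
qed

text \<open>Thus \<open>z star x\<close> measures how far \<open>g\<close> is from acting trivially on the discriminant group.\<close>

lemma imp_dual_action:
  assumes inv: "\<And>v. g (g' v) = v" and y: "y \<in> even_part"
    and par: "x \<in> even_part \<longleftrightarrow> e = 1"
    and z: "x * y - twist x y * x = z * delta" and w: "z * star x = vec w"
  shows "n * (skew_functional y (g' v) - skew_functional y v) = e * form w v"
proof -
  note xr = imp_range and yr = even_part_range[OF y]
  let ?c = "x * y * star x"
  have ce: "?c \<in> even_part"
    using imp_hom y by (auto simp: homogeneous_def part_mult star_part)
  have sc: "star ?c = x * star y * star x"
    by (simp add: star_mult lin_mult_closed xr yr star_closed star_star mult.assoc)
  \<comment> \<open>Conjugation by \<open>x\<close> carries the identity that defines the functional
    of \<open>y\<close> at \<open>g' v\<close> to the one for \<open>?c\<close> at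
    \<open>v\<close>.\<close>
  have "of_int (n * n * skew_functional y (g' v)) * delta =
      x * (of_int n * (of_int (skew_functional y (g' v)) * delta)) * star x"
  proof -
    have "x * (of_int n * (of_int (skew_functional y (g' v)) * delta)) * star x =
       of_int n * (of_int (skew_functional y (g' v)) * (x * delta * star x))"
      by (simp add: scalars mult_ac)
    also have "x * delta * star x = of_int n * delta"
      by (simp add: delta_commute'[OF imp_range] mult.assoc imp_norm scalars)
    finally show ?thesis by (simp add: scalars mult_ac)
  qed
  also have "\<dots> = x * (of_int n * (vec (g' v) * y - star y * vec (g' v))) * star x"
    by (simp only: skew_functional_eq[OF y])
  also have "\<dots> = x * (of_int n * vec (g' v) * y - star y * (of_int n * vec (g' v))) * star x"
    by (simp add: right_diff_distrib scalars mult_ac)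
  also have "\<dots> = of_int e * ((x * star x) * vec v * ?c - star ?c * vec v * (x * star x))"
    unfolding imp_inverse[OF inv] sc
    by (simp add: right_diff_distrib left_diff_distrib scalars mult_ac)
  also have "\<dots> = of_int e * (of_int n * (vec v * ?c - star ?c * vec v))"
    unfolding imp_norm by (simp add: right_diff_distrib scalars mult_ac)
  also have "\<dots> = of_int (e * n * skew_functional ?c v) * delta"
    unfolding skew_functional_eq[OF ce] by (simp add: scalars mult_ac)
  finally have "n * n * skew_functional y (g' v) = e * n * skew_functional ?c v"
    by (simp only: delta_scale_inject)
  then have 1: "n * skew_functional y (g' v) = e * skew_functional ?c v"
    using imp_nz by simp
  \<comment> \<open>The witness equation times \<open>star x\<close> compares \<open>?c\<close> with
    a multiple of the twist; their functionals differ by that of \<open>vec w * delta\<close>, which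
    is \<open>form w\<close>.\<close>
  have "?c - of_int n * twist x y = z * delta * star x"
    unfolding z[symmetric] by (simp add: left_diff_distrib mult.assoc imp_norm scalars)
  also have "\<dots> = vec w * delta"
    by (simp add: w[symmetric] mult.assoc delta_commute' star_closed xr)
  finally have *: "?c - of_int n * twist x y = vec w * delta" .
  have 2: "skew_functional ?c v - n * skew_functional (twist x y) v = form w v"
    unfolding skew_functional_vec_delta[symmetric] *[symmetric]
        by (simp only: skew_functional_diff skew_functional_scale)
  \<comment> \<open>The twist reverses \<open>y\<close> exactly when \<open>e = - 1\<close>, and
    reversal negates the functional.\<close>
  have "skew_functional (twist x y) v = e * skew_functional y v"
    using par imp_e by (auto simp: twist_def skew_functional_star y)
  then have "e * skew_functional ?c v - n * skew_functional y v = e * form w v"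
    using 2 imp_e by auto
  then show ?thesis using 1 by (simp add: algebra_simps)
qed

end

lemma form_uminus_left: "form (- x) y = - form x y"
  using form_scale_left[of "- 1" x y] by simp

lemma form_diff_left: "form (x - y) z = form x z - form y z"
  using form_add_left[of x "- y" z] by (simp add: form_uminus_left)

lemma form_diff_right: "form x (y - z) = form x y - form x z"
  using form_diff_left[of y z x] by (simp add: form_sym)

lemma vec_diff: "vec (x - y) = vec x - vec y"
  using vec_add[of x "- y"] by (simp add: vec_uminus)

lemma nondegenerateD: "(\<And>y. form x y = 0) \<Longrightarrow> x = 0"
  using nondegenerate by (simp add: nondegenerate_form_def)

lemma form_left_inject: "(\<And>v. form x v = form y v) \<Longrightarrow> x = y"
  using nondegenerateD[of "x - y"] by (simp add: form_diff_left)

section \<open>Cartan--Dieudonne\<close>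

text \<open>The reflection in \<open>u\<close> multiplied by \<open>q u\<close>, so that no denominators occur.\<close>

definition refl :: "'a \<Rightarrow> 'a \<Rightarrow> 'a" where
  "refl u x = scale (q u) x - scale (form u x) u"

lemma vec_refl: "vec (refl u x) = - (vec u * vec x * vec u)"
proof -
  have "vec u * vec x * vec u = (of_int (form u x) - vec x * vec u) * vec u"
    by (simp add: vec_mult_vec[symmetric])
  also have "\<dots> = of_int (form u x) * vec u - of_int (q u) * vec x"
    by (simp add: left_diff_distrib mult.assoc vec_square mult_of_int_commute)
  finally show ?thesis by (simp add: refl_def vec_diff vec_scale)
qed

lemma refl_linear: "refl u (x + y) = refl u x + refl u y" "refl u (scale n x) = scale n (refl u x)"
  by (simp_all add: refl_def form_add_right form_scale_right scale_right_distrib scale_left_distrib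
      scale_right_diff_distrib mult_ac)

lemma form_refl: "form (refl u x) (refl u y) = q u * q u * form x y"
  by (simp add: refl_def form_diff_left form_diff_right form_scale_left form_scale_right form_self
      form_sym[of x u] form_sym[of y u] algebra_simps)

lemma refl_fix: "form u w = 0 \<Longrightarrow> refl u (scale k w) = scale (q u * k) w"
  by (simp add: refl_def form_scale_right)

lemma refl_self: "refl v (scale k v) = scale (- (q v * k)) v"
proof -
  have "q v * k - form v (scale k v) = - (q v * k)"
    by (simp add: form_scale_right form_self)
  then show ?thesis
    by (simp only: refl_def scale_scale scale_left_diff_distrib[symmetric])
qed

text \<open>Conjugation by \<open>x\<close> up to a nonzero rational factor. The factor absorbs the
  denominators of reflections; norm and sign are recovered in
  \<open>isometry_implemented\<close>.\<close>

definition representable :: "('a \<Rightarrow> 'a) \<Rightarrow> bool" where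
  "representable f \<longleftrightarrow> (\<exists>x k m. x \<in> homogeneous \<and> k \<noteq> 0 \<and> m \<noteq> 0 \<and>
     (\<forall>v. sc k (x * vec v * star x) = sc m (vec (f v))))"

text \<open>Applying \<open>refl u\<close> twice is multiplication by \<open>q u * q u\<close>, so
  composing with another reflection undoes it. By \<open>vec_refl\<close> this amounts to
  multiplying \<open>x\<close> by \<open>vec u\<close> on the left.\<close>

lemma representable_refl:
  assumes "q u \<noteq> 0" "representable (\<lambda>v. refl u (f v))"
  shows "representable f"
proof -
  obtain x k m where *: "x \<in> homogeneous" "k \<noteq> 0" "m \<noteq> 0"
    "\<And>v. sc k (x * vec v * star x) = sc m (vec (refl u (f v)))"
    using assms(2) by (auto simp: representable_def)
  have "sc k ((vec u * x) * vec v * star (vec u * x)) = sc (- m * q u * q u) (vec (f v))" for v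
  proof -
    have "sc k ((vec u * x) * vec v * star (vec u * x)) = vec u * sc k (x * vec v * star x) * vec u"
      using homogeneous_range[OF *(1)] by (simp add: star_mult vec_range scalars mult_ac)
    also have "\<dots> = sc (- m) ((vec u * vec u) * vec (f v) * (vec u * vec u))"
      unfolding *(4) vec_refl by (simp add: scalars mult_ac) (simp add: sc_def)
    also have "\<dots> = sc (- m * q u * q u) (vec (f v))"
      unfolding vec_square by (simp add: scalars mult_ac)
    finally show ?thesis .
  qed
  moreover have "vec u * x \<in> homogeneous"
    using *(1) by (intro homogeneous_mult) (simp_all add: homogeneous_def)
  moreover have "- m * q u * q u \<noteq> 0" using * assms(1) by simp
  ultimately show ?thesis
    using *(2) unfolding representable_def by blast
qed

lemma representable_scalar:
  assumes "m \<noteq> 0" "\<And>v. f v = scale m v"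
  shows "representable f"
proof -
  have "sc m (1 * vec v * star 1) = sc 1 (vec (f v))" for v
    using assms(2) by (simp add: vec_scale sc_def)
  then show ?thesis
    using assms(1) unfolding representable_def
    by (intro exI[of _ 1] exI[of _ m] exI[of _ "1::int"]) (simp add: homogeneous_def)
qed

lemma exists_anisotropic: "\<exists>v. q v \<noteq> 0"
proof (rule ccontr)
  assume "\<not> ?thesis"
  then have "form x y = 0" for x y using q_add[of x y] by simp
  then have "e1 = 0" by (rule nondegenerateD)
  then show False using co_basis(1) co_scale(1)[of 0 0] by simp
qed

text \<open>Take \<open>v0\<close> anisotropic, \<open>v1\<close> anisotropic in its orthogonal
  complement, and for \<open>v2\<close> the vector \<open>vec v0 * vec v1 * delta\<close>. Its norm
  is \<open>q v0 * q v1 * disc\<close>, which is not 0.\<close>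

lemma orthogonal_frame:
  obtains v0 v1 v2 where "q v0 \<noteq> 0" "q v1 \<noteq> 0" "q v2 \<noteq> 0" "form v0 v1 = 0" "form v0 v2 = 0"
      "form v1 v2 = 0"
    "\<And>x. form x v0 = 0 \<Longrightarrow> form x v1 = 0 \<Longrightarrow> form x v2 = 0 \<Longrightarrow> x = 0"
proof -
  obtain v0 where v0: "q v0 \<noteq> 0" using exists_anisotropic by blast
  define P where "P x = scale (2 * q v0) x - scale (form v0 x) v0" for x
  have P0: "form (P x) v0 = 0" for x
    by (simp add: P_def form_diff_left form_scale_left form_self form_sym[of x v0])
  have "\<exists>x. q (P x) \<noteq> 0"
  proof (rule ccontr)
    assume "\<not> ?thesis"
    then have qP: "q (P x) = 0" for x by simp
    have Padd: "P (x + y) = P x + P y" for x y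
      by (simp add: P_def form_add_right scale_right_distrib scale_left_distrib)
    \<comment> \<open>Polarisation makes the form vanish on the image of \<open>P\<close>. Since
      \<open>P x\<close> is orthogonal to \<open>v0\<close>, it is then orthogonal to every
      \<open>y\<close>, hence 0.\<close>
    have "form (P x) (P y) = 0" for x y
      using q_add[of "P x" "P y"] qP[of "x + y"] qP[of x] qP[of y] by (simp add: Padd)
    moreover have "form (P x) (P y) = 2 * q v0 * form (P x) y" for x y
      by (subst P_def[of y]) (simp add: form_diff_right form_scale_right P0)
    ultimately have "form (P x) y = 0" for x y using v0 by simp
    then have "P x = 0" for x by (rule nondegenerateD)
    then have eq: "scale (2 * q v0) x = scale (form v0 x) v0" for x by (simp add: P_def)
    \<comment> \<open>Both \<open>e1\<close> and \<open>e2\<close> would be rational multiples of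
      \<open>v0\<close>, which the coordinates exclude.\<close>
    have "2 * q v0 = form v0 e1 * co1 v0" "0 = form v0 e1 * co2 v0" "2 * q v0 = form v0 e2 * co2 v0"
      using arg_cong[OF eq[of e1], of co1] arg_cong[OF eq[of e1], of co2] arg_cong[OF eq[of e2],
          of co2]
      by (simp_all add: co_scale)
    then show False using v0 by auto
  qed
  then obtain v1 where v1: "q v1 \<noteq> 0" "form v1 v0 = 0" using P0 by blast
  have anti: "vec v1 * vec v0 = - (vec v0 * vec v1)"
    using vec_mult_vec[of v1 v0] v1(2) by (simp add: eq_neg_iff_add_eq_0)
  have odd: "vec v0 * vec v1 * delta \<in> odd_part"
    by (simp add: part_mult delta_odd)
  have "star (vec v0 * vec v1 * delta) = vec v0 * vec v1 * delta"
    by (simp add: star_mult lin_mult_closed vec_range delta_range star_delta anti delta_commute')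
  \<comment> \<open>up to a factor, the cross product of \<open>v0\<close> and \<open>v1\<close>\<close>
  then obtain v2 where v2: "vec v2 = vec v0 * vec v1 * delta"
    using odd odd_fixed_by_star vec_elt_is_vec by metis
  have dv: "delta * vec x = vec x * delta" "delta * (vec x * y) = vec x * (delta * y)" for x y
    by (simp_all add: delta_commute'[OF vec_range] mult.assoc[symmetric])
  have f02: "form v0 v2 = 0"
  proof -
    have "of_int (form v0 v2) = vec v0 * vec v2 + vec v2 * vec v0" by (simp add: vec_mult_vec)
    also have "\<dots> = vec v0 * (vec v0 * vec v1 + vec v1 * vec v0) * delta"
      by (simp add: v2 dv mult.assoc distrib_left distrib_right)
    finally show ?thesis by (simp add: anti)
  qed
  have f12: "form v1 v2 = 0"
  proof -
    have "of_int (form v1 v2) = vec v1 * vec v2 + vec v2 * vec v1" by (simp add: vec_mult_vec)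
    also have "\<dots> = (vec v1 * vec v0 + vec v0 * vec v1) * vec v1 * delta"
      by (simp add: v2 dv mult.assoc distrib_left distrib_right)
    finally show ?thesis by (simp add: anti)
  qed
  have q2: "q v2 = q v0 * q v1 * disc"
  proof -
    have "of_int (q v2) = vec v0 * (vec v1 * vec v0) * vec v1 * (delta * delta)"
      unfolding vec_square[symmetric] v2 by (simp add: dv mult.assoc)
    also have "\<dots> = - ((vec v0 * vec v0) * (vec v1 * vec v1) * (delta * delta))"
      by (simp add: anti mult.assoc)
    also have "\<dots> = of_int (q v0 * q v1 * disc)"
      unfolding vec_square delta_square by simp
    finally show ?thesis by (simp only: of_int_eq_iff)
  qed
  \<comment> \<open>Such an \<open>x\<close> anticommutes with \<open>v0\<close> and
    \<open>v1\<close>, hence commutes with \<open>v2\<close>, their product with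
    \<open>delta\<close>. It also anticommutes with \<open>v2\<close>, so the product with the
    anisotropic \<open>v2\<close> is 0.\<close>
  have "x = 0" if "form x v0 = 0" "form x v1 = 0" "form x v2 = 0" for x
  proof -
    have 0: "vec x * vec v0 = - (vec v0 * vec x)" and 1: "vec x * vec v1 = - (vec v1 * vec x)"
      and 2: "vec x * vec v2 = - (vec v2 * vec x)"
      using vec_mult_vec[of x v0] vec_mult_vec[of x v1] vec_mult_vec[of x v2] that
      by (simp_all add: eq_neg_iff_add_eq_0)
    have "vec x * vec v2 = (vec x * vec v0) * vec v1 * delta" by (simp add: v2 mult.assoc)
    also have "\<dots> = - (vec v0 * (vec x * vec v1) * delta)" by (simp add: 0 mult.assoc)
    also have "\<dots> = vec v2 * vec x" by (simp add: 1 v2 dv mult.assoc)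
    finally have "vec v2 * vec x = - (vec v2 * vec x)" using 2 by simp
    then have "of_int 2 * (vec v2 * vec x) = 0"
      by (simp add: mult_2 eq_neg_iff_add_eq_0)
    then have "vec v2 * vec x = 0" unfolding of_int_mult_eq_0_iff by simp
    then have "vec v2 * (vec v2 * vec x) = 0" by simp
    then have "of_int (q v2) * vec x = 0" by (simp add: mult.assoc[symmetric] vec_square)
    moreover have "q v2 \<noteq> 0" using q2 v0 v1 disc_nonzero by simp
    ultimately have "vec x = vec 0" by (simp add: of_int_mult_eq_0_iff)
    then show "x = 0" by (simp only: vec_inject)
  qed
  then show ?thesis
    using that[of v0 v1 v2] v0 v1 f02 f12 q2 disc_nonzero by (simp add: form_sym[of v0 v1])
qed

text \<open>A map that is \<open>m\<close> times a rational isometry; the class is preserved by the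
  denominator-free reflections.\<close>

definition similitude :: "int \<Rightarrow> ('a \<Rightarrow> 'a) \<Rightarrow> bool" where
  "similitude m f \<longleftrightarrow> m \<noteq> 0 \<and> (\<forall>x y. f (x + y) = f x + f y) \<and> (\<forall>n x. f (scale n x) = scale n (f x)) \<and>
     (\<forall>x y. form (f x) (f y) = m * m * form x y)"

lemma similitude_refl:
  "similitude m f \<Longrightarrow> q u \<noteq> 0 \<Longrightarrow> similitude (q u * m) (\<lambda>v. refl u (f v))"
  by (simp add: similitude_def refl_linear form_refl)

text \<open>The vectors \<open>f v\<close> and \<open>m v\<close> have the same norm, and the norms
  of their difference and sum add up to \<open>4 * m * m * q v\<close>. So one of the two is
  anisotropic, and its reflection sends \<open>f v\<close> to a multiple of \<open>v\<close>. As it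
  lies in the span of \<open>f v\<close> and \<open>v\<close>, it is orthogonal to whatever both are
  orthogonal to.\<close>

lemma similitude_align:
  assumes f: "similitude m f" and v: "q v \<noteq> 0"
  obtains u k where "q u \<noteq> 0" "refl u (f v) = scale k v" "k * k = (q u * m) * (q u * m)"
    "\<And>w. form v w = 0 \<Longrightarrow> form (f v) w = 0 \<Longrightarrow> form u w = 0"
proof -
  define F where "F = form (f v) v"
  have ff: "form (f v) (f v) = 2 * (m * m * q v)"
    using f form_self[of v] by (auto simp: similitude_def simp del: mult_cancel_left)
  have u: "2 * q (f v - scale m v) = 2 * (2 * m * m * q v - m * F)"
     "2 * q (f v + scale m v) = 2 * (2 * m * m * q v + m * F)"
    unfolding form_self[symmetric] F_def
    by (simp_all add: form_add_left form_add_right form_diff_left form_diff_right form_scale_left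
        form_scale_right form_self[of v] ff form_sym[of v "f v"] algebra_simps)
  have fu: "form (f v - scale m v) (f v) = q (f v - scale m v)"
     "form (f v + scale m v) (f v) = q (f v + scale m v)"
    using u unfolding F_def
    by (simp_all add: form_add_left form_diff_left form_scale_left ff form_sym[of v "f v"])
  have "m * m * q v \<noteq> 0" using f v by (simp add: similitude_def)
  then consider "q (f v - scale m v) \<noteq> 0" | "q (f v + scale m v) \<noteq> 0" using u by fastforce
  then show ?thesis
  proof cases
    case 1
    let ?u = "f v - scale m v"
    have "refl ?u (f v) = scale (q ?u * m) v"
      unfolding refl_def fu by (simp add: scale_right_diff_distrib)
    then show ?thesis
      by (rule that[OF 1]) (auto simp: form_diff_left form_scale_left)
  next
    case 2
    let ?u = "f v + scale m v"
    have "refl ?u (f v) = scale (- (q ?u * m)) v"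
      unfolding refl_def fu by (simp add: scale_right_distrib)
    then show ?thesis
      by (rule that[OF 2]) (auto simp: form_add_left form_scale_left)
  qed
qed

lemma similitude_orthogonal:
  assumes "similitude m f" "f w = scale k w" "k \<noteq> 0" "form v w = 0"
  shows "form (f v) w = 0"
proof -
  have "k * form (f v) w = form (f v) (f w)" using assms(2) by (simp add: form_scale_right)
  also have "\<dots> = 0" using assms(1,4) by (simp add: similitude_def)
  finally show ?thesis using assms(3) by simp
qed

text \<open>Cartan and Dieudonne along the orthogonal frame: reflections make \<open>v0\<close>,
  \<open>v1\<close>, \<open>v2\<close> eigenvectors in turn, each preserving the earlier ones, and
  reflections in \<open>v1\<close> and \<open>v2\<close> then equalise the signs of the eigenvalues.
  The auxiliary facts run backwards, from scalar maps to arbitrary similitudes.\<close>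

lemma similitude_representable:
  assumes f: "similitude m f"
  shows "representable f"
proof -
  obtain v0 v1 v2 where q: "q v0 \<noteq> 0" "q v1 \<noteq> 0" "q v2 \<noteq> 0"
    and orth: "form v0 v1 = 0" "form v0 v2 = 0" "form v1 v2 = 0"
    and complete: "\<And>x. form x v0 = 0 \<Longrightarrow> form x v1 = 0 \<Longrightarrow> form x v2 = 0 \<Longrightarrow> x = 0"
    using orthogonal_frame by metis
  have orth': "form v1 v0 = 0" "form v2 v0 = 0" "form v2 v1 = 0"
    using orth by (simp_all add: form_sym[of v1 v0] form_sym[of v2])
  have scalar: "representable f" if "similitude m f" "f v0 = scale k v0" "f v1 = scale k v1"
      "f v2 = scale k v2"
     "k * k = m * m" for f m k
  proof -
    have k: "k \<noteq> 0" using that by (auto simp: similitude_def)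
    have "f x = scale k x" for x
    proof -
      have "form (f x - scale k x) v = 0" if "f v = scale k v" for v
      proof -
        have "k * form (f x) v = form (f x) (f v)" using that by (simp add: form_scale_right)
        also have "\<dots> = k * (k * form x v)" using \<open>similitude m f\<close> \<open>k * k = m * m\<close>
          by (simp add: similitude_def mult.assoc[symmetric])
        finally show ?thesis using k by (simp add: form_diff_left form_scale_left)
      qed
      then have "f x - scale k x = 0" using complete that(2-4) by blast
      then show ?thesis by simp
    qed
    then show ?thesis using k by (rule representable_scalar[rotated])
  qed
  have diag2: "representable f" if f: "similitude m f" "f v0 = scale k v0" "f v1 = scale k v1"
      "f v2 = scale k2 v2"
     "k * k = m * m" "k2 * k2 = m * m" for f m k k2
  proof (cases "k2 = k")
    case True
    then show ?thesis using scalar that by blast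
  next
    case False
    then have "k2 = - k" using that(5,6) by (metis square_eq_iff)
    moreover have "refl v2 (scale (- k) v2) = scale (q v2 * k) v2"
      using refl_self[of v2 "- k"] by simp
    ultimately have "representable (\<lambda>v. refl v2 (f v))"
      using f q(3) orth orth'
      by (intro scalar[OF similitude_refl[OF f(1) q(3)], of
          "q v2 * k"]) (simp_all add: refl_fix mult_ac)
    then show ?thesis using q(3) by (rule representable_refl[rotated])
  qed
  have diag: "representable f" if f: "similitude m f" "f v0 = scale k0 v0" "f v1 = scale k1 v1"
      "f v2 = scale k2 v2"
     "k0 * k0 = m * m" "k1 * k1 = m * m" "k2 * k2 = m * m" for f m k0 k1 k2
  proof (cases "k1 = k0")
    case True
    then show ?thesis using diag2 that by blast
  next
    case False
    then have "k1 = - k0" using that(5,6) by (metis square_eq_iff)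
    moreover have "refl v1 (scale (- k0) v1) = scale (q v1 * k0) v1"
      using refl_self[of v1 "- k0"] by simp
    ultimately have "representable (\<lambda>v. refl v1 (f v))"
      using f q(2) orth orth'
      by (intro diag2[OF similitude_refl[OF f(1) q(2)], of "q v1 * k0"
          "q v1 * k2"]) (simp_all add: refl_fix mult_ac)
    then show ?thesis using q(2) by (rule representable_refl[rotated])
  qed
  have stage2: "representable f" if f: "similitude m f" "f v0 = scale k0 v0" "f v1 = scale k1 v1"
     "k0 * k0 = m * m" "k1 * k1 = m * m" for f m k0 k1
  proof -
    obtain u k where u: "q u \<noteq> 0" "refl u (f v2) = scale k v2" "k * k = (q u * m) * (q u * m)"
      "\<And>w. form v2 w = 0 \<Longrightarrow> form (f v2) w = 0 \<Longrightarrow> form u w = 0"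
      using similitude_align[OF f(1) q(3)] by metis
    have m: "k0 \<noteq> 0" "k1 \<noteq> 0" using f by (auto simp: similitude_def)
    have "form u v0 = 0" "form u v1 = 0"
      using u(4) similitude_orthogonal[OF f(1) f(2) m(1)] similitude_orthogonal[OF f(1) f(3) m(2)]
        orth by (simp_all add: form_sym[of v2])
    then have "representable (\<lambda>v. refl u (f v))"
      using f u
      by (intro diag[OF similitude_refl[OF f(1) u(1)], of "q u * k0"
          "q u * k1" k]) (simp_all add: refl_fix mult_ac)
    then show ?thesis using u(1) by (rule representable_refl[rotated])
  qed
  have stage1: "representable f" if f: "similitude m f" "f v0 = scale k0 v0"
     "k0 * k0 = m * m" for f m k0
  proof -
    obtain u k where u: "q u \<noteq> 0" "refl u (f v1) = scale k v1" "k * k = (q u * m) * (q u * m)"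
      "\<And>w. form v1 w = 0 \<Longrightarrow> form (f v1) w = 0 \<Longrightarrow> form u w = 0"
      using similitude_align[OF f(1) q(2)] by metis
    have m: "k0 \<noteq> 0" using f by (auto simp: similitude_def)
    have "form u v0 = 0"
      using u(4) similitude_orthogonal[OF f(1) f(2) m(1)] orth by (simp_all add: form_sym[of v1])
    then have "representable (\<lambda>v. refl u (f v))"
      using f u
      by (intro stage2[OF similitude_refl[OF f(1) u(1)], of
          "q u * k0" k]) (simp_all add: refl_fix mult_ac)
    then show ?thesis using u(1) by (rule representable_refl[rotated])
  qed
  obtain u k where u: "q u \<noteq> 0" "refl u (f v0) = scale k v0" "k * k = (q u * m) * (q u * m)"
    using similitude_align[OF f q(1)] by metis
  have "representable (\<lambda>v. refl u (f v))"
    by (rule stage1[OF similitude_refl[OF f u(1)] u(2,3)])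
  then show ?thesis using u(1) by (rule representable_refl[rotated])
qed

section \<open>Primitive representatives\<close>

text \<open>Squaring the representation at an anisotropic vector gives
  \<open>m * m = (k * n) * (k * n)\<close>, so \<open>m\<close> is \<open>k * n\<close> up to a
  sign. That sign becomes \<open>e\<close>.\<close>

lemma isometry_implemented:
  assumes "similitude 1 g"
  obtains x n e where "implements x n e g"
proof -
  obtain x k m where *: "x \<in> homogeneous" "k \<noteq> 0" "m \<noteq> 0"
    and eq: "\<And>v. sc k (x * vec v * star x) = sc m (vec (g v))"
    using similitude_representable[OF assms] by (auto simp: representable_def)
  obtain n where n: "x * star x = of_int n" "star x * x = of_int n" using norm_int[OF *(1)] .
  obtain v where v: "q v \<noteq> 0" using exists_anisotropic by blast
  have "q (g v) = q v"
    using assms form_self[of v] form_self[of "g v"] by (simp add: similitude_def)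
  have "of_int (m * m * q v) = sc m (vec (g v)) * sc m (vec (g v))"
    by (simp add: scalars mult_ac vec_square \<open>q (g v) = q v\<close>)
  also have "\<dots> = sc (k * k) (x * vec v * (star x * x) * vec v * star x)"
    unfolding eq[symmetric] by (simp add: scalars mult_ac)
  also have "\<dots> = sc (k * k * n) (x * (vec v * vec v) * star x)"
    unfolding n by (simp add: scalars mult_ac)
  also have "\<dots> = sc (k * k * n * q v) (x * star x)"
    unfolding vec_square by (simp add: scalars mult_ac)
  also have "\<dots> = of_int (k * k * n * q v * n)"
    unfolding n by (simp add: sc_def)
  finally have "m * m * q v = k * k * n * q v * n" by (simp only: of_int_eq_iff)
  then have "m * m = (k * n) * (k * n)" using v by (simp add: algebra_simps)
  then have mk: "m = k * n \<or> m = - (k * n)" using square_eq_iff by blast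
  define e :: int where "e = (if m = k * n then 1 else - 1)"
  have e: "m = k * (e * n)" "e = 1 \<or> e = - 1" using mk by (auto simp: e_def)
  have "of_int n * vec (g v) = of_int e * (x * vec v * star x)" for v
  proof -
    have "sc k (x * vec v * star x) = sc k (sc (e * n) (vec (g v)))"
      unfolding eq by (simp add: scalars e(1) mult_ac)
    then have "x * vec v * star x = sc (e * n) (vec (g v))" using sc_inject[OF *(2)] by blast
    then show ?thesis using e(2) by (auto simp: sc_def)
  qed
  moreover have "n \<noteq> 0" using e(1) *(3) by auto
  ultimately show ?thesis
    using *(1) n(1) e(2) that unfolding implements_def by blast
qed

lemma star_sc: "star (sc n x) = sc n (star x)"
  by (simp add: sc_def star_scale)

lemma norm_delta: "delta * star delta = of_int disc"
  by (simp add: star_delta delta_square)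

definition matching :: "coord_op \<Rightarrow> int \<Rightarrow> bool" where
  "matching x e \<longleftrightarrow> (x \<in> even_part \<longleftrightarrow> e = 1)"

lemma implements_nonzero: "implements x n e g \<Longrightarrow> x \<noteq> 0"
  by (auto simp: implements_def)

lemma isometry_implemented_matching:
  assumes "similitude 1 g"
  obtains x n e where "implements x n e g" "matching x e"
proof -
  obtain x n e where *: "implements x n e g" using isometry_implemented[OF assms] .
  show ?thesis
  proof (cases "matching x e")
    case True
    then show ?thesis using * that by blast
  next
    case False
    note hom = imp_hom[OF *] and xr = imp_range[OF *]
    let ?x = "x * delta"
    have hom': "?x \<in> homogeneous"
      using hom delta_odd by (auto simp: homogeneous_def part_mult)
    have st: "star ?x = star delta * star x" by (simp add: star_mult xr delta_range)
    \<comment> \<open>The odd central \<open>delta\<close> flips the parity of \<open>x\<close> and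
      only multiplies conjugation by \<open>delta * star delta = disc\<close>, so \<open>g\<close>
      and \<open>e\<close> stay the same.\<close>
    have conj: "?x * y * star ?x = sc disc (x * y * star x)" if "y \<in> range lin" for y
    proof -
      have "?x * y * star ?x = x * (delta * y) * star delta * star x" by (simp add: st mult.assoc)
      also have "\<dots> = x * y * (delta * star delta) * star x"
        by (simp add: delta_commute'[OF that, symmetric] mult.assoc)
      also have "\<dots> = sc disc (x * y * star x)" unfolding norm_delta by (simp add: scalars mult_ac)
      finally show ?thesis .
    qed
    have nrm: "?x * star ?x = of_int (disc * n)"
      using conj[OF range_lin_1(1)] imp_norm[OF *] by (simp add: scalars)
    have "of_int (disc * n) * vec (g v) = of_int e * (?x * vec v * star ?x)" for v
    proof -
      have "of_int (disc * n) * vec (g v) = sc disc (of_int n * vec (g v))" by (simp add: scalars)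
      also have "\<dots> = of_int e * (?x * vec v * star ?x)"
        unfolding imp_eq[OF *] conj[OF vec_range] by (simp add: scalars mult_ac)
      finally show ?thesis .
    qed
    then have imp': "implements ?x (disc * n) e g"
      using hom' nrm imp_nz[OF *] imp_e[OF *] disc_nonzero unfolding implements_def by auto
    have "?x \<in> even_part \<longleftrightarrow> x \<notin> even_part"
      using hom delta_odd part_mult part_disjoint implements_nonzero[OF imp']
      by (metis UnE homogeneous_def)
    then have "matching ?x e" using False by (auto simp: matching_def)
    then show ?thesis using imp' that by blast
  qed
qed

lemma implements_divide:
  assumes "implements (of_int p * x) n e g" "matching (of_int p * x) e" "x \<in> homogeneous"
  obtains m where "implements x m e g" "matching x e"
proof -
  have p: "p \<noteq> 0" using implements_nonzero[OF assms(1)] by auto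
  obtain m where m: "x * star x = of_int m" using norm_int[OF assms(3)] .
  have nm: "n = p * p * m"
  proof -
    have "(of_int n :: coord_op) = of_int (p * p * m)"
      using imp_norm[OF assms(1)] by (simp add: scalars star_sc mult_ac m)
    then show ?thesis by (simp only: of_int_eq_iff)
  qed
  have "of_int m * vec (g v) = of_int e * (x * vec v * star x)" for v
  proof -
    have "sc (p * p) (of_int m * vec (g v)) = of_int n * vec (g v)" by (simp add: nm scalars)
    also have "\<dots> = sc (p * p) (of_int e * (x * vec v * star x))"
      unfolding imp_eq[OF assms(1)] by (simp add: scalars star_sc mult_ac)
    finally show ?thesis using sc_inject[of "p * p"] p by simp
  qed
  then have imp: "implements x m e g"
    using m nm assms(3) imp_nz[OF assms(1)] imp_e[OF assms(1)] unfolding implements_def by auto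
  have "x \<in> even_part \<longleftrightarrow> of_int p * x \<in> even_part"
    using assms(3) part_scale implements_nonzero[OF assms(1)] part_disjoint
    by (metis UnE homogeneous_def)
  then have "matching x e" using assms(2) by (simp add: matching_def)
  with imp show ?thesis by (rule that)
qed

text \<open>Take \<open>x\<close> with the smallest coordinates. If \<open>x\<close> were a prime
  times \<open>y\<close>, then \<open>y\<close> would implement \<open>g\<close> as well by
  \<open>implements_divide\<close>, with smaller coordinates.\<close>

lemma isometry_implemented_primitive:
  assumes "similitude 1 g"
  obtains x n e where "implements x n e g" "matching x e"
    "\<And>p y. prime p \<Longrightarrow> y \<in> homogeneous \<Longrightarrow> x \<noteq> of_int p * y"
proof -
  let ?P = "\<lambda>x. \<exists>n e. implements x n e g \<and> matching x e"
  have "\<exists>x. ?P x" using isometry_implemented_matching[OF assms] by metis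
  then obtain x where x: "?P x" and min: "\<And>y. ?P y \<Longrightarrow>
      csize (app x unit_coords) \<le> csize (app y unit_coords)"
    using ex_has_least_nat[of ?P _ "\<lambda>x. csize (app x unit_coords)"] by metis
  obtain n e where *: "implements x n e g" "matching x e" using x by blast
  have "x \<noteq> of_int p * y" if p: "prime p" and y: "y \<in> homogeneous" for p y
  proof
    assume eq: "x = of_int p * y"
    have "?P y" using implements_divide[of p y n e g] * y eq by metis
    then have "csize (app x unit_coords) \<le> csize (app y unit_coords)" by (rule min)
    then have "nat \<bar>p\<bar> * csize (app y unit_coords) \<le> csize (app y unit_coords)"
        by (simp add: eq csize_cscale)
    moreover have "nat \<bar>p\<bar> \<ge> 2" using prime_ge_2_int[OF p] by simp
    moreover have "csize (app y unit_coords) \<noteq> 0"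
    proof
      assume "csize (app y unit_coords) = 0"
      then have "app y unit_coords = 0" by (simp add: csize_0)
      moreover obtain w where "y = lin w" using homogeneous_range[OF y] by blast
      ultimately have "y = 0" by (simp add: lin_zero)
      then show False using implements_nonzero[OF *(1)] eq by simp
    qed
    ultimately have "2 * csize (app y unit_coords) \<le> csize (app y unit_coords)"
      using mult_le_mono1 order_trans by metis
    then show False using \<open>csize (app y unit_coords) \<noteq> 0\<close> by simp
  qed
  then show ?thesis using * that by blast
qed

lemma skew_functional_linear: "Modules.module_hom scale (*) (skew_functional x)"
proof (rule module_hom.intro[OF module_axioms _ module_hom_axioms.intro])
  show "Modules.module ((*) :: int \<Rightarrow> int \<Rightarrow> int)"
    by standard (auto simp: algebra_simps)
  show "skew_functional x (u + v) = skew_functional x u + skew_functional x v"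
      "skew_functional x (scale k u) = k * skew_functional x u" for u v k
    by (cases "app x unit_coords"; simp add: skew_functional_def co_add co_scale algebra_simps)+
qed

text \<open>Trivial action on the discriminant group makes every \<open>z * star x\<close> divisible
  by \<open>n\<close> in the lattice. Then \<open>n\<close> divides all \<open>z * star z'\<close>,
  and a prime factor of \<open>n\<close> would divide all coordinates of \<open>x\<close>.\<close>

lemma primitive_unit_norm:
  assumes imp: "implements x n e g" and mat: "matching x e"
    and prim: "\<And>p y. prime p \<Longrightarrow> y \<in> homogeneous \<Longrightarrow> x \<noteq> of_int p * y"
    and inv: "\<And>v. g (g' v) = v"
    and disc: "\<And>f. Modules.module_hom scale (*) f \<Longrightarrow> \<exists>w. \<forall>v. f (g' v) - f v = form w v"
  shows "n = 1 \<or> n = - 1"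
proof (rule ccontr)
  assume "\<not> ?thesis"
  then have "\<not> is_unit n" by auto
  then obtain p where p: "prime p" "p dvd n"
    using prime_divisor_exists imp_nz[OF imp] by metis
  note xr = imp_range[OF imp]
  have key: "\<exists>u. z * star x = sc (e * n) (vec u)"
    if y: "y \<in> even_part" and z: "x * y - twist x y * x = z * delta"
      "x \<in> even_part \<Longrightarrow> z \<in> odd_part" "x \<notin> even_part \<Longrightarrow> z \<in> even_part" for y z
  proof -
    obtain w where w: "z * star x = vec w"
      using twist_witness_in_lattice[OF disc_nonzero imp_hom[OF imp] y z] vec_elt_is_vec by metis
    obtain u where u: "\<And>v. skew_functional y (g' v) - skew_functional y v = form u v"
        using disc[OF skew_functional_linear] by blast
    \<comment> \<open>Both sides compute the change of the functional of \<open>y\<close>;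
      nondegeneracy then identifies \<open>w\<close> with \<open>e * n\<close> times
      \<open>u\<close>.\<close>
    have "n * form u v = e * form w v" for v
      using imp_dual_action[OF imp inv y _ z(1) w, of v] mat by (simp add: u matching_def)
    then have "form (scale (e * n) u) v = form w v" for v
      using imp_e[OF imp] by (auto simp: form_scale_left)
    then have "scale (e * n) u = w" by (rule form_left_inject)
    then show ?thesis using w by (auto simp: vec_scale sc_def)
  qed
  have prods: "\<exists>w\<in>even_part. z * star z' = of_int n * w"
    if y: "y \<in> even_part" and z: "x * y - twist x y * x = z * delta"
      "x \<in> even_part \<Longrightarrow> z \<in> odd_part" "x \<notin> even_part \<Longrightarrow> z \<in> even_part"
    and y': "y' \<in> even_part" and z': "x * y' - twist x y' * x = z' * delta"
      "x \<in> even_part \<Longrightarrow> z' \<in> odd_part" "x \<notin> even_part \<Longrightarrow> z' \<in> even_part" for y z y' z'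
  proof -
    obtain u u' where u: "z * star x = sc (e * n) (vec u)" "z' * star x = sc (e * n) (vec u')"
      using key[OF y z] key[OF y' z'] by blast
    have zr: "z' \<in> range lin" using z' even_part_range odd_part_range by blast
    have "star (z' * star x) = x * star z'"
      by (simp add: star_mult zr xr star_closed star_star)
    then have u': "x * star z' = sc (e * n) (vec u')"
        by (simp add: u(2) sc_def star_scale del: of_int_mult)
    \<comment> \<open>Inserting \<open>star x * x = n\<close> between \<open>z\<close> and
      \<open>star z'\<close> expresses the product by two lattice vectors divisible by
      \<open>n\<close>; one of the two factors \<open>n\<close> cancels.\<close>
    have "sc n (z * star z') = z * (star x * x) * star z'"
      unfolding imp_norm'[OF imp] by (simp add: scalars)
    also have "\<dots> = (z * star x) * (x * star z')" by (simp add: mult.assoc)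
    also have "\<dots> = sc n (sc n (vec u * vec u'))"
      unfolding u(1) u' using imp_e[OF imp] by (auto simp: scalars)
    finally have "z * star z' = of_int n * (vec u * vec u')"
      using sc_inject[OF imp_nz[OF imp]] by (simp add: sc_def)
    moreover have "vec u * vec u' \<in> even_part" by (simp add: part_mult)
    ultimately show ?thesis by blast
  qed
  show False
  proof (cases "x \<in> even_part")
    case True
    then obtain x0 x1 x2 x3 where x: "x = even_elt x0 x1 x2 x3" by (rule even_partE)
    have "p dvd x0 \<and> p dvd x1 \<and> p dvd x2 \<and> p dvd x3"
    proof (rule even_prime_dvd_coords[OF p])
      show "even_elt x0 x1 x2 x3 * star (even_elt x0 x1 x2 x3) = of_int n"
        using imp_norm[OF imp] by (simp add: x)
    next
      fix y y' z z'
      assume "y \<in> even_part" "y' \<in> even_part" "z \<in> odd_part" "z' \<in> odd_part"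
        "even_elt x0 x1 x2 x3 * y - y * even_elt x0 x1 x2 x3 = z * delta"
        "even_elt x0 x1 x2 x3 * y' - y' * even_elt x0 x1 x2 x3 = z' * delta"
      then show "\<exists>w\<in>even_part. z * star z' = of_int n * w"
        using prods[of y z y' z'] True by (simp add: twist_def x[symmetric])
    qed
    then obtain y0 y1 y2 y3 where "x0 = p * y0" "x1 = p * y1" "x2 = p * y2" "x3 = p * y3"
      unfolding dvd_def by blast
    then have "x = of_int p * even_elt y0 y1 y2 y3" by (simp add: x to_lin)
    moreover have "even_elt y0 y1 y2 y3 \<in> homogeneous" by (simp add: homogeneous_def)
    ultimately show False using prim[OF p(1)] by blast
  next
    case False
    then have "x \<in> odd_part" using imp_hom[OF imp] by (simp add: homogeneous_def)
    then obtain y1 y2 y3 y0 where x: "x = odd_elt y1 y2 y3 y0" by (rule odd_partE)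
    have "p dvd y1 \<and> p dvd y2 \<and> p dvd y3 \<and> p dvd y0"
    proof (rule odd_prime_dvd_coords[OF p imp_nz[OF imp]])
      show "odd_elt y1 y2 y3 y0 * star (odd_elt y1 y2 y3 y0) = of_int n"
        using imp_norm[OF imp] by (simp add: x)
    next
      fix y y' z z'
      assume "y \<in> even_part" "y' \<in> even_part" "z \<in> even_part" "z' \<in> even_part"
        "odd_elt y1 y2 y3 y0 * y - star y * odd_elt y1 y2 y3 y0 = z * delta"
        "odd_elt y1 y2 y3 y0 * y' - star y' * odd_elt y1 y2 y3 y0 = z' * delta"
      then show "\<exists>w\<in>even_part. z * star z' = of_int n * w"
        using prods[of y z y' z'] False by (simp add: twist_def x[symmetric])
    qed
    then obtain z1 z2 z3 z0 where "y1 = p * z1" "y2 = p * z2" "y3 = p * z3" "y0 = p * z0"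
      unfolding dvd_def by blast
    then have "x = of_int p * odd_elt z1 z2 z3 z0" by (simp add: x to_lin)
    moreover have "odd_elt z1 z2 z3 z0 \<in> homogeneous" by (simp add: homogeneous_def)
    ultimately show False using prim[OF p(1)] by blast
  qed
qed

section \<open>The isomorphism\<close>

text \<open>The matrices of the two base changes are mutually inverse, so the traces of their products are
  equal.\<close>

lemma basis_length:
  assumes bs: "ordered_basis scale bs"
  shows "length bs = 3"
proof -
  have ind: "independent (set bs)" and span: "span (set bs) = UNIV" and dist: "distinct bs"
    using bs by (auto simp: ordered_basis_def)
  let ?r = "representation (set bs)"
  have e: "(\<Sum>v\<in>set bs. scale (?r x v) v) = x" for x
    by (rule sum_representation_eq) (simp_all add: ind span)
  have diag: "1 = co1 v * ?r e1 v + co2 v * ?r e2 v + co3 v * ?r e3 v" if "v \<in> set bs" for v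
  proof -
    have "1 = ?r v v" using representation_basis[OF ind that] by simp
    also have "\<dots> = ?r (scale (co1 v) e1 + scale (co2 v) e2 + scale (co3 v) e3) v"
      by (simp add: expand[symmetric])
    also have "\<dots> = co1 v * ?r e1 v + co2 v * ?r e2 v + co3 v * ?r e3 v"
      by (simp add: representation_add[OF ind] representation_scale[OF ind] span)
    finally show ?thesis .
  qed
  have co_sum: "co1 (sum f A) = (\<Sum>i\<in>A. co1 (f i))" "co2 (sum f A) = (\<Sum>i\<in>A. co2 (f i))"
    "co3 (sum f A) = (\<Sum>i\<in>A. co3 (f i))" for f :: "'a \<Rightarrow> 'a" and A
    using co_scale[of 0 0]
    by (induction A rule: infinite_finite_induct) (auto simp: co_add)
  have "int (length bs) = (\<Sum>v\<in>set bs. 1)" using dist by (simp add: distinct_card)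
  also have "\<dots> = (\<Sum>v\<in>set bs. co1 v * ?r e1 v + co2 v * ?r e2 v + co3 v * ?r e3 v)"
    by (rule sum.cong) (use diag in auto)
  also have "\<dots> = co1 (\<Sum>v\<in>set bs. scale (?r e1 v) v) + co2 (\<Sum>v\<in>set bs. scale (?r e2 v) v)
      + co3 (\<Sum>v\<in>set bs. scale (?r e3 v) v)"
    by (simp add: co_sum co_scale sum.distrib mult.commute)
  also have "\<dots> = 3" by (simp add: e)
  finally show ?thesis by simp
qed

lemma det_endo_matrix: "det (endo_matrix scale [e1, e2, e3] f) = det3 f"
proof -
  let ?A = "endo_matrix scale [e1, e2, e3] f"
  have "?A \<in> carrier_mat 3 3" by (simp add: endo_matrix_def numeral_3_eq_3)
  from det_3[OF this] show ?thesis
    by (simp add: endo_matrix_def co1_def[symmetric] co2_def[symmetric] co3_def[symmetric] det3_def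
        numeral_2_eq_2 algebra_simps)
qed

text \<open>Acting trivially means fixing each coset of the lattice in its dual. For the coset of
  \<open>f\<close> this says that \<open>f\<close> composed with the inverse of \<open>g\<close>
  differs from \<open>f\<close> by some \<open>form w\<close>.\<close>

lemma disc_kernel_iff:
  "g \<in> carrier (disc_kernel scale form) \<longleftrightarrow>
     bij g \<and> Modules.module_hom scale scale g \<and> (\<forall>x y. form (g x) (g y) = form x y) \<and>
     (\<forall>f. Modules.module_hom scale (*) f \<longrightarrow> (\<exists>w. \<forall>v. f (inv_into UNIV g v) - f v = form w v))"
proof -
  let ?O = "bij g \<and> Modules.module_hom scale scale g \<and> (\<forall>x y. form (g x) (g y) = form x y)"
  let ?cos = "\<lambda>f :: 'a \<Rightarrow> int. {\<lambda>v. form u v + f v | u. True}"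
  have cos: "range form #>\<^bsub>dual_lattice scale\<^esub> f = ?cos f" for f
    by (auto simp: r_coset_def dual_lattice_def)
  have car: "carrier (disc_group scale form) = {?cos f | f. Modules.module_hom scale (*) f}"
    by (auto simp: disc_group_def FactGroup_def RCOSETS_def cos) (auto simp: dual_lattice_def)
  have ball_image: "(\<forall>X\<in>{F f | f. M f}. P X) \<longleftrightarrow> (\<forall>f. M f \<longrightarrow> P (F f))"
    for F :: "('a \<Rightarrow> int) \<Rightarrow> ('a \<Rightarrow> int) set" and M P by auto
  have "g \<in> carrier (disc_kernel scale form) \<longleftrightarrow> ?O \<and>
    (\<forall>X \<in> carrier (disc_group scale form). (\<lambda>f. f \<circ> inv_into UNIV g) ` X = X)"
    by (simp add: disc_kernel_def kernel_def orthogonal_group_def disc_orthogonal_group_def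
        AutoGroup_def BijGroup_def disc_action_def restrict_def fun_eq_iff Ball_def)
  also have "\<dots> \<longleftrightarrow> ?O \<and> (\<forall>f. Modules.module_hom scale (*) f \<longrightarrow> (\<lambda>f. f \<circ> inv_into UNIV g) ` ?cos f =
      ?cos f)"
    unfolding car by (simp only: ball_image)
  also have "\<dots> \<longleftrightarrow> ?O \<and> (\<forall>f. Modules.module_hom scale (*) f \<longrightarrow> (\<exists>w. \<forall>v. f (inv_into UNIV g v) - f v =
      form w v))"
  proof (rule conj_cong[OF refl], rule all_cong)
    fix f :: "'a \<Rightarrow> int"
    assume O: ?O
    then have inv: "g (inv_into UNIV g v) = v" "inv_into UNIV g (g v) = v" for v
      by (auto simp: bij_is_surj surj_f_inv_f bij_is_inj)
    have fi: "form u (inv_into UNIV g v) = form (g u) v" for u v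
    proof -
      have "form (g u) (g (inv_into UNIV g v)) = form u (inv_into UNIV g v)" using O by blast
      then show ?thesis by (simp add: inv)
    qed
    show "(\<lambda>f. f \<circ> inv_into UNIV g) ` ?cos f = ?cos f \<longleftrightarrow>
        (\<exists>w. \<forall>v. f (inv_into UNIV g v) - f v = form w v)"
    proof
      assume eq: "(\<lambda>f. f \<circ> inv_into UNIV g) ` ?cos f = ?cos f"
      have "f \<in> ?cos f"
        using form_scale_left[of 0 0] by (intro CollectI exI[of _ 0]) simp
      then have "f \<circ> inv_into UNIV g \<in> ?cos f" using eq by blast
      then obtain u where "f \<circ> inv_into UNIV g = (\<lambda>v. form u v + f v)" by blast
      then show "\<exists>w. \<forall>v. f (inv_into UNIV g v) - f v = form w v" by (auto simp: fun_eq_iff)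
    next
      assume "\<exists>w. \<forall>v. f (inv_into UNIV g v) - f v = form w v"
      then obtain w where "\<And>v. f (inv_into UNIV g v) - f v = form w v" by blast
      then have w: "f (inv_into UNIV g v) = form w v + f v" for v by (simp add: algebra_simps)
      \<comment> \<open>On the coset of \<open>f\<close> the action is \<open>u\<close> to
        \<open>g u + w\<close>, which is onto because \<open>g\<close> is.\<close>
      have shift: "(\<lambda>v. form u v + f v) \<circ> inv_into UNIV g = (\<lambda>v. form (g u + w) v + f v)" for u
        by (simp add: fun_eq_iff fi w form_add_left)
      show "(\<lambda>f. f \<circ> inv_into UNIV g) ` ?cos f = ?cos f"
      proof
        show "(\<lambda>f. f \<circ> inv_into UNIV g) ` ?cos f \<subseteq> ?cos f"
        proof (rule image_subsetI)
          fix h assume "h \<in> ?cos f"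
          then obtain u where "h = (\<lambda>v. form u v + f v)" by blast
          then have "h \<circ> inv_into UNIV g = (\<lambda>v. form (g u + w) v + f v)" by (simp only: shift)
          then show "h \<circ> inv_into UNIV g \<in> ?cos f" by blast
        qed
        show "?cos f \<subseteq> (\<lambda>f. f \<circ> inv_into UNIV g) ` ?cos f"
        proof
          fix h assume "h \<in> ?cos f"
          then obtain u where "h = (\<lambda>v. form u v + f v)" by blast
          then have "h = (\<lambda>v. form (inv_into UNIV g (u - w)) v + f v) \<circ> inv_into UNIV g"
            unfolding shift by (simp add: inv)
          then show "h \<in> (\<lambda>f. f \<circ> inv_into UNIV g) ` ?cos f"
            by (rule image_eqI[where x = "\<lambda>v. form (inv_into UNIV g (u - w)) v + f v"]) blast
        qed
      qed
    qed
  qed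
  finally show ?thesis by (simp only: conj_assoc)
qed

section \<open>The map \<open>clifford_isometry\<close> on elements of unit norm\<close>

definition parity :: "coord_op \<Rightarrow> int" where
  "parity x = (if x \<in> even_part then 1 else - 1)"

lemma conj_vec:
  assumes "x \<in> homogeneous"
  shows "\<exists>w. x * vec v * star x = vec w"
proof -
  have r: "x \<in> range lin" using assms by (rule homogeneous_range)
  have "x * vec v * star x \<in> odd_part"
    using assms by (auto simp: homogeneous_def part_mult star_part)
  moreover have "star (x * vec v * star x) = x * vec v * star x"
    by (simp add: star_mult star_star star_closed lin_mult_closed r vec_range mult.assoc)
  ultimately show ?thesis
    using odd_fixed_by_star vec_elt_is_vec by metis
qed

lemma unit_normE:
  assumes "x \<in> unit_norm"
  obtains n :: int where "x \<in> homogeneous" "x \<in> range lin" "n = 1 \<or> n = - 1"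
      "x * star x = of_int n" "star x * x = of_int n"
proof -
  have h: "x \<in> homogeneous" using assms by (simp add: unit_norm_def)
  obtain n where n: "x * star x = of_int n" "star x * x = of_int n" using norm_int[OF h] .
  have "(of_int n :: coord_op) = of_int 1 \<or> (of_int n :: coord_op) = of_int (- 1)"
    using assms n(1) by (auto simp: unit_norm_def)
  then have "n = 1 \<or> n = - 1" unfolding of_int_eq_iff .
  then show ?thesis using that h n homogeneous_range[OF h] by blast
qed

lemma unit_norm_nonzero: "x \<in> unit_norm \<Longrightarrow> x \<noteq> 0"
  by (auto simp: unit_norm_def)

lemma clifford_sign_to_clifford:
  assumes "x \<in> unit_norm"
  shows "clifford_sign form (to_clifford x) = parity x"
proof -
  have "to_clifford x \<in> to_clifford ` even_part \<longleftrightarrow> x \<in> even_part"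
    using assms by (auto elim!: unit_normE simp: to_clifford_inject even_part_range)
  then show ?thesis by (simp add: clifford_sign_def parity_def clifford_even_to_clifford)
qed

lemma unit_inverse:
  assumes "x \<in> unit_norm" "x * star x = of_int n"
  shows "to_clifford x \<in> Units (clifford form)" "inv\<^bsub>clifford form\<^esub> to_clifford x =
      to_clifford (sc n (star x))"
proof -
  interpret ring "clifford form" by (rule ring_clifford)
  obtain m where m: "x \<in> range lin" "m = 1 \<or> m = - 1" "x * star x = of_int m"
      "star x * x = of_int m"
    using unit_normE[OF assms(1)] by metis
  have nm: "n = m" using assms(2) m(3) by simp
  have yr: "sc n (star x) \<in> range lin"
    using star_closed[OF m(1)] by (auto simp: sc_def lin_cscale[symmetric])
  have "x * sc n (star x) = 1" "sc n (star x) * x = 1"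
    using m(2-4) nm by (auto simp: scalars)
  then have 1: "to_clifford x \<otimes>\<^bsub>clifford form\<^esub> to_clifford (sc n (star x)) = \<one>\<^bsub>clifford form\<^esub>"
    and 2: "to_clifford (sc n (star x)) \<otimes>\<^bsub>clifford form\<^esub> to_clifford x = \<one>\<^bsub>clifford form\<^esub>"
    by (simp_all add: to_clifford_mult[symmetric] m(1) yr to_clifford_one)
  show "to_clifford x \<in> Units (clifford form)"
    using 1 2 to_clifford_closed m(1) yr unfolding Units_def by blast
  show "inv\<^bsub>clifford form\<^esub> to_clifford x = to_clifford (sc n (star x))"
    by (rule inv_char) (use 1 2 to_clifford_closed m(1) yr in auto)
qed

lemma clifford_conj_to_clifford:
  assumes "x \<in> unit_norm" "x * star x = of_int n"
  shows "clifford_conj form (to_clifford x) v = to_clifford (sc n (x * vec v * star x))"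
proof -
  have r: "x \<in> range lin" using unit_normE[OF assms(1)] by metis
  have yr: "sc n (star x) \<in> range lin"
    using star_closed[OF r] by (auto simp: sc_def lin_cscale[symmetric])
  have "clifford_conj form (to_clifford x) v = to_clifford (x * vec v * sc n (star x))"
    unfolding clifford_conj_def clifford_vec_to_clifford unit_inverse(2)[OF assms]
    by (simp add: to_clifford_mult r yr vec_range lin_mult_closed)
  then show ?thesis by (simp add: scalars)
qed

text \<open>The description by \<open>THE\<close> is resolved here once: the vector exists by
  \<open>conj_vec\<close> and is unique because \<open>vec\<close> and \<open>to_clifford\<close>
  are injective. As \<open>n\<close> is 1 or -1, it is its own inverse.\<close>

lemma clifford_isometry_implemented:
  assumes "x \<in> unit_norm" "x * star x = of_int n"
  shows "implements x n (parity x) (clifford_isometry form (to_clifford x))"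
proof -
  obtain m where m: "x \<in> homogeneous" "m = 1 \<or> m = - 1" "x * star x = of_int m"
    using unit_normE[OF assms(1)] by metis
  then have n: "n = 1 \<or> n = - 1" using assms(2) by simp
  have "of_int n * vec (clifford_isometry form (to_clifford x) v) =
      of_int (parity x) * (x * vec v * star x)" for v
  proof -
    obtain w where w: "x * vec v * star x = vec w" using conj_vec[OF m(1)] by blast
    let ?u = "scale (parity x * n) w"
    have u: "vec ?u = sc (parity x * n) (x * vec v * star x)"
      by (simp add: vec_scale w sc_def)
    have "[(parity x)] \<cdot>\<^bsub>clifford form\<^esub> clifford_conj form (to_clifford x) v = to_clifford (vec ?u)"
    proof -
      have "sc n (vec w) \<in> range lin" by (simp add: sc_def vec_scale[symmetric] vec_range)
      then show ?thesis
        unfolding clifford_conj_to_clifford[OF assms] w vec_scale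
        using to_clifford_sign[of "sc n (vec w)"] by (auto simp: parity_def sc_def)
    qed
    then have "clifford_isometry form (to_clifford x) v = (THE w. to_clifford (vec w) =
        to_clifford (vec ?u))"
      by (simp add: clifford_isometry_def clifford_vec_to_clifford clifford_sign_to_clifford[OF
          assms(1)])
    also have "\<dots> = ?u" by (simp add: to_clifford_inject vec_range)
    finally have "vec (clifford_isometry form (to_clifford x) v) =
        sc (parity x * n) (x * vec v * star x)"
      using u by simp
    then show ?thesis using n by (auto simp: sc_def)
  qed
  then show ?thesis
    using m(1) assms(2) n unfolding implements_def by (auto simp: parity_def)
qed

lemma implements_unique:
  assumes "implements x n e g" "implements x m e g'"
  shows "g = g'"
proof
  fix v
  have "(of_int n :: coord_op) = of_int m" using imp_norm[OF assms(1)] imp_norm[OF assms(2)] by simp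
  then have "n = m" by simp
  then have "of_int n * vec (g v) = of_int n * vec (g' v)"
    using imp_eq[OF assms(1)] imp_eq[OF assms(2)] by simp
  then show "g v = g' v" using imp_nz[OF assms(1)] by (simp add: of_int_mult_cancel)
qed

lemma implements_compose:
  assumes x: "implements x n e g" and y: "implements y m f h"
  shows "implements (x * y) (n * m) (e * f) (g \<circ> h)"
proof -
  have st: "star (x * y) = star y * star x"
    by (simp add: star_mult imp_range[OF x] imp_range[OF y])
  have "x * y * star (x * y) = x * (y * star y) * star x" by (simp add: st mult.assoc)
  also have "\<dots> = of_int (n * m)"
    unfolding imp_norm[OF y] using imp_norm[OF x] by (simp add: scalars mult_ac)
  finally have nrm: "x * y * star (x * y) = of_int (n * m)" .
  have "of_int (n * m) * vec ((g \<circ> h) v) = of_int (e * f) * (x * y * vec v * star (x * y))" for v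
  proof -
    have "of_int (n * m) * vec ((g \<circ> h) v) = sc m (of_int n * vec (g (h v)))"
        by (simp add: scalars mult_ac)
    also have "\<dots> = sc e (x * (of_int m * vec (h v)) * star x)"
      unfolding imp_eq[OF x] by (simp add: scalars mult_ac)
    also have "\<dots> = of_int (e * f) * (x * y * vec v * star (x * y))"
      unfolding imp_eq[OF y] st by (simp add: scalars mult_ac)
    finally show ?thesis .
  qed
  then show ?thesis
    using nrm homogeneous_mult[OF imp_hom[OF x] imp_hom[OF y]] imp_nz[OF x] imp_nz[OF y]
      imp_e[OF x] imp_e[OF y] unfolding implements_def by auto
qed

text \<open>The product has to be nonzero because 0 is both even and odd, and \<open>parity\<close>
  counts it as even.\<close>

lemma parity_mult:
  assumes "x \<in> homogeneous" "y \<in> homogeneous" "x * y \<noteq> 0"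
  shows "parity (x * y) = parity x * parity y"
proof -
  have "z \<notin> even_part" if "z \<in> odd_part" "z \<noteq> 0" for z using part_disjoint that by blast
  then show ?thesis
    using assms part_mult by (auto simp: homogeneous_def parity_def)
qed

lemma unit_norm_mult:
  assumes "x \<in> unit_norm" "y \<in> unit_norm"
  shows "x * y \<in> unit_norm"
proof -
  obtain n where x: "x \<in> homogeneous" "x \<in> range lin" "n = 1 \<or> n = - 1" "x * star x = of_int n"
    using unit_normE[OF assms(1)] by metis
  obtain m where y: "y \<in> homogeneous" "y \<in> range lin" "m = 1 \<or> m = - 1" "y * star y = of_int m"
    using unit_normE[OF assms(2)] by metis
  have "x * y * star (x * y) = x * (y * star y) * star x"
    by (simp add: star_mult x(2) y(2) mult.assoc)
  also have "\<dots> = of_int (n * m)"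
    unfolding y(4) using x(4) by (simp add: scalars mult_ac)
  finally show ?thesis
    using x(1,3) y(1,3) by (auto simp: unit_norm_def homogeneous_mult)
qed

lemma unit_norm_star:
  assumes "x \<in> unit_norm"
  shows "star x \<in> unit_norm"
proof -
  obtain n where x: "x \<in> homogeneous" "x \<in> range lin" "n = 1 \<or> n = - 1" "star x * x = of_int n"
    using unit_normE[OF assms] by metis
  have "star x * star (star x) = of_int n" using x by (simp add: star_star)
  then show ?thesis using x by (auto simp: unit_norm_def homogeneous_star)
qed

lemma unit_norm_uminus:
  assumes "x \<in> unit_norm"
  shows "- x \<in> unit_norm"
  using assms by (auto simp: unit_norm_def homogeneous_def part_uminus star_uminus)

lemma unit_norm_one: "1 \<in> unit_norm"
  by (simp add: unit_norm_def homogeneous_def)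

lemma unit_norm_range: "x \<in> unit_norm \<Longrightarrow> x \<in> range lin"
  by (auto elim: unit_normE)

section \<open>The two groups, the kernel and the image\<close>

lemma pm_group_simps:
  "x \<otimes>\<^bsub>clifford_pm_group form\<^esub> y = x \<otimes>\<^bsub>clifford form\<^esub> y"
  "\<one>\<^bsub>clifford_pm_group form\<^esub> = \<one>\<^bsub>clifford form\<^esub>"
  by (simp_all add: clifford_pm_group_def)

lemma group_pm_group: "group (clifford_pm_group form)"
proof (rule groupI, unfold carrier_pm_group pm_group_simps)
  interpret ring "clifford form" by (rule ring_clifford)
  show "\<one>\<^bsub>clifford form\<^esub> \<in> to_clifford ` unit_norm"
    using unit_norm_one by (auto simp: to_clifford_one[symmetric])
  fix X assume "X \<in> to_clifford ` unit_norm"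
  then obtain x where x: "x \<in> unit_norm" "X = to_clifford x" by blast
  show "\<one>\<^bsub>clifford form\<^esub> \<otimes>\<^bsub>clifford form\<^esub> X = X"
    by (simp add: x to_clifford_closed unit_norm_range)
  obtain n where n: "n = 1 \<or> n = - 1" "star x * x = of_int n"
    using unit_normE[OF x(1)] by metis
  have "sc n (star x) \<in> unit_norm"
    using n(1) x(1) by (auto simp: scalars unit_norm_star unit_norm_uminus)
  moreover have "to_clifford (sc n (star x)) \<otimes>\<^bsub>clifford form\<^esub> X = \<one>\<^bsub>clifford form\<^esub>"
    using calculation n
        by (auto simp: x to_clifford_mult[symmetric] unit_norm_range to_clifford_one[symmetric]
            scalars)
  ultimately show "\<exists>Y\<in>to_clifford ` unit_norm. Y \<otimes>\<^bsub>clifford form\<^esub> X = \<one>\<^bsub>clifford form\<^esub>" by blast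
  fix Y assume "Y \<in> to_clifford ` unit_norm"
  then obtain y where y: "y \<in> unit_norm" "Y = to_clifford y" by blast
  show "X \<otimes>\<^bsub>clifford form\<^esub> Y \<in> to_clifford ` unit_norm"
    using unit_norm_mult[OF x(1) y(1)]
        by (auto simp: x y to_clifford_mult[symmetric] unit_norm_range)
  fix Z assume "Z \<in> to_clifford ` unit_norm"
  then show "X \<otimes>\<^bsub>clifford form\<^esub> Y \<otimes>\<^bsub>clifford form\<^esub> Z = X \<otimes>\<^bsub>clifford form\<^esub> (Y \<otimes>\<^bsub>clifford form\<^esub> Z)"
    by (auto simp: x y m_assoc to_clifford_closed unit_norm_range)
qed

lemma disc_kernel_simps:
  "g \<otimes>\<^bsub>disc_kernel scale form\<^esub> h = g \<circ> h" "\<one>\<^bsub>disc_kernel scale form\<^esub> = id"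
  by (simp_all add: disc_kernel_def orthogonal_group_def)

lemma group_disc_kernel: "group (disc_kernel scale form)"
proof (rule groupI, unfold disc_kernel_simps)
  interpret id: module_hom scale scale id by standard simp_all
  show "id \<in> carrier (disc_kernel scale form)"
    unfolding disc_kernel_iff using form_scale_left[of 0 0]
    by (auto simp: id.module_hom_axioms intro!: exI[of _ 0])
  fix g assume g: "g \<in> carrier (disc_kernel scale form)"
  then have bg: "bij g" and lg: "Modules.module_hom scale scale g"
    and ig: "form (g x) (g y) = form x y"
    and dg: "\<And>f. Modules.module_hom scale (*) f \<Longrightarrow> \<exists>w. \<forall>v. f (inv_into UNIV g v) - f v = form w v"
        for x y
    unfolding disc_kernel_iff by auto
  interpret g: Modules.module_hom scale scale g by (rule lg)
  let ?g' = "inv_into UNIV g"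
  have gg': "g (?g' v) = v" and g'g: "?g' (g v) = v" for v
    using bg by (simp_all add: bij_is_surj surj_f_inv_f bij_is_inj)
  show "id \<circ> g = g" by simp
  show "g \<circ> h \<circ> k = g \<circ> (h \<circ> k)" for h k by (rule comp_assoc)
  have "?g' \<in> carrier (disc_kernel scale form)"
    unfolding disc_kernel_iff
  proof (intro conjI allI impI)
    show "bij ?g'" using bg by (rule bij_imp_bij_inv)
    show "Modules.module_hom scale scale ?g'"
    proof (rule module_hom.intro[OF module_axioms module_axioms module_hom_axioms.intro])
      show "?g' (x + y) = ?g' x + ?g' y" for x y
        using g.add[of "?g' x" "?g' y"] by (metis gg' g'g)
      show "?g' (scale k x) = scale k (?g' x)" for k x
        using g.scale[of k "?g' x"] by (metis gg' g'g)
    qed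
    show "form (?g' x) (?g' y) = form x y" for x y
      using ig[of "?g' x" "?g' y"] by (simp add: gg')
    fix f assume "Modules.module_hom scale (*) f"
    then obtain w where w: "\<And>v. f (?g' v) - f v = form w v" using dg by blast
    \<comment> \<open>The relation for \<open>g\<close>, read at \<open>g v\<close>, with the
      isometry moved to the other argument of the form.\<close>
    have "f (g v) - f v = form (- ?g' w) v" for v
      using w[of "g v"] ig[of "?g' w" v] by (simp add: g'g gg' form_uminus_left)
    then show "\<exists>w. \<forall>v. f (inv_into UNIV ?g' v) - f v = form w v"
      using bg by (auto simp: inv_inv_eq)
  qed
  moreover have "?g' \<circ> g = id" by (simp add: fun_eq_iff g'g)
  ultimately show "\<exists>h\<in>carrier (disc_kernel scale form). h \<circ> g = id" by blast
  fix h assume h: "h \<in> carrier (disc_kernel scale form)"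
  then have bh: "bij h" and lh: "Modules.module_hom scale scale h"
    and ih: "form (h x) (h y) = form x y"
    and dh: "\<And>f. Modules.module_hom scale (*) f \<Longrightarrow> \<exists>w. \<forall>v. f (inv_into UNIV h v) - f v = form w v"
        for x y
    unfolding disc_kernel_iff by auto
  have hh': "h (inv_into UNIV h v) = v" for v
    using bh by (simp_all add: bij_is_surj surj_f_inv_f)
  show "g \<circ> h \<in> carrier (disc_kernel scale form)"
    unfolding disc_kernel_iff
  proof (intro conjI allI impI)
    show "bij (g \<circ> h)" using bg bh by (rule bij_comp[rotated])
    show "Modules.module_hom scale scale (g \<circ> h)" using lh lg by (rule module_hom_compose)
    show "form ((g \<circ> h) x) ((g \<circ> h) y) = form x y" for x y by (simp add: ig ih)
    fix f assume f: "Modules.module_hom scale (*) f"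
    obtain w where w: "\<And>v. f (?g' v) - f v = form w v" using dg[OF f] by blast
    obtain u where u: "\<And>v. f (inv_into UNIV h v) - f v = form u v" using dh[OF f] by blast
    have "f (inv_into UNIV (g \<circ> h) v) - f v = form (g u + w) v" for v
    proof -
      have "f (inv_into UNIV h (?g' v)) - f (?g' v) = form (g u) v"
        using u[of "?g' v"] ig[of u "?g' v"] by (simp add: gg')
      moreover have "inv_into UNIV (g \<circ> h) v = inv_into UNIV h (?g' v)"
        using bg bh by (simp add: o_inv_distrib)
      ultimately show ?thesis using w[of v] by (simp add: form_add_left)
    qed
    then show "\<exists>w. \<forall>v. f (inv_into UNIV (g \<circ> h) v) - f v = form w v" by blast
  qed
qed

lemma implements_scalar:
  assumes "n = 1 \<or> n = - 1"
  shows "implements (of_int n) (n * n) 1 id"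
  using assms by (auto simp: implements_def homogeneous_def part_uminus star_uminus)

lemma parity_star:
  assumes "x \<in> unit_norm"
  shows "parity (star x) = parity x"
proof -
  have "star x \<in> even_part \<longleftrightarrow> x \<in> even_part"
    using star_part(1) star_star[OF unit_norm_range[OF assms]] by metis
  then show ?thesis by (simp add: parity_def)
qed

lemma parity_cases: "parity x = 1 \<or> parity x = - 1"
  by (simp add: parity_def)

text \<open>The product \<open>x * star x\<close> is 1 or -1, and such a scalar implements the
  identity.\<close>

lemma clifford_isometry_star:
  assumes "x \<in> unit_norm"
  shows "clifford_isometry form (to_clifford x) (clifford_isometry form (to_clifford (star x)) v)
      = v"
proof -
  obtain n where n: "n = 1 \<or> n = - 1" "x * star x = of_int n" "star x * x = of_int n"
      "x \<in> range lin"
    using unit_normE[OF assms] by metis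
  let ?g = "clifford_isometry form (to_clifford x)" and ?g' =
      "clifford_isometry form (to_clifford (star x))"
  have "implements (x * star x) (n * n) (parity x * parity (star x)) (?g \<circ> ?g')"
    by (rule implements_compose) (use n assms in \<open>auto intro!: clifford_isometry_implemented
        unit_norm_star simp: star_star\<close>)
  moreover have "parity x * parity (star x) = 1"
    using parity_star[OF assms] parity_cases[of x] by auto
  ultimately have "implements (of_int n) (n * n) 1 (?g \<circ> ?g')" by (simp add: n)
  then have "?g \<circ> ?g' = id" using implements_scalar[OF n(1)] by (rule implements_unique)
  then show ?thesis by (metis comp_apply id_apply)
qed

text \<open>Every functional is the \<open>skew_functional\<close> of an even element, and for norm
  1 or -1 \<open>imp_dual_action\<close> shows directly that its change is some
  \<open>form w\<close>.\<close>

lemma clifford_isometry_in_disc_kernel: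
  assumes "x \<in> unit_norm"
  shows "clifford_isometry form (to_clifford x) \<in> carrier (disc_kernel scale form)"
proof -
  obtain n where n: "n = 1 \<or> n = - 1" "x * star x = of_int n" "x \<in> range lin" "x \<in> homogeneous"
    using unit_normE[OF assms] by metis
  let ?g = "clifford_isometry form (to_clifford x)" and ?g' =
      "clifford_isometry form (to_clifford (star x))"
  have imp: "implements x n (parity x) ?g" using assms n(2) by (rule clifford_isometry_implemented)
  have gg': "?g (?g' v) = v" for v using assms by (rule clifford_isometry_star)
  have g'g: "?g' (?g v) = v" for v
    using clifford_isometry_star[OF unit_norm_star[OF assms]] by (simp add: star_star n(3))
  have bij: "bij ?g" by (rule o_bij[of ?g']) (simp_all add: fun_eq_iff gg' g'g)
  have inv: "inv_into UNIV ?g = ?g'" by (rule inv_equality) (simp_all add: gg' g'g)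
  have "\<exists>w. \<forall>v. f (inv_into UNIV ?g v) - f v = form w v" if f: "Modules.module_hom scale (*) f"
      for f
  proof -
    obtain y where y: "y \<in> even_part" "f = skew_functional y"
        using functional_is_skew_functional[OF f] .
    obtain z where z: "x * y - twist x y * x = z * delta"
      "x \<in> even_part \<Longrightarrow> z \<in> odd_part" "x \<notin> even_part \<Longrightarrow> z \<in> even_part"
      using twist_witness_ex[OF n(4) y(1)] by metis
    obtain w where w: "z * star x = vec w"
      using twist_witness_in_lattice[OF disc_nonzero n(4) y(1) z] vec_elt_is_vec by metis
    have act: "n * (skew_functional y (?g' v) - skew_functional y v) = parity x * form w v" for v
      by (rule imp_dual_action[OF imp gg' y(1) _ z(1) w]) (simp add: parity_def)
    have "f (inv_into UNIV ?g v) - f v = form (scale (n * parity x) w) v" for v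
    proof -
      have "skew_functional y (?g' v) - skew_functional y v =
          n * (n * (skew_functional y (?g' v) - skew_functional y v))" using n(1) by auto
      then show ?thesis unfolding act inv y(2) form_scale_left by (simp add: mult.assoc)
    qed
    then show ?thesis by blast
  qed
  then show ?thesis
    unfolding disc_kernel_iff using bij imp_linear[OF imp] imp_isometry[OF imp] by blast
qed

lemma disc_kernel_surjective:
  assumes "g \<in> carrier (disc_kernel scale form)"
  obtains x where "x \<in> unit_norm" "clifford_isometry form (to_clifford x) = g"
proof -
  have g: "bij g" "Modules.module_hom scale scale g" "\<And>x y. form (g x) (g y) = form x y"
    "\<And>f. Modules.module_hom scale (*) f \<Longrightarrow> \<exists>w. \<forall>v. f (inv_into UNIV g v) - f v = form w v"
    using assms unfolding disc_kernel_iff by auto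
  have sim: "similitude 1 g"
    using g(2,3) by (simp add: similitude_def module_hom.add module_hom.scale)
  obtain x n e where x: "implements x n e g" "matching x e"
    and prim: "\<And>p y. prime p \<Longrightarrow> y \<in> homogeneous \<Longrightarrow> x \<noteq> of_int p * y"
    using isometry_implemented_primitive[OF sim] by metis
  have gg': "g (inv_into UNIV g v) = v" for v
    using g(1) by (simp add: bij_is_surj surj_f_inv_f)
  have n: "n = 1 \<or> n = - 1"
    using primitive_unit_norm[OF x prim gg' g(4)] by blast
  then have u: "x \<in> unit_norm"
    using imp_hom[OF x(1)] imp_norm[OF x(1)] by (auto simp: unit_norm_def)
  have "parity x = e" using x(2) imp_e[OF x(1)] by (auto simp: matching_def parity_def)
  then have "clifford_isometry form (to_clifford x) = g"
    using clifford_isometry_implemented[OF u imp_norm[OF x(1)]] x(1) implements_unique by metis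
  with u show ?thesis by (rule that)
qed

lemma clifford_isometry_mult:
  assumes "x \<in> unit_norm" "y \<in> unit_norm"
  shows "clifford_isometry form (to_clifford x \<otimes>\<^bsub>clifford form\<^esub> to_clifford y) =
    clifford_isometry form (to_clifford x) \<circ> clifford_isometry form (to_clifford y)"
proof -
  obtain n where n: "x * star x = of_int n" "x \<in> range lin" "x \<in> homogeneous"
    using unit_normE[OF assms(1)] by metis
  obtain m where m: "y * star y = of_int m" "y \<in> range lin" "y \<in> homogeneous"
    using unit_normE[OF assms(2)] by metis
  note xy = unit_norm_mult[OF assms]
  obtain k where k: "x * y * star (x * y) = of_int k"
    using unit_normE[OF xy] by metis
  have "parity (x * y) = parity x * parity y"
    using n(3) m(3) unit_norm_nonzero[OF xy] by (rule parity_mult)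
  then have "implements (x * y) k (parity x * parity y) (clifford_isometry form (to_clifford (x *
      y)))"
    using clifford_isometry_implemented[OF xy k] by simp
  moreover have "implements (x * y) (n * m) (parity x * parity y)
      (clifford_isometry form (to_clifford x) \<circ> clifford_isometry form (to_clifford y))"
    using clifford_isometry_implemented[OF assms(1) n(1)] clifford_isometry_implemented[OF
        assms(2) m(1)]
    by (rule implements_compose)
  ultimately have "clifford_isometry form (to_clifford (x * y)) =
    clifford_isometry form (to_clifford x) \<circ> clifford_isometry form (to_clifford y)"
    by (rule implements_unique)
  then show ?thesis by (simp add: to_clifford_mult n(2) m(2))
qed

text \<open>The determinant of the identity forces \<open>x\<close> to be even. Then
  \<open>x\<close> commutes with all vectors, so its commutators vanish and its non-scalar
  coordinates are 0.\<close>

lemma clifford_isometry_eq_id_iff: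
  assumes "x \<in> unit_norm"
  shows "clifford_isometry form (to_clifford x) = id \<longleftrightarrow> x = 1 \<or> x = - 1"
proof -
  obtain n where n: "n = 1 \<or> n = - 1" "x * star x = of_int n" "star x * x = of_int n"
    using unit_normE[OF assms] by metis
  note imp = clifford_isometry_implemented[OF assms n(2)]
  show ?thesis
  proof
    assume "clifford_isometry form (to_clifford x) = id"
    then have id: "implements x n (parity x) id" using imp by simp
    have "parity x = 1" using imp_det[OF id] by (simp add: det3_def)
    then have "x \<in> even_part" by (simp add: parity_def split: if_splits)
    then obtain x0 x1 x2 x3 where x: "x = even_elt x0 x1 x2 x3" by (rule even_partE)
    have com: "vec v * x = x * vec v" for v
    proof -
      have "of_int n * (vec v * x) = of_int n * vec (id v) * x" by (simp add: mult.assoc)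
      also have "\<dots> = x * vec v * (star x * x)"
        unfolding imp_eq[OF id] \<open>parity x = 1\<close> by (simp add: mult.assoc)
      also have "\<dots> = of_int n * (x * vec v)" unfolding n(3) by (simp add: mult_of_int_commute)
      finally show ?thesis using imp_nz[OF id] by (simp add: of_int_mult_cancel)
    qed
    then have "E1 * x = x * E1" "E2 * x = x * E2" "E3 * x = x * E3"
      using vec_basis by metis+
    then have "x * (E2 * E3) - (E2 * E3) * x = 0" "x * (E1 * E3) - (E1 * E3) * x = 0"
      by (simp_all add: mult.assoc) (simp_all add: mult.assoc[symmetric])
    then have "vec_elt 0 (- x3) (- x2) * delta = 0 * delta"
        "vec_elt (- x3) 0 x1 * delta = 0 * delta"
      unfolding x lin_monomials even_commutator by simp_all
    then have "vec_elt 0 (- x3) (- x2) = 0" "vec_elt (- x3) 0 x1 = 0"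
      using delta_cancel[OF disc_nonzero] by blast+
    then have 0: "x1 = 0" "x2 = 0" "x3 = 0" by (simp_all add: lin_zero[symmetric])
    have "n = x0 * x0" using even_norm_eq[of x0 x1 x2 x3 n] n(2) by (simp add: x 0)
    \<comment> \<open>The norm is now a square, which excludes -1.\<close>
    then have "x0 * x0 = 1" using n(1) by (smt (verit) zero_le_square)
    then have "x0 = 1 \<or> x0 = - 1" using square_eq_1_iff[of x0] by (simp add: power2_eq_square)
    then show "x = 1 \<or> x = - 1" unfolding x 0 lin_of_int[symmetric] by auto
  next
    assume x: "x = 1 \<or> x = - 1"
    then have "x = of_int 1 \<or> x = of_int (- 1)" by simp
    then have "implements x 1 1 id" using implements_scalar[of 1] implements_scalar[of "- 1"]
        by auto
    moreover have "parity x = 1" using x by (auto simp: parity_def part_uminus)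
    ultimately show "clifford_isometry form (to_clifford x) = id"
      using imp implements_unique by metis
  qed
qed

lemma clifford_pm_group_conj:
  assumes "\<alpha> \<in> carrier (clifford_pm_group form)"
  shows "\<alpha> \<in> Units (clifford form)" "clifford_conj form \<alpha> v \<in> range (clifford_vec form)"
proof -
  obtain x where x: "x \<in> unit_norm" "\<alpha> = to_clifford x" using assms by (auto simp: carrier_pm_group)
  obtain n where n: "x * star x = of_int n" "x \<in> homogeneous" using unit_normE[OF x(1)] by metis
  show "\<alpha> \<in> Units (clifford form)" using unit_inverse(1)[OF x(1) n(1)] x(2) by simp
  obtain w where "x * vec v * star x = vec w" using conj_vec[OF n(2)] by blast
  then have "clifford_conj form \<alpha> v = clifford_vec form (scale n w)"
    by (simp add: x(2) clifford_conj_to_clifford[OF x(1) n(1)] clifford_vec_to_clifford vec_scale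
        sc_def)
  then show "clifford_conj form \<alpha> v \<in> range (clifford_vec form)" by simp
qed

lemma group_hom_clifford_isometry:
  "group_hom (clifford_pm_group form) (disc_kernel scale form) (clifford_isometry form)"
proof (rule group_hom.intro[OF group_pm_group group_disc_kernel group_hom_axioms.intro])
  show "clifford_isometry form \<in> hom (clifford_pm_group form) (disc_kernel scale form)"
    unfolding hom_def carrier_pm_group
    by (auto simp: clifford_isometry_in_disc_kernel clifford_isometry_mult pm_group_simps
        disc_kernel_simps)
qed

lemma kernel_clifford_isometry:
  "kernel (clifford_pm_group form) (disc_kernel scale form) (clifford_isometry form) =
      clifford_pm1 form"
proof -
  have "kernel (clifford_pm_group form) (disc_kernel scale form) (clifford_isometry form) =
     to_clifford ` {x \<in> unit_norm. clifford_isometry form (to_clifford x) = id}"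
    by (auto simp: kernel_def carrier_pm_group disc_kernel_simps)
  also have "{x \<in> unit_norm. clifford_isometry form (to_clifford x) = id} = {1, - 1}"
    using unit_norm_one unit_norm_uminus[OF unit_norm_one]
        by (auto simp: clifford_isometry_eq_id_iff)
  finally show ?thesis by (simp add: clifford_pm1_to_clifford)
qed

lemma clifford_isometry_onto:
  "clifford_isometry form ` carrier (clifford_pm_group form) = carrier (disc_kernel scale form)"
proof
  show "clifford_isometry form ` carrier (clifford_pm_group form) \<subseteq> carrier (disc_kernel scale
      form)"
    by (auto simp: carrier_pm_group clifford_isometry_in_disc_kernel)
  show "carrier (disc_kernel scale form) \<subseteq> clifford_isometry form ` carrier (clifford_pm_group
      form)"
  proof
    fix g assume "g \<in> carrier (disc_kernel scale form)"
    then obtain x where "x \<in> unit_norm" "clifford_isometry form (to_clifford x) = g"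
      by (rule disc_kernel_surjective)
    then show "g \<in> clifford_isometry form ` carrier (clifford_pm_group form)"
      by (auto simp: carrier_pm_group)
  qed
qed

lemma clifford_pm1_normal: "clifford_pm1 form \<lhd> clifford_pm_group form"
  using group_hom.normal_kernel[OF group_hom_clifford_isometry]
      by (simp add: kernel_clifford_isometry)

text \<open>The first isomorphism theorem; \<open>the_elem\<close> picks the common value on a
  coset.\<close>

lemma clifford_isometry_iso:
  "\<exists>\<Phi> \<in> iso (clifford_pm_group form Mod clifford_pm1 form) (disc_kernel scale form).
     \<forall>\<alpha> \<in> carrier (clifford_pm_group form).
       \<Phi> (clifford_pm1 form #>\<^bsub>clifford_pm_group form\<^esub> \<alpha>) = clifford_isometry form \<alpha>"
proof (intro bexI ballI)
  let ?h = "clifford_isometry form"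
  show "(\<lambda>X. the_elem (?h ` X)) \<in> iso (clifford_pm_group form Mod clifford_pm1 form) (disc_kernel
      scale form)"
    using group_hom.FactGroup_iso_set[OF group_hom_clifford_isometry clifford_isometry_onto]
    by (simp add: kernel_clifford_isometry)
  fix \<alpha> assume \<alpha>: "\<alpha> \<in> carrier (clifford_pm_group form)"
  interpret group_hom "clifford_pm_group form" "disc_kernel scale form" ?h
    by (rule group_hom_clifford_isometry)
  have "?h \<beta> = ?h \<alpha>" if "\<beta> \<in> clifford_pm1 form #>\<^bsub>clifford_pm_group form\<^esub> \<alpha>" for \<beta>
  proof -
    obtain \<gamma> where \<gamma>: "\<gamma> \<in> clifford_pm1 form" "\<beta> = \<gamma> \<otimes>\<^bsub>clifford_pm_group form\<^esub> \<alpha>"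
      using \<open>\<beta> \<in> _\<close> by (auto simp: r_coset_def)
    then have "\<gamma> \<in> carrier (clifford_pm_group form)" "?h \<gamma> = \<one>\<^bsub>disc_kernel scale form\<^esub>"
      by (auto simp: kernel_clifford_isometry[symmetric] kernel_def)
    then show ?thesis using \<alpha> \<gamma>(2) by simp
  qed
  moreover have "\<alpha> \<in> clifford_pm1 form #>\<^bsub>clifford_pm_group form\<^esub> \<alpha>"
    by (rule G.rcos_self[OF \<alpha> normal_imp_subgroup[OF clifford_pm1_normal]])
  ultimately have "?h ` (clifford_pm1 form #>\<^bsub>clifford_pm_group form\<^esub> \<alpha>) = {?h \<alpha>}" by blast
  then show "the_elem (?h ` (clifford_pm1 form #>\<^bsub>clifford_pm_group form\<^esub> \<alpha>)) = ?h \<alpha>" by simp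
qed

lemma det_clifford_isometry:
  assumes "\<alpha> \<in> carrier (clifford_pm_group form)"
  shows "det (endo_matrix scale [e1, e2, e3] (clifford_isometry form \<alpha>)) = clifford_sign form \<alpha>"
proof -
  obtain x where x: "x \<in> unit_norm" "\<alpha> = to_clifford x" using assms by (auto simp: carrier_pm_group)
  obtain n where n: "x * star x = of_int n" using unit_normE[OF x(1)] by metis
  show ?thesis
    unfolding det_endo_matrix x(2) clifford_sign_to_clifford[OF x(1)]
    by (rule imp_det[OF clifford_isometry_implemented[OF x(1) n]])
qed

end

lemma ternary_latticeI:
  assumes "int_lattice scale form" "even_form form" "nondegenerate_form form"
    "ordered_basis scale [e1, e2, e3]"
  shows "ternary_lattice scale form (form e1 e1 div 2) (form e2 e2 div 2) (form e3 e3 div 2)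
    (form e2 e3) (form e1 e3) (form e1 e2) e1 e2 e3"
  using assms by (auto simp: ternary_lattice_def ternary_lattice_axioms_def even_form_def)

theorem theorem3p1:
  fixes scale :: "int \<Rightarrow> 'a::ab_group_add \<Rightarrow> 'a"
    and form :: "'a \<Rightarrow> 'a \<Rightarrow> int"
  assumes "int_lattice scale form"
    and "even_form form"
    and "nondegenerate_form form"
    and "has_rank scale 3"
  shows "(\<forall>\<alpha> \<in> carrier (clifford_pm_group form). \<forall>v.
            \<alpha> \<in> Units (clifford form) \<and> clifford_conj form \<alpha> v \<in> range (clifford_vec form)) \<and>
         clifford_pm1 form \<lhd> clifford_pm_group form \<and>
         group (disc_kernel scale form) \<and>
         (\<exists>\<Phi> \<in> iso (clifford_pm_group form Mod clifford_pm1 form) (disc_kernel scale form).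
            \<forall>\<alpha> \<in> carrier (clifford_pm_group form).
              \<Phi> (clifford_pm1 form #>\<^bsub>clifford_pm_group form\<^esub> \<alpha>) = clifford_isometry form \<alpha>) \<and>
         (\<forall>\<alpha> \<in> carrier (clifford_pm_group form). \<forall>bs. ordered_basis scale bs \<longrightarrow>
            det (endo_matrix scale bs (clifford_isometry form \<alpha>)) = clifford_sign form \<alpha>)"
proof -
  have list3: "\<exists>e1 e2 e3. bs = [e1, e2, e3]" if "length bs = 3" for bs :: "'a list"
    using that by (auto simp: length_Suc_conv numeral_3_eq_3)
  obtain e1 e2 e3 where "ordered_basis scale [e1, e2, e3]"
    using assms(4) list3 unfolding has_rank_def by blast
  from ternary_latticeI[OF assms(1-3) this]
  interpret ternary_lattice scale form "form e1 e1 div 2" "form e2 e2 div 2" "form e3 e3 div 2"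
    "form e2 e3" "form e1 e3" "form e1 e2" e1 e2 e3 .
  have "det (endo_matrix scale bs (clifford_isometry form \<alpha>)) = clifford_sign form \<alpha>"
    if bs: "ordered_basis scale bs" and \<alpha>: "\<alpha> \<in> carrier (clifford_pm_group form)" for bs \<alpha>
  proof -
    \<comment> \<open>Any ordered basis has three elements, so the locale can be instantiated anew
      with it and the determinant formula transfers from the fixed basis.\<close>
    obtain b1 b2 b3 where b: "bs = [b1, b2, b3]" using list3 basis_length[OF bs] by blast
    show ?thesis
      using ternary_lattice.det_clifford_isometry[OF ternary_latticeI[OF assms(1-3)] \<alpha>] bs
      unfolding b by blast
  qed
  then show ?thesis
    using clifford_pm_group_conj clifford_pm1_normal group_disc_kernel clifford_isometry_iso
        by blast
qed

end
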